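(* Let $d\ge 1$ and $m\ge 1$ be integers and let $\lambda\vdash m$ be a partition. The multiplicity $\mathrm{mult}_{\lambda}(\mathfrak{sl}_2(\mathbb{C}),\rho^{(d)})$ is non-zero only if $\lambda$ has at most $3$ non-zero parts, i.e. $\lambda=(\lambda_1,\lambda_2,\lambda_3)$, and in this case \[\mathrm{mult}_{\lambda}(\mathfrak{sl}_2(\mathbb{C}),\rho^{(d)})\le 3^{d-2}.\]
   Context: $\mathfrak{sl}_2(\mathbb{C})$ is the Lie algebra of traceless $2\times 2$ complex matrices, and $\rho^{(d)}:\mathfrak{sl}_2(\mathbb{C})\to\mathfrak{gl}(\mathbb{C}^d)=\mathbb{C}^{d\times d}$ is its $d$-dimensional irreducible representation (unique up to isomorphism). Let $F=\mathbb{C}\langle x_1,x_2,\dots\rangle$ be the free associative $\mathbb{C}$-algebra of countable rank and $F_m=\mathbb{C}\langle x_1,\dots,x_m\rangle\subset F$. Let $I(\mathfrak{sl}_2(\mathbb{C}),\rho^{(d)})$ be the ideal of $F$ consisting of all $f$ such that, if $f\in F_m$, then $f(\rho^{(d)}(A_1),\dots,\rho^{(d)}(A_m))=0$ in $\mathbb{C}^{d\times d}$ for all $A_1,\dots,A_m\in\mathfrak{sl}_2(\mathbb{C})$. Let $P_m=\mathrm{Span}_{\mathbb{C}}\{x_{\pi(1)}\cdots x_{\pi(m)}\mid \pi\in S_m\}\subset F_m$ be the multilinear component. The symmetric group $S_m$ acts on $F_m$ by algebra automorphisms $\pi: x_i\mapsto x_{\pi(i)}$, and $P_m$ and $I(\mathfrak{sl}_2(\mathbb{C}),\rho^{(d)})\cap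 P_m$ are $S_m$-invariant. For a partition $\lambda\vdash m$, $\chi^\lambda$ denotes the irreducible $S_m$-character associated to $\lambda$, and $\mathrm{mult}_{\lambda}(\mathfrak{sl}_2(\mathbb{C}),\rho^{(d)})$ is the multiplicity of $\chi^\lambda$ in the character of the $S_m$-module $P_m/(I(\mathfrak{sl}_2(\mathbb{C}),\rho^{(d)})\cap P_m)$. *)

theory Defs
  imports
    "Jordan_Normal_Form.Matrix"
    "HOL-Library.Poly_Mapping"
    "HOL-Combinatorics.Permutations"
begin

section \<open>Formal linear combinations\<close>

text \<open>
  For a set \<open>K\<close> of symbols, \<open>K \<Rightarrow>\<^sub>0 complex\<close> is the complex vector space with basis \<open>K\<close>. It is used
  both for the free associative algebra (basis: words) and for the group algebra of a
  symmetric group (basis: permutations).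
\<close>

definition lc_scale :: "complex \<Rightarrow> ('k \<Rightarrow>\<^sub>0 complex) \<Rightarrow> ('k \<Rightarrow>\<^sub>0 complex)" where
  "lc_scale c f = Poly_Mapping.map ((*) c) f"

lemma lookup_lc_scale [simp]: "Poly_Mapping.lookup (lc_scale c f) k = c * Poly_Mapping.lookup f k"
  by (simp add: lc_scale_def Poly_Mapping.map.rep_eq when_def)

interpretation lc: Vector_Spaces.vector_space "lc_scale :: complex \<Rightarrow> ('k \<Rightarrow>\<^sub>0 complex) \<Rightarrow> _"
  by unfold_locales (auto intro!: poly_mapping_eqI simp: lookup_add algebra_simps)

text \<open>The linear map that sends each basis symbol \<open>k\<close> to the basis symbol \<open>\<phi> k\<close>.\<close>

definition lc_map :: "('k \<Rightarrow> 'l) \<Rightarrow> ('k \<Rightarrow>\<^sub>0 complex) \<Rightarrow> ('l \<Rightarrow>\<^sub>0 complex)" where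
  "lc_map \<phi> f = (\<Sum>k\<in>Poly_Mapping.keys f. Poly_Mapping.single (\<phi> k) (Poly_Mapping.lookup f k))"


section \<open>Traces on quotient spaces\<close>

text \<open>
  For subspaces \<open>W \<subseteq> V\<close>, the residue classes modulo \<open>W\<close> of the elements of \<open>B\<close> form a (finite) basis
  of \<open>V / W\<close>, and different elements of \<open>B\<close> have different classes.
\<close>

definition quot_basis ::
  "('k \<Rightarrow>\<^sub>0 complex) set \<Rightarrow> ('k \<Rightarrow>\<^sub>0 complex) set \<Rightarrow> ('k \<Rightarrow>\<^sub>0 complex) set \<Rightarrow> bool" where
  "quot_basis V W B \<longleftrightarrow> finite B \<and> B \<subseteq> V \<and>
     (\<forall>v\<in>V. \<exists>!c. (\<forall>b. b \<notin> B \<longrightarrow> c b = 0) \<and> v - (\<Sum>b\<in>B. lc_scale (c b) b) \<in> W)"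

definition quot_coords ::
  "('k \<Rightarrow>\<^sub>0 complex) set \<Rightarrow> ('k \<Rightarrow>\<^sub>0 complex) set \<Rightarrow> ('k \<Rightarrow>\<^sub>0 complex) \<Rightarrow> ('k \<Rightarrow>\<^sub>0 complex) \<Rightarrow> complex" where
  "quot_coords W B v = (THE c. (\<forall>b. b \<notin> B \<longrightarrow> c b = 0) \<and> v - (\<Sum>b\<in>B. lc_scale (c b) b) \<in> W)"

text \<open>
  The trace of the endomorphism of the finite-dimensional space \<open>V / W\<close> induced by a linear map \<open>T\<close>
  that preserves \<open>V\<close> and \<open>W\<close>; as usual it does not depend on the basis.
\<close>

definition quot_trace ::
  "('k \<Rightarrow>\<^sub>0 complex) set \<Rightarrow> ('k \<Rightarrow>\<^sub>0 complex) set \<Rightarrow> (('k \<Rightarrow>\<^sub>0 complex) \<Rightarrow> ('k \<Rightarrow>\<^sub>0 complex)) \<Rightarrow> complex" where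
  "quot_trace V W T = (let B = (SOME B. quot_basis V W B) in \<Sum>b\<in>B. quot_coords W B (T b) b)"


section \<open>Irreducible characters of the symmetric groups\<close>

text \<open>The symmetric group \<open>S\<^sub>m\<close> is realised as the permutations of \<open>{..<m}\<close>.\<close>

definition sym_group :: "nat \<Rightarrow> (nat \<Rightarrow> nat) set" where
  "sym_group m = {p. p permutes {..<m}}"

definition partitions_of :: "nat \<Rightarrow> nat list set" where
  "partitions_of m = {lam. sorted_wrt (\<ge>) lam \<and> (\<forall>k\<in>set lam. 0 < k) \<and> sum_list lam = m}"

text \<open>The entry in row \<open>r\<close>, column \<open>c\<close> of the Young tableau filled row by row with \<open>0, \<dots>, m - 1\<close>.\<close>

definition tableau_entry :: "nat list \<Rightarrow> nat \<Rightarrow> nat \<Rightarrow> nat" where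
  "tableau_entry lam r c = sum_list (take r lam) + c"

definition tableau_row :: "nat list \<Rightarrow> nat \<Rightarrow> nat set" where
  "tableau_row lam r = {tableau_entry lam r c | c. c < lam ! r}"

definition tableau_col :: "nat list \<Rightarrow> nat \<Rightarrow> nat set" where
  "tableau_col lam c = {tableau_entry lam r c | r. r < length lam \<and> c < lam ! r}"

definition row_stabilizer :: "nat list \<Rightarrow> (nat \<Rightarrow> nat) set" where
  "row_stabilizer lam = {p \<in> sym_group (sum_list lam).
     \<forall>r < length lam. p ` tableau_row lam r = tableau_row lam r}"

definition col_stabilizer :: "nat list \<Rightarrow> (nat \<Rightarrow> nat) set" where
  "col_stabilizer lam = {q \<in> sym_group (sum_list lam).
     \<forall>c. q ` tableau_col lam c = tableau_col lam c}"

text \<open>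
  The Young symmetrizer \<open>(\<Sum>p. p) (\<Sum>q. sgn q q)\<close>, with \<open>p\<close> and \<open>q\<close> ranging over the row and column
  stabilizers, as an element of the group algebra.
\<close>

definition young_symmetrizer :: "nat list \<Rightarrow> ((nat \<Rightarrow> nat) \<Rightarrow>\<^sub>0 complex)" where
  "young_symmetrizer lam =
     (\<Sum>p\<in>row_stabilizer lam. \<Sum>q\<in>col_stabilizer lam.
        Poly_Mapping.single (p \<circ> q) (of_int (sign q)))"

text \<open>
  The Specht module of shape \<open>lam\<close>: the left ideal of the group algebra generated by the Young
  symmetrizer. A permutation \<open>g\<close> acts on the group algebra by the left multiplication
  \<open>lc_map ((\<circ>) g)\<close>.
\<close>

definition specht_module :: "nat list \<Rightarrow> ((nat \<Rightarrow> nat) \<Rightarrow>\<^sub>0 complex) set" where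
  "specht_module lam =
     lc.span ((\<lambda>g. lc_map ((\<circ>) g) (young_symmetrizer lam)) ` sym_group (sum_list lam))"

definition irr_character :: "nat list \<Rightarrow> (nat \<Rightarrow> nat) \<Rightarrow> complex" where
  "irr_character lam g = quot_trace (specht_module lam) {0} (lc_map ((\<circ>) g))"

text \<open>
  The multiplicity of the irreducible character of shape \<open>lam\<close> in a character \<open>\<chi>\<close> of \<open>S\<^sub>m\<close>: its
  coefficient in the (unique) decomposition of \<open>\<chi>\<close> as a sum of irreducible characters.
\<close>

definition char_mult :: "nat \<Rightarrow> ((nat \<Rightarrow> nat) \<Rightarrow> complex) \<Rightarrow> nat list \<Rightarrow> nat" where
  "char_mult m \<chi> lam = (THE n. \<exists>c :: nat list \<Rightarrow> nat. c lam = n \<and>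
     (\<forall>g\<in>sym_group m. \<chi> g = (\<Sum>\<mu>\<in>partitions_of m. of_nat (c \<mu>) * irr_character \<mu> g)))"


section \<open>The free associative algebra\<close>

text \<open>
  Words in the variables, which are numbered from \<open>0\<close>. Concatenation is written additively, so
  that the convolution product of \<open>HOL-Library.Poly_Mapping\<close> makes \<open>word \<Rightarrow>\<^sub>0 complex\<close> the free
  associative algebra of countable rank.
\<close>

datatype word = Word (letters: "nat list")

instantiation word :: monoid_add
begin

definition zero_word :: word where "zero_word = Word []"

definition plus_word :: "word \<Rightarrow> word \<Rightarrow> word" where
  "plus_word u v = Word (letters u @ letters v)"

instance
  by standard (simp_all add: zero_word_def plus_word_def)

end

type_synonym free_alg = "word \<Rightarrow>\<^sub>0 complex"

definition free_alg_vars :: "nat \<Rightarrow> free_alg set" where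
  "free_alg_vars m = {f. \<forall>w\<in>Poly_Mapping.keys f. set (letters w) \<subseteq> {..<m}}"

definition multilinear_part :: "nat \<Rightarrow> free_alg set" where
  "multilinear_part m =
     lc.span ((\<lambda>p. Poly_Mapping.single (Word (map p [0..<m])) 1) ` sym_group m)"

text \<open>The algebra automorphism that substitutes the variable number \<open>p i\<close> for the variable number \<open>i\<close>.\<close>

definition rename_vars :: "(nat \<Rightarrow> nat) \<Rightarrow> free_alg \<Rightarrow> free_alg" where
  "rename_vars p = lc_map (\<lambda>w. Word (map p (letters w)))"

definition word_eval :: "nat \<Rightarrow> (nat \<Rightarrow> complex mat) \<Rightarrow> word \<Rightarrow> complex mat" where
  "word_eval d X w = foldr (\<lambda>i M. X i * M) (letters w) (1\<^sub>m d)"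

text \<open>The value of \<open>f\<close> at \<open>d \<times> d\<close> matrices \<open>X 0, X 1, \<dots>\<close>\<close>

definition free_alg_eval :: "nat \<Rightarrow> (nat \<Rightarrow> complex mat) \<Rightarrow> free_alg \<Rightarrow> complex mat" where
  "free_alg_eval d X f = mat d d (\<lambda>(i, j).
     \<Sum>w\<in>Poly_Mapping.keys f. Poly_Mapping.lookup f w * word_eval d X w $$ (i, j))"


section \<open>Representations of \<open>sl\<^sub>2\<close> and their weak identities\<close>

definition sl2 :: "complex mat set" where
  "sl2 = {A \<in> carrier_mat 2 2. A $$ (0, 0) + A $$ (1, 1) = 0}"

text \<open>Lie algebra representations on \<open>\<complex>\<^sup>d\<close>; the values outside \<open>sl2\<close> are irrelevant.\<close>

definition sl2_rep :: "nat \<Rightarrow> (complex mat \<Rightarrow> complex mat) \<Rightarrow> bool" where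
  "sl2_rep d \<rho> \<longleftrightarrow>
     (\<forall>A\<in>sl2. \<rho> A \<in> carrier_mat d d) \<and>
     (\<forall>A\<in>sl2. \<forall>B\<in>sl2. \<rho> (A + B) = \<rho> A + \<rho> B) \<and>
     (\<forall>c. \<forall>A\<in>sl2. \<rho> (c \<cdot>\<^sub>m A) = c \<cdot>\<^sub>m \<rho> A) \<and>
     (\<forall>A\<in>sl2. \<forall>B\<in>sl2. \<rho> (A * B - B * A) = \<rho> A * \<rho> B - \<rho> B * \<rho> A)"

definition invariant_subspace ::
  "nat \<Rightarrow> (complex mat \<Rightarrow> complex mat) \<Rightarrow> complex vec set \<Rightarrow> bool" where
  "invariant_subspace d \<rho> U \<longleftrightarrow>
     U \<subseteq> carrier_vec d \<and> 0\<^sub>v d \<in> U \<and> (\<forall>u\<in>U. \<forall>v\<in>U. u + v \<in> U) \<and> (\<forall>c. \<forall>u\<in>U. c \<cdot>\<^sub>v u \<in> U) \<and>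
     (\<forall>A\<in>sl2. \<forall>u\<in>U. \<rho> A *\<^sub>v u \<in> U)"

definition irreducible_sl2_rep :: "nat \<Rightarrow> (complex mat \<Rightarrow> complex mat) \<Rightarrow> bool" where
  "irreducible_sl2_rep d \<rho> \<longleftrightarrow> sl2_rep d \<rho> \<and> 0 < d \<and>
     (\<forall>U. invariant_subspace d \<rho> U \<longrightarrow> U = {0\<^sub>v d} \<or> U = carrier_vec d)"

definition weak_identities :: "nat \<Rightarrow> (complex mat \<Rightarrow> complex mat) \<Rightarrow> free_alg set" where
  "weak_identities d \<rho> = {f. \<forall>m. f \<in> free_alg_vars m \<longrightarrow>
     (\<forall>A. (\<forall>i<m. A i \<in> sl2) \<longrightarrow> free_alg_eval d (\<lambda>i. \<rho> (A i)) f = 0\<^sub>m d d)}"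

text \<open>The character of the \<open>S\<^sub>m\<close>-module of multilinear polynomials modulo weak identities.\<close>

definition cocharacter ::
  "nat \<Rightarrow> (complex mat \<Rightarrow> complex mat) \<Rightarrow> nat \<Rightarrow> (nat \<Rightarrow> nat) \<Rightarrow> complex" where
  "cocharacter d \<rho> m g =
     quot_trace (multilinear_part m) (weak_identities d \<rho> \<inter> multilinear_part m) (rename_vars g)"

definition sl2_mult ::
  "nat \<Rightarrow> (complex mat \<Rightarrow> complex mat) \<Rightarrow> nat \<Rightarrow> nat list \<Rightarrow> nat" where
  "sl2_mult d \<rho> m lam = char_mult m (cocharacter d \<rho> m) lam"

end

theory Submission
  imports Defs "Jordan_Normal_Form.Spectral_Radius"
begin

text \<open>
  \<^bold>\<open>Characters.\<close> With \<open>c\<close> the Young symmetrizer of shape \<open>\<lambda>\<close> one has \<open>c x c \<in> \<complex> c\<close>, \<open>c\<^sup>2 = k c\<close> with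
  \<open>k \<noteq> 0\<close>, and \<open>c x c' = 0\<close> for the symmetrizer \<open>c'\<close> of another shape. So evaluating characters at
  \<open>c / k\<close> gives functionals dual to the irreducible characters. As there are at least as many
  partitions as conjugacy classes, the irreducible characters span the class functions, and the
  multiplicity of \<open>\<chi>\<^sup>\<lambda>\<close> in the character of a module \<open>M\<close> is the rank of \<open>c\<close> on \<open>M\<close>.

  \<^bold>\<open>The bound.\<close> Here \<open>M\<close> consists of the multilinear maps \<open>sl\<^sub>2\<^sup>m \<rightarrow> gl\<^sub>d\<close> given by polynomials.
  Let \<open>c = a b\<close> with the row symmetrizer \<open>a\<close> and the column antisymmetrizer \<open>b\<close>. If \<open>\<lambda>\<close> has more
  than three rows, \<open>b M = 0\<close> as \<open>dim sl\<^sub>2 = 3\<close>. Otherwise substitute the \<open>r\<close>-th vector of an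
  orthonormal basis for the variables of row \<open>r\<close>. Since \<open>gl\<^sub>3\<close> is the sum of \<open>so\<^sub>3\<close> and the upper
  triangular matrices, equivariance shows that \<open>a b f = 0\<close> if the value of \<open>b f\<close> there vanishes.
  Hence the rank of \<open>c\<close> is at most the dimension of the space of these values. They lie in one
  isotypic part of \<open>gl\<^sub>d\<close> under a Klein four-group, of dimension at most \<open>(d\<^sup>2 + 3) / 4\<close>, which does
  not exceed \<open>3\<^sup>d\<^sup>-\<^sup>2\<close> for \<open>d \<ge> 2\<close>; for \<open>d = 1\<close> all values are zero.
\<close>

text \<open>The orthonormal basis is what makes both halves of the bound work. In it sl2 acts on
  itself by antisymmetric matrices, a complement of the upper triangular ones; in the basis E, H, F
  the adjoint image meets the upper triangular matrices in dimension two, and the sum is too small.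
  Each basis vector is moreover an eigenvector of the Klein four-group, so that all monomials,
  evaluated at the same basis vectors, fall into one isotypic part. The obstacle is that evaluation
  is equivariant under sl2 only, while row symmetric tensors are connected through gl3. It is
  overcome by the tensor substituted: after antisymmetrization along columns it is a highest weight
  vector for gl3, so the sl2-module it generates is already stable under gl3 and contains every
  tensor first symmetrized along rows and then antisymmetrized along columns. On the side of
  characters, the definite descriptions behind the multiplicity require both existence and
  uniqueness of a decomposition: existence comes from a dimension count, uniqueness from duality.
  The numerical bound is tight for the count of entries in dimensions 2 and 3.\<close>

abbreviation "single \<equiv> Poly_Mapping.single"
abbreviation "lookup \<equiv> Poly_Mapping.lookup"
abbreviation "keys \<equiv> Poly_Mapping.keys"

section \<open>Traces on quotient spaces\<close>

lemma lc_scale_zero [simp]: "lc_scale 0 f = 0" "lc_scale c 0 = 0"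
  by (simp_all)

text \<open>The vectors that extend a basis \<open>BW\<close> of \<open>W\<close> to a basis of
  \<open>V\<close> have residue classes forming a basis of the quotient. Uniqueness of coordinates
  comes down to independence of the extended basis, once the difference of two expansions has been
  written in terms of \<open>BW\<close>.\<close>

lemma quot_basis_exists:
  fixes V W :: "('k \<Rightarrow>\<^sub>0 complex) set"
  assumes V: "lc.subspace V" and W: "lc.subspace W" and "W \<subseteq> V"
    and S: "finite S" "V \<subseteq> lc.span S"
  obtains B where "quot_basis V W B"
proof -
  obtain BW where BW: "BW \<subseteq> W" "lc.independent BW" "W \<subseteq> lc.span BW"
    using lc.maximal_independent_subset[of W] by metis
  obtain B where B: "BW \<subseteq> B" "B \<subseteq> V" "lc.independent B" "V \<subseteq> lc.span B"
    using lc.maximal_independent_subset_extend[of BW V] BW \<open>W \<subseteq> V\<close> by blast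
  have finB: "finite B"
    using lc.independent_span_bound[OF S(1) B(3)] B(2) S(2) by blast
  have spBW: "lc.span BW = W"
    using BW W lc.span_minimal by blast
  define C where "C = B - BW"
  have finC: "finite C" and finBW: "finite BW" and BC: "B = C \<union> BW" "C \<inter> BW = {}"
    using finB B(1) by (auto simp: C_def intro: finite_subset)
  have ex: "\<exists>!c. (\<forall>b. b \<notin> C \<longrightarrow> c b = 0) \<and> v - (\<Sum>b\<in>C. lc_scale (c b) b) \<in> W" if v: "v \<in> V" for v
  proof (rule ex_ex1I)
    from v B(4) have "v \<in> lc.span B" by blast
    then obtain u where u: "v = (\<Sum>b\<in>B. lc_scale (u b) b)"
      using lc.span_finite[OF finB] by auto
    have "v - (\<Sum>b\<in>C. lc_scale (if b \<in> C then u b else 0) b) = (\<Sum>b\<in>BW. lc_scale (u b) b)"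
      unfolding u BC(1) by (simp add: sum.union_disjoint finC finBW BC(2))
    moreover have "\<dots> \<in> W"
      using BW(1) by (intro lc.subspace_sum[OF W] lc.subspace_scale[OF W]) auto
    ultimately show "\<exists>c. (\<forall>b. b \<notin> C \<longrightarrow> c b = 0) \<and> v - (\<Sum>b\<in>C. lc_scale (c b) b) \<in> W"
      by (intro exI[of _ "\<lambda>b. if b \<in> C then u b else 0"]) auto
  next
    fix c c'
    assume c: "(\<forall>b. b \<notin> C \<longrightarrow> c b = 0) \<and> v - (\<Sum>b\<in>C. lc_scale (c b) b) \<in> W"
      and c': "(\<forall>b. b \<notin> C \<longrightarrow> c' b = 0) \<and> v - (\<Sum>b\<in>C. lc_scale (c' b) b) \<in> W"
    have "(\<Sum>b\<in>C. lc_scale (c b - c' b) b) =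
        (v - (\<Sum>b\<in>C. lc_scale (c' b) b)) - (v - (\<Sum>b\<in>C. lc_scale (c b) b))"
      by (simp add: lc.scale_left_diff_distrib sum_subtractf)
    also have "\<dots> \<in> W"
      by (rule lc.subspace_diff[OF W conjunct2[OF c'] conjunct2[OF c]])
    finally have "(\<Sum>b\<in>C. lc_scale (c b - c' b) b) \<in> lc.span BW"
      using spBW by simp
    then obtain u where u: "(\<Sum>b\<in>C. lc_scale (c b - c' b) b) = (\<Sum>b\<in>BW. lc_scale (u b) b)"
      using lc.span_finite[OF finBW] by auto
    define z where "z b = (if b \<in> C then c b - c' b else - u b)" for b
    have "(\<Sum>b\<in>B. lc_scale (z b) b) =
        (\<Sum>b\<in>C. lc_scale (c b - c' b) b) + (\<Sum>b\<in>BW. lc_scale (- u b) b)"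
      unfolding BC(1) using BC(2) finC finBW
      by (subst sum.union_disjoint) (auto simp: z_def intro!: arg_cong2[where f="(+)"] sum.cong)
    also have "\<dots> = 0"
      unfolding u by (simp add: sum_negf)
    finally have "\<forall>b\<in>B. z b = 0"
      using lc.independentD[OF B(3) finB subset_refl] by blast
    then have "c b = c' b" if "b \<in> C" for b
      using that BC(1) by (auto simp: z_def dest!: bspec[where x=b])
    with c c' show "c = c'"
      by (intro ext) metis
  qed
  have "quot_basis V W C"
    unfolding quot_basis_def using finC B(2) BC(1) ex by auto
  then show thesis by (rule that)
qed

text \<open>Linearity is demanded only on \<open>V\<close>: \<open>quot_coords\<close> is a definite
  description and carries no information outside \<open>V\<close>.\<close>

definition lin_on :: "('k \<Rightarrow>\<^sub>0 complex) set \<Rightarrow> (('k \<Rightarrow>\<^sub>0 complex) \<Rightarrow> complex) \<Rightarrow> bool" where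
  "lin_on V \<phi> \<longleftrightarrow> (\<forall>x\<in>V. \<forall>y\<in>V. \<phi> (x + y) = \<phi> x + \<phi> y) \<and> (\<forall>a. \<forall>x\<in>V. \<phi> (lc_scale a x) = a * \<phi> x)"

lemma lin_on_add: "lin_on V \<phi> \<Longrightarrow> x \<in> V \<Longrightarrow> y \<in> V \<Longrightarrow> \<phi> (x + y) = \<phi> x + \<phi> y"
  by (simp add: lin_on_def)

lemma lin_on_sum:
  assumes "lc.subspace V" "lin_on V \<phi>" "finite B" "\<And>b. b \<in> B \<Longrightarrow> f b \<in> V"
  shows "\<phi> (\<Sum>b\<in>B. lc_scale (a b) (f b)) = (\<Sum>b\<in>B. a b * \<phi> (f b))"
  using assms(3,4)
proof (induction B rule: finite_induct)
  case empty
  have "\<phi> (lc_scale 0 0) = 0 * \<phi> 0"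
    using assms(2) lc.subspace_0[OF assms(1)] unfolding lin_on_def by blast
  then show ?case by simp
next
  case (insert b B)
  have "lc_scale (a b) (f b) \<in> V" "(\<Sum>b\<in>B. lc_scale (a b) (f b)) \<in> V"
    using insert.prems lc.subspace_scale[OF assms(1)] by (auto intro!: lc.subspace_sum[OF assms(1)])
  with insert show ?case
    using assms(2) by (simp add: lin_on_def)
qed

locale quot =
  fixes V W :: "('k \<Rightarrow>\<^sub>0 complex) set"
  assumes V: "lc.subspace V" and W: "lc.subspace W" and WV: "W \<subseteq> V"
    and fin: "\<exists>S. finite S \<and> V \<subseteq> lc.span S"
begin

text \<open>The same choice as in \<open>quot_trace\<close>, so that the trace unfolds to a sum over
  \<open>B\<close> by definition.\<close>

definition B where "B = (SOME B. quot_basis V W B)"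

lemma B: "quot_basis V W B"
  unfolding B_def using quot_basis_exists[OF V W WV] fin by (metis someI)

end

lemma quot_coords:
  assumes "quot_basis V W B" "v \<in> V"
  shows "b \<notin> B \<Longrightarrow> quot_coords W B v b = 0"
    and "v - (\<Sum>b\<in>B. lc_scale (quot_coords W B v b) b) \<in> W"
proof -
  have "\<exists>!c. (\<forall>b. b \<notin> B \<longrightarrow> c b = 0) \<and> v - (\<Sum>b\<in>B. lc_scale (c b) b) \<in> W"
    using assms unfolding quot_basis_def by blast
  from theI'[OF this] show "b \<notin> B \<Longrightarrow> quot_coords W B v b = 0"
    and "v - (\<Sum>b\<in>B. lc_scale (quot_coords W B v b) b) \<in> W"
    unfolding quot_coords_def by blast+
qed

lemma quot_coords_eqI:
  assumes "quot_basis V W B" "v \<in> V" "v - (\<Sum>b\<in>B. lc_scale (c b) b) \<in> W" "b \<in> B"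
  shows "quot_coords W B v b = c b"
proof -
  have ex1: "\<exists>!c. (\<forall>b. b \<notin> B \<longrightarrow> c b = 0) \<and> v - (\<Sum>b\<in>B. lc_scale (c b) b) \<in> W"
    using assms unfolding quot_basis_def by blast
  define c' where "c' b = (if b \<in> B then c b else 0)" for b
  have "(\<Sum>b\<in>B. lc_scale (c' b) b) = (\<Sum>b\<in>B. lc_scale (c b) b)"
    by (simp add: c'_def)
  then have "quot_coords W B v = c'"
    using quot_coords[OF assms(1,2)] assms(3) ex1 by (metis c'_def)
  then show ?thesis using assms(4) by (simp add: c'_def)
qed

context quot
begin

lemma finB [simp]: "finite B" and BV: "b \<in> B \<Longrightarrow> b \<in> V"
  using B unfolding quot_basis_def by auto

abbreviation "co \<equiv> quot_coords W B"

lemma lin_co: "lin_on V (\<lambda>v. co v b)"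
  if "b \<in> B"
  unfolding lin_on_def
proof (intro conjI ballI allI)
  fix x y assume xy: "x \<in> V" "y \<in> V"
  have "(x - (\<Sum>b\<in>B. lc_scale (co x b) b)) + (y - (\<Sum>b\<in>B. lc_scale (co y b) b)) \<in> W"
    by (intro lc.subspace_add[OF W] quot_coords(2)[OF B] xy)
  then show "co (x + y) b = co x b + co y b"
    by (intro quot_coords_eqI[OF B] lc.subspace_add[OF V] xy that)
      (simp add: lc.scale_left_distrib sum.distrib algebra_simps)
next
  fix a x assume x: "x \<in> V"
  have "lc_scale a (x - (\<Sum>b\<in>B. lc_scale (co x b) b)) \<in> W"
    by (intro lc.subspace_scale[OF W] quot_coords(2)[OF B] x)
  then show "co (lc_scale a x) b = a * co x b"
    by (intro quot_coords_eqI[OF B] lc.subspace_scale[OF V] x that)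
      (simp add: lc.scale_right_diff_distrib lc.scale_sum_right)
qed

lemma co_W: "v \<in> W \<Longrightarrow> b \<in> B \<Longrightarrow> co v b = 0"
  using quot_coords_eqI[OF B, of v "\<lambda>_. 0" b] WV by auto

lemma co_cong:
  assumes "x \<in> V" "y \<in> V" "x - y \<in> W" "b \<in> B"
  shows "co x b = co y b"
proof -
  have "co (y + (x - y)) b = co y b + co (x - y) b"
    using lin_co[OF assms(4)] assms(1-3) WV unfolding lin_on_def by blast
  then show ?thesis using co_W[OF assms(3,4)] by simp
qed

lemma quot_trace_eq: "quot_trace V W T = (\<Sum>b\<in>B. co (T b) b)"
  unfolding quot_trace_def Let_def B_def ..

text \<open>Expanding every \<open>u c\<close> in the chosen basis and exchanging the sums gives the
  trace of a sum of rank-one maps. The \<open>u c\<close> may be any finite family, so later traces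
  are computed with whatever vectors are at hand instead of the basis picked by
  \<open>SOME\<close>.\<close>

lemma quot_trace_formula:
  assumes "finite C" and lin: "\<And>c. c \<in> C \<Longrightarrow> lin_on V (\<phi> c)"
    and \<phi>W: "\<And>c w. c \<in> C \<Longrightarrow> w \<in> W \<Longrightarrow> \<phi> c w = 0"
    and u: "\<And>c. c \<in> C \<Longrightarrow> u c \<in> V"
    and T: "\<And>v. v \<in> V \<Longrightarrow> T v - (\<Sum>c\<in>C. lc_scale (\<phi> c v) (u c)) \<in> W"
  shows "quot_trace V W T = (\<Sum>c\<in>C. \<phi> c (u c))"
proof -
  have sV: "(\<Sum>c\<in>C. lc_scale (\<phi> c v) (u c)) \<in> V" for v
    using u by (intro lc.subspace_sum[OF V] lc.subspace_scale[OF V])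
  have TV: "T v \<in> V" if "v \<in> V" for v
  proof -
    have "(T v - (\<Sum>c\<in>C. lc_scale (\<phi> c v) (u c))) + (\<Sum>c\<in>C. lc_scale (\<phi> c v) (u c)) \<in> V"
      using T[OF that] WV sV by (intro lc.subspace_add[OF V]) auto
    then show ?thesis by simp
  qed
  have "co (T b) b = (\<Sum>c\<in>C. \<phi> c b * co (u c) b)" if b: "b \<in> B" for b
  proof -
    have "co (T b) b = co (\<Sum>c\<in>C. lc_scale (\<phi> c b) (u c)) b"
      using b BV by (intro co_cong TV T sV) auto
    also have "\<dots> = (\<Sum>c\<in>C. \<phi> c b * co (u c) b)"
      by (intro lin_on_sum[OF V] lin_co b u assms)
    finally show ?thesis .
  qed
  then have "quot_trace V W T = (\<Sum>b\<in>B. \<Sum>c\<in>C. \<phi> c b * co (u c) b)"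
    by (simp add: quot_trace_eq)
  also have "\<dots> = (\<Sum>c\<in>C. \<Sum>b\<in>B. co (u c) b * \<phi> c b)"
    by (subst sum.swap) (simp add: mult.commute)
  also have "\<dots> = (\<Sum>c\<in>C. \<phi> c (u c))"
  proof (rule sum.cong[OF refl])
    fix c assume c: "c \<in> C"
    have "(\<Sum>b\<in>B. co (u c) b * \<phi> c b) = \<phi> c (\<Sum>b\<in>B. lc_scale (co (u c) b) b)"
      using BV by (intro lin_on_sum[OF V, symmetric] lin c finB)
    \<comment> \<open>The remainder of \<open>u c\<close> after its basis expansion lies in
      \<open>W\<close>, where \<open>\<phi> c\<close> vanishes; adding it restores
      \<open>u c\<close> itself.\<close>
    also have "\<dots> = \<phi> c (\<Sum>b\<in>B. lc_scale (co (u c) b) b) + \<phi> c (u c - (\<Sum>b\<in>B. lc_scale (co (u c) b) b))"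
      using \<phi>W[OF c quot_coords(2)[OF B u[OF c]]] by simp
    also have "\<dots> = \<phi> c ((\<Sum>b\<in>B. lc_scale (co (u c) b) b) + (u c - (\<Sum>b\<in>B. lc_scale (co (u c) b) b)))"
    proof -
      have "(\<Sum>b\<in>B. lc_scale (co (u c) b) b) \<in> V"
        using BV by (intro lc.subspace_sum[OF V] lc.subspace_scale[OF V])
      moreover have "u c - (\<Sum>b\<in>B. lc_scale (co (u c) b) b) \<in> V"
        using quot_coords(2)[OF B u[OF c]] WV by blast
      ultimately show ?thesis by (rule lin_on_add[OF lin[OF c], symmetric])
    qed
    finally show "(\<Sum>b\<in>B. co (u c) b * \<phi> c b) = \<phi> c (u c)" by simp
  qed
  finally show ?thesis .
qed

lemma quot_trace_sum:
  assumes "finite P" "\<And>p v. p \<in> P \<Longrightarrow> v \<in> V \<Longrightarrow> F p v \<in> V"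
  shows "quot_trace V W (\<lambda>v. \<Sum>p\<in>P. lc_scale (a p) (F p v)) = (\<Sum>p\<in>P. a p * quot_trace V W (F p))"
proof -
  have "co (\<Sum>p\<in>P. lc_scale (a p) (F p b)) b = (\<Sum>p\<in>P. a p * co (F p b) b)" if "b \<in> B" for b
    using that BV assms by (intro lin_on_sum[OF V] lin_co) auto
  then show ?thesis
    unfolding quot_trace_eq sum_distrib_left by (subst sum.swap) simp
qed

end

definition end_on :: "('k \<Rightarrow>\<^sub>0 complex) set \<Rightarrow> (('k \<Rightarrow>\<^sub>0 complex) \<Rightarrow> ('k \<Rightarrow>\<^sub>0 complex)) \<Rightarrow> bool" where
  "end_on V T \<longleftrightarrow> (\<forall>x\<in>V. T x \<in> V) \<and> (\<forall>x\<in>V. \<forall>y\<in>V. T (x + y) = T x + T y) \<and>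
     (\<forall>a. \<forall>x\<in>V. T (lc_scale a x) = lc_scale a (T x))"

lemma end_on_sum:
  assumes "lc.subspace V" "end_on V T" "finite B" "\<And>b. b \<in> B \<Longrightarrow> f b \<in> V"
  shows "T (\<Sum>b\<in>B. lc_scale (a b) (f b)) = (\<Sum>b\<in>B. lc_scale (a b) (T (f b)))"
  using assms(3,4)
proof (induction B rule: finite_induct)
  case empty
  have "T (lc_scale 0 0) = lc_scale 0 (T 0)"
    using assms(2) lc.subspace_0[OF assms(1)] unfolding end_on_def by blast
  then show ?case by simp
next
  case (insert b B)
  have "lc_scale (a b) (f b) \<in> V" "(\<Sum>b\<in>B. lc_scale (a b) (f b)) \<in> V"
    using insert.prems lc.subspace_scale[OF assms(1)] by (auto intro!: lc.subspace_sum[OF assms(1)])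
  with insert show ?case
    using assms(2) by (simp add: end_on_def)
qed

lemma end_on_diff:
  assumes "lc.subspace V" "end_on V T" "x \<in> V" "y \<in> V"
  shows "T (x - y) = T x - T y"
proof -
  have "T ((x - y) + y) = T (x - y) + T y"
    using assms lc.subspace_diff[OF assms(1)] unfolding end_on_def by metis
  then show ?thesis by simp
qed

context quot
begin

text \<open>In \<open>quot_trace_formula\<close> the images \<open>h b\<close> of the basis vectors
  serve as the family, with the coordinates of \<open>g (k v)\<close> as functionals; then
  \<open>k (h b) = b\<close> leaves the trace of \<open>g\<close>.\<close>

lemma quot_trace_conj:
  assumes g: "end_on V g" and h: "end_on V h" and k: "end_on V k"
    and W': "\<And>w. w \<in> W \<Longrightarrow> g w \<in> W" "\<And>w. w \<in> W \<Longrightarrow> h w \<in> W" "\<And>w. w \<in> W \<Longrightarrow> k w \<in> W"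
    and kh: "\<And>v. v \<in> V \<Longrightarrow> k (h v) = v"
  shows "quot_trace V W (\<lambda>v. h (g (k v))) = quot_trace V W g"
proof -
  have gV: "g v \<in> V" and hV: "h v \<in> V" and kV: "k v \<in> V" if "v \<in> V" for v
    using that g h k unfolding end_on_def by auto
  have "quot_trace V W (\<lambda>v. h (g (k v))) = (\<Sum>b\<in>B. co (g (k (h b))) b)"
  proof (rule quot_trace_formula[where \<phi>="\<lambda>b v. co (g (k v)) b" and u=h])
    show "lin_on V (\<lambda>v. co (g (k v)) b)" if "b \<in> B" for b
      using lin_co[OF that] g k unfolding lin_on_def end_on_def by auto
    show "co (g (k w)) b = 0" if "b \<in> B" "w \<in> W" for b w
      using that W' by (intro co_W) auto
    show "h b \<in> V" if "b \<in> B" for b using that BV hV by blast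
    show "h (g (k v)) - (\<Sum>b\<in>B. lc_scale (co (g (k v)) b) (h b)) \<in> W" if v: "v \<in> V" for v
    proof -
      have "h (g (k v)) - (\<Sum>b\<in>B. lc_scale (co (g (k v)) b) (h b))
          = h (g (k v) - (\<Sum>b\<in>B. lc_scale (co (g (k v)) b) b))"
        using BV v gV kV
        by (subst end_on_diff[OF V h])
          (auto simp: end_on_sum[OF V h finB] intro!: lc.subspace_sum[OF V] lc.subspace_scale[OF V])
      also have "\<dots> \<in> W"
        by (intro W'(2) quot_coords(2)[OF B] gV kV v)
      finally show ?thesis .
    qed
  qed simp
  also have "\<dots> = quot_trace V W g"
    using kh BV by (simp add: quot_trace_eq)
  finally show ?thesis .
qed

end

text \<open>Functions on \<open>R\<close> are encoded as formal combinations of elements of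
  \<open>R\<close>, so that the dimension bound for independent sets applies. It is used twice: to
  bound a rank, and to force a linear relation among too many class functions.\<close>

lemma card_le_by_functionals:
  fixes v :: "'c \<Rightarrow> ('r \<Rightarrow> complex)"
  assumes "finite C" "finite R"
    and inj: "\<And>a. (\<And>r. r \<in> R \<Longrightarrow> (\<Sum>c\<in>C. a c * v c r) = 0) \<Longrightarrow> \<forall>c\<in>C. a c = 0"
  shows "card C \<le> card R"
proof -
  define u :: "'c \<Rightarrow> ('r \<Rightarrow>\<^sub>0 complex)" where
    "u c = (\<Sum>r\<in>R. single r (v c r))" for c
  have lu: "lookup (u c) r = (if r \<in> R then v c r else 0)" for c r
    using \<open>finite R\<close> by (simp add: u_def lookup_sum lookup_single when_def)
  have lus: "lookup (\<Sum>c\<in>C. lc_scale (a c) (u c)) r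
      = (if r \<in> R then \<Sum>c\<in>C. a c * v c r else 0)" for a r
    by (simp add: lookup_sum lu)
  \<comment> \<open>Independence is a property of the image set, so equal vectors with different
    indices must be excluded before cardinalities can be compared.\<close>
  have injC: "inj_on u C"
  proof (rule inj_onI, rule ccontr)
    fix c c' assume cc: "c \<in> C" "c' \<in> C" "u c = u c'" "c \<noteq> c'"
    define a where "a x = (if x = c then 1 else if x = c' then -1 else (0::complex))" for x
    have "(\<Sum>x\<in>C. a x * v x r) = 0" if "r \<in> R" for r
    proof -
      have "(\<Sum>x\<in>C. a x * v x r) = (\<Sum>x\<in>{c, c'}. a x * v x r)"
        using cc \<open>finite C\<close> by (intro sum.mono_neutral_right) (auto simp: a_def)
      also have "\<dots> = v c r - v c' r" using cc by (simp add: a_def)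
      also have "\<dots> = 0" using lu[of c r] lu[of c' r] cc(3) that by simp
      finally show ?thesis .
    qed
    then have "a c = 0" using inj cc(1) by blast
    then show False by (simp add: a_def)
  qed
  have ind: "lc.independent (u ` C)"
  proof (subst lc.independent_explicit_finite_subsets, intro allI impI ballI)
    fix A a x assume A: "A \<subseteq> u ` C" "finite A" and s: "(\<Sum>y\<in>A. lc_scale (a y) y) = 0" and x: "x \<in> A"
    define b where "b c = (if u c \<in> A then a (u c) else 0)" for c
    have "(\<Sum>c\<in>C. lc_scale (b c) (u c)) = (\<Sum>c\<in>{c\<in>C. u c \<in> A}. lc_scale (a (u c)) (u c))"
      using \<open>finite C\<close> by (intro sum.mono_neutral_cong_right) (auto simp: b_def)
    also have "\<dots> = (\<Sum>y\<in>u ` {c\<in>C. u c \<in> A}. lc_scale (a y) y)"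
      by (subst sum.reindex) (auto intro: inj_on_subset[OF injC])
    also have "u ` {c\<in>C. u c \<in> A} = A" using A by auto
    finally have "(\<Sum>c\<in>C. lc_scale (b c) (u c)) = 0" using s by simp
    then have "(\<Sum>c\<in>C. b c * v c r) = 0" if "r \<in> R" for r
      using lus[of b r] that by simp
    then have "\<forall>c\<in>C. b c = 0" by (rule inj)
    moreover obtain c where "c \<in> C" "x = u c" using x A(1) by blast
    ultimately show "a x = 0" using x by (auto simp: b_def)
  qed
  define S where "S = (\<lambda>r. single r (1::complex)) ` R"
  have "u c \<in> lc.span S" for c
  proof -
    have "u c = (\<Sum>r\<in>R. lc_scale (v c r) (single r 1))"
      unfolding u_def by (intro sum.cong refl poly_mapping_eqI) (simp add: lookup_single when_def)
    also have "\<dots> \<in> lc.span S"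
      unfolding S_def by (intro lc.span_sum lc.span_scale lc.span_base imageI)
    finally show ?thesis .
  qed
  then have "card (u ` C) \<le> card S"
    using lc.independent_span_bound[OF _ ind, of S] \<open>finite R\<close> by (auto simp: S_def)
  also have "card S \<le> card R" unfolding S_def using \<open>finite R\<close> by (rule card_image_le)
  finally show ?thesis by (simp add: card_image[OF injC])
qed

context quot
begin

text \<open>Modulo \<open>W\<close>, \<open>T\<close> maps everything into its image and acts there
  as the scalar \<open>k\<close>, so its trace is \<open>k\<close> times the dimension of the image.
  If the \<open>l r\<close> jointly detect that \<open>T v\<close> vanishes modulo \<open>W\<close>,
  this dimension is at most their number. Both facts are about one \<open>n\<close>, because for
  \<open>k = 0\<close> the trace does not determine it.\<close>

lemma quot_trace_rank:
  assumes T: "end_on V T" and TW: "\<And>w. w \<in> W \<Longrightarrow> T w \<in> W"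
    and k: "\<And>v. v \<in> V \<Longrightarrow> T (T v) - lc_scale k (T v) \<in> W"
  obtains n where "quot_trace V W T = k * of_nat n"
    and "\<And>R (l :: 'r \<Rightarrow> _). finite R \<Longrightarrow> (\<And>r. r \<in> R \<Longrightarrow> lin_on V (l r)) \<Longrightarrow>
        (\<And>v. v \<in> V \<Longrightarrow> (\<And>r. r \<in> R \<Longrightarrow> l r v = 0) \<Longrightarrow> T v \<in> W) \<Longrightarrow> n \<le> card R"
proof -
  \<comment> \<open>The image of \<open>T\<close> enlarged by \<open>W\<close>, so that the image
    modulo \<open>W\<close> is again a quotient of the kind treated here.\<close>
  define U where "U = {T v + w | v w. v \<in> V \<and> w \<in> W}"
  have TV: "T v \<in> V" if "v \<in> V" for v using that T unfolding end_on_def by blast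
  have UV: "U \<subseteq> V" using TV WV lc.subspace_add[OF V] unfolding U_def by blast
  have T0: "T 0 = 0"
    using end_on_sum[OF V T, of "{}"] by simp
  have WU: "W \<subseteq> U"
    using lc.subspace_0[OF V] T0 unfolding U_def by force
  have TU: "T v \<in> U" if "v \<in> V" for v
    using that lc.subspace_0[OF W] unfolding U_def by force
  have U: "lc.subspace U"
    unfolding lc.subspace_def
  proof (intro conjI ballI allI)
    show "0 \<in> U" using WU lc.subspace_0[OF W] by blast
    show "x + y \<in> U" if xy: "x \<in> U" "y \<in> U" for x y
    proof -
      obtain v w v' w' where "x = T v + w" "y = T v' + w'" "v \<in> V" "w \<in> W" "v' \<in> V" "w' \<in> W"
        using xy unfolding U_def by blast
      moreover from this have "x + y = T (v + v') + (w + w')"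
        using T unfolding end_on_def by (simp add: algebra_simps)
      ultimately show ?thesis
        using lc.subspace_add[OF V] lc.subspace_add[OF W] unfolding U_def by blast
    qed
    show "lc_scale a x \<in> U" if x: "x \<in> U" for a x
    proof -
      obtain v w where "x = T v + w" "v \<in> V" "w \<in> W"
        using x unfolding U_def by blast
      moreover from this have "lc_scale a x = T (lc_scale a v) + lc_scale a w"
        using T unfolding end_on_def by (simp add: lc.scale_right_distrib)
      ultimately show ?thesis
        using lc.subspace_scale[OF V] lc.subspace_scale[OF W] unfolding U_def by blast
    qed
  qed
  interpret U: quot U W
    using U W WU fin UV by unfold_locales auto
  have kU: "T u - lc_scale k u \<in> W" if u: "u \<in> U" for u
  proof -
    obtain v w where vw: "u = T v + w" "v \<in> V" "w \<in> W"
      using u unfolding U_def by blast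
    have "T u - lc_scale k u = (T (T v) - lc_scale k (T v)) + (T w - lc_scale k w)"
      using vw T TV WV unfolding end_on_def by (auto simp: lc.scale_right_distrib algebra_simps)
    also have "\<dots> \<in> W"
      using vw k TW lc.subspace_add[OF W] lc.subspace_diff[OF W] lc.subspace_scale[OF W] by meson
    finally show ?thesis .
  qed
  have coT: "U.co (T b) c = (if b = c then k else 0)" if "b \<in> U.B" "c \<in> U.B" for b c
  proof -
    have "(\<Sum>c\<in>U.B. lc_scale (if b = c then k else 0) c) = lc_scale k b"
      using that(1) by (subst sum.cong[OF refl, of _ _ "\<lambda>c. if b = c then lc_scale k b else 0"]) auto
    then show ?thesis
      using that by (intro quot_coords_eqI[OF U.B]) (auto intro!: TU kU dest: U.BV UV[THEN subsetD])
  qed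
  have "quot_trace V W T = (\<Sum>c\<in>U.B. U.co (T c) c)"
  proof (rule quot_trace_formula[where \<phi>="\<lambda>c v. U.co (T v) c" and u="\<lambda>c. c"])
    show "lin_on V (\<lambda>v. U.co (T v) c)" if "c \<in> U.B" for c
      using U.lin_co[OF that] T TU unfolding lin_on_def end_on_def by auto
    show "U.co (T w) c = 0" if "c \<in> U.B" "w \<in> W" for c w
      using that TW U.co_W by auto
    show "c \<in> V" if "c \<in> U.B" for c using U.BV[OF that] UV by blast
    show "T v - (\<Sum>c\<in>U.B. lc_scale (U.co (T v) c) c) \<in> W" if "v \<in> V" for v
      using quot_coords(2)[OF U.B TU[OF that]] .
  qed simp
  also have "\<dots> = k * of_nat (card U.B)"
    using coT by simp
  finally have tr: "quot_trace V W T = k * of_nat (card U.B)" .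
  show thesis
  proof (rule that[OF tr])
    fix R and l :: "'r \<Rightarrow> ('k \<Rightarrow>\<^sub>0 complex) \<Rightarrow> complex"
    assume R: "finite R" and l: "\<And>r. r \<in> R \<Longrightarrow> lin_on V (l r)"
      and z: "\<And>v. v \<in> V \<Longrightarrow> (\<And>r. r \<in> R \<Longrightarrow> l r v = 0) \<Longrightarrow> T v \<in> W"
    have "\<forall>c\<in>U.B. \<exists>v. v \<in> V \<and> c - T v \<in> W"
    proof
      fix c assume "c \<in> U.B"
      then have "c \<in> U" by (rule U.BV)
      then obtain v w where "c = T v + w" "v \<in> V" "w \<in> W" unfolding U_def by blast
      then show "\<exists>v. v \<in> V \<and> c - T v \<in> W" by (intro exI[of _ v]) simp
    qed
    then obtain v where v: "\<And>c. c \<in> U.B \<Longrightarrow> v c \<in> V" "\<And>c. c \<in> U.B \<Longrightarrow> c - T (v c) \<in> W"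
      by metis
    show "card U.B \<le> card R"
    \<comment> \<open>A relation between the functionals' values on the preimages \<open>v c\<close>
      gives a combination that \<open>T\<close> maps into \<open>W\<close>; this is a relation
      between basis vectors of the image, hence trivial.\<close>
    proof (rule card_le_by_functionals[where v="\<lambda>c r. l r (v c)", OF _ R])
      fix a assume a: "\<And>r. r \<in> R \<Longrightarrow> (\<Sum>c\<in>U.B. a c * l r (v c)) = 0"
      let ?x = "\<Sum>c\<in>U.B. lc_scale (a c) (v c)"
      have xV: "?x \<in> V" using v by (intro lc.subspace_sum[OF V] lc.subspace_scale[OF V])
      have "T ?x \<in> W"
      proof (rule z[OF xV])
        fix r assume r: "r \<in> R"
        show "l r ?x = 0"
          using lin_on_sum[OF V l[OF r], of "U.B" v a] v a[OF r] by simp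
      qed
      moreover have "T ?x = (\<Sum>c\<in>U.B. lc_scale (a c) (T (v c)))"
        using v by (intro end_on_sum[OF V T]) auto
      moreover have "(\<Sum>c\<in>U.B. lc_scale (a c) (c - T (v c))) \<in> W"
        using v by (intro lc.subspace_sum[OF W] lc.subspace_scale[OF W])
      ultimately have "(\<Sum>c\<in>U.B. lc_scale (a c) (T (v c))) + (\<Sum>c\<in>U.B. lc_scale (a c) (c - T (v c))) \<in> W"
        using lc.subspace_add[OF W] by simp
      then have xW: "(\<Sum>c\<in>U.B. lc_scale (a c) c) \<in> W"
        by (simp add: lc.scale_right_diff_distrib sum_subtractf)
      show "\<forall>c\<in>U.B. a c = 0"
      proof
        fix c assume c: "c \<in> U.B"
        have "(0 :: 'k \<Rightarrow>\<^sub>0 complex) - (\<Sum>c\<in>U.B. lc_scale (a c) c) \<in> W"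
          using lc.subspace_neg[OF W xW] by simp
        then have "U.co 0 c = a c"
          using c lc.subspace_0[OF U] by (intro quot_coords_eqI[OF U.B]) auto
        moreover have "U.co 0 c = 0" using c lc.subspace_0[OF W] by (rule U.co_W[rotated])
        ultimately show "a c = 0" by simp
      qed
    qed simp
  qed
qed

end

section \<open>Young tableaux\<close>

text \<open>\<open>tab_row\<close> and \<open>tab_col\<close> are the inverse coordinates of
  \<open>tableau_entry\<close>: \<open>x\<close> lies in the first row whose end exceeds it.\<close>

definition tab_row :: "nat list \<Rightarrow> nat \<Rightarrow> nat" where
  "tab_row lam x = (LEAST r. x < sum_list (take (Suc r) lam))"

definition tab_col :: "nat list \<Rightarrow> nat \<Rightarrow> nat" where
  "tab_col lam x = x - sum_list (take (tab_row lam x) lam)"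

lemma sum_list_take_Suc: "r < length lam \<Longrightarrow> sum_list (take (Suc r) lam) = sum_list (take r lam) + (lam ! r :: nat)"
  by (simp add: take_Suc_conv_app_nth)

lemma sum_list_take_mono: "r \<le> s \<Longrightarrow> sum_list (take r lam) \<le> (sum_list (take s lam) :: nat)"
  by (auto simp: le_iff_add take_add)

lemma tableau_coordinates:
  assumes "x < sum_list lam"
  shows "tab_row lam x < length lam" "tab_col lam x < lam ! tab_row lam x"
    "tableau_entry lam (tab_row lam x) (tab_col lam x) = x"
proof -
  let ?r = "tab_row lam x"
  have ex: "x < sum_list (take (Suc (length lam)) lam)" using assms by simp
  have 1: "x < sum_list (take (Suc ?r) lam)"
    unfolding tab_row_def by (rule LeastI[of "\<lambda>r. x < sum_list (take (Suc r) lam)", OF ex])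
  have 2: "sum_list (take ?r lam) \<le> x"
  proof (cases ?r)
    case (Suc r)
    then have "\<not> x < sum_list (take (Suc r) lam)"
      unfolding tab_row_def using not_less_Least by (metis lessI)
    then show ?thesis using Suc by simp
  qed simp
  show r: "?r < length lam"
  proof (rule ccontr)
    assume "\<not> ?r < length lam"
    then have "sum_list (take ?r lam) = sum_list lam" by simp
    with 2 assms show False by simp
  qed
  show "tab_col lam x < lam ! ?r"
    using 1 2 sum_list_take_Suc[OF r] by (simp add: tab_col_def)
  show "tableau_entry lam ?r (tab_col lam x) = x"
    using 2 by (simp add: tab_col_def tableau_entry_def)
qed

lemma tableau_entry_coordinates:
  assumes "r < length lam" "c < lam ! r"
  shows "tableau_entry lam r c < sum_list lam" "tab_row lam (tableau_entry lam r c) = r"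
    "tab_col lam (tableau_entry lam r c) = c"
proof -
  have S: "tableau_entry lam r c < sum_list (take (Suc r) lam)"
    using assms by (simp add: tableau_entry_def sum_list_take_Suc)
  also have "\<dots> \<le> sum_list lam"
    using sum_list_take_mono[of "Suc r" "length lam" lam] assms by simp
  finally show "tableau_entry lam r c < sum_list lam" .
  show r: "tab_row lam (tableau_entry lam r c) = r"
    unfolding tab_row_def
  proof (rule Least_equality)
    show "tableau_entry lam r c < sum_list (take (Suc r) lam)" by (rule S)
  next
    fix s assume s: "tableau_entry lam r c < sum_list (take (Suc s) lam)"
    show "r \<le> s"
    proof (rule ccontr)
      assume "\<not> r \<le> s"
      then have "sum_list (take (Suc s) lam) \<le> sum_list (take r lam)"
        by (intro sum_list_take_mono) simp
      with s show False by (simp add: tableau_entry_def)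
    qed
  qed
  show "tab_col lam (tableau_entry lam r c) = c"
    unfolding tab_col_def r by (simp add: tableau_entry_def)
qed

lemma tableau_row_eq:
  assumes r: "r < length lam"
  shows "tableau_row lam r = {x. x < sum_list lam \<and> tab_row lam x = r}"
proof (rule equalityI; rule subsetI)
  fix x assume "x \<in> tableau_row lam r"
  then show "x \<in> {x. x < sum_list lam \<and> tab_row lam x = r}"
    using tableau_entry_coordinates[OF r] by (auto simp: tableau_row_def)
next
  fix x assume "x \<in> {x. x < sum_list lam \<and> tab_row lam x = r}"
  then have "x < sum_list lam" "tab_row lam x = r" by auto
  from tableau_coordinates[OF this(1)] this(2) show "x \<in> tableau_row lam r"
    unfolding tableau_row_def by (intro CollectI exI[of _ "tab_col lam x"]) auto
qed

lemma tableau_col_eq: "tableau_col lam c = {x. x < sum_list lam \<and> tab_col lam x = c}"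
proof (rule equalityI; rule subsetI)
  fix x assume "x \<in> tableau_col lam c"
  then show "x \<in> {x. x < sum_list lam \<and> tab_col lam x = c}"
    using tableau_entry_coordinates[of _ lam c] by (auto simp: tableau_col_def)
next
  fix x assume "x \<in> {x. x < sum_list lam \<and> tab_col lam x = c}"
  then have "x < sum_list lam" "tab_col lam x = c" by auto
  from tableau_coordinates[OF this(1)] this(2) show "x \<in> tableau_col lam c"
    unfolding tableau_col_def by (intro CollectI exI[of _ "tab_row lam x"]) auto
qed

text \<open>A permutation mapping a finite set into itself maps it onto itself. So stabilizing
  fibres of \<open>f\<close> is a pointwise condition, the form in which row and column stabilizers
  are used from here on.\<close>

lemma sym_group_image_eq_iff:
  assumes p: "p \<in> sym_group m"
  shows "(\<forall>a\<in>A. p ` {x. x < m \<and> f x = a} = {x. x < m \<and> f x = a}) \<longleftrightarrow>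
     (\<forall>x<m. f x \<in> A \<longrightarrow> f (p x) = f x)" (is "?L \<longleftrightarrow> ?R")
proof
  assume L: ?L
  show ?R
  proof (intro allI impI)
    fix x assume "x < m" "f x \<in> A"
    then have "p x \<in> p ` {y. y < m \<and> f y = f x}" by blast
    with L \<open>f x \<in> A\<close> show "f (p x) = f x" by blast
  qed
next
  assume R: ?R
  show ?L
  proof
    fix a assume a: "a \<in> A"
    have pm: "p permutes {..<m}" using p by (simp add: sym_group_def)
    show "p ` {x. x < m \<and> f x = a} = {x. x < m \<and> f x = a}"
    proof (rule endo_inj_surj)
      show "p ` {x. x < m \<and> f x = a} \<subseteq> {x. x < m \<and> f x = a}"
        using R a permutes_in_image[OF pm] by auto
      show "inj_on p {x. x < m \<and> f x = a}" using permutes_inj[OF pm] by (rule inj_on_subset) simp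
    qed simp
  qed
qed

lemma row_stabilizer_eq:
  assumes "sum_list lam = m"
  shows "row_stabilizer lam = {p \<in> sym_group m. \<forall>x<m. tab_row lam (p x) = tab_row lam x}"
proof -
  have "(\<forall>r<length lam. p ` tableau_row lam r = tableau_row lam r) \<longleftrightarrow>
      (\<forall>x<m. tab_row lam (p x) = tab_row lam x)" if "p \<in> sym_group m" for p
  proof -
    have "(\<forall>r<length lam. p ` tableau_row lam r = tableau_row lam r) \<longleftrightarrow>
      (\<forall>r\<in>{..<length lam}. p ` {x. x < m \<and> tab_row lam x = r} = {x. x < m \<and> tab_row lam x = r})"
      using assms by (auto simp: tableau_row_eq)
    then show ?thesis
      unfolding sym_group_image_eq_iff[OF that] using tableau_coordinates(1) assms by auto
  qed
  then show ?thesis unfolding row_stabilizer_def assms by blast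
qed

lemma col_stabilizer_eq:
  assumes "sum_list lam = m"
  shows "col_stabilizer lam = {p \<in> sym_group m. \<forall>x<m. tab_col lam (p x) = tab_col lam x}"
proof -
  have "(\<forall>r. p ` tableau_col lam r = tableau_col lam r) \<longleftrightarrow>
      (\<forall>x<m. tab_col lam (p x) = tab_col lam x)" if "p \<in> sym_group m" for p
    using sym_group_image_eq_iff[OF that, of UNIV "tab_col lam"] assms by (simp add: tableau_col_eq)
  then show ?thesis unfolding col_stabilizer_def assms by blast
qed

text \<open>The maximum of a set with \<open>n + 1\<close> elements is at least \<open>n\<close>;
  removing it gives the induction. Both the inequality and its rigidity are applied to the set of
  rows met by a column.\<close>

lemma sum_lessThan_card_le:
  assumes "finite (S :: nat set)"
  shows "\<Sum>{..<card S} \<le> \<Sum>S" and "\<Sum>S = \<Sum>{..<card S} \<Longrightarrow> S = {..<card S}"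
proof -
  have "\<Sum>{..<card S} \<le> \<Sum>S \<and> (\<Sum>S = \<Sum>{..<card S} \<longrightarrow> S = {..<card S})"
    using assms
  proof (induction "card S" arbitrary: S)
    case 0
    then show ?case by simp
  next
    case (Suc n)
    define M where "M = Max S"
    have ne: "S \<noteq> {}" using Suc(2) by auto
    have M: "M \<in> S" unfolding M_def using ne Suc.prems by simp
    have "S \<subseteq> {..M}" unfolding M_def using Suc.prems by auto
    then have "card S \<le> Suc M" using card_mono[of "{..M}" S] by simp
    then have nM: "n \<le> M" using Suc(2) by simp
    have S': "n = card (S - {M})" "finite (S - {M})" using Suc M by auto
    have sumS: "\<Sum>S = M + \<Sum>(S - {M})" using M Suc.prems by (simp add: sum.remove)
    have IH: "\<Sum>{..<n} \<le> \<Sum>(S - {M})" "\<Sum>(S - {M}) = \<Sum>{..<n} \<longrightarrow> S - {M} = {..<n}"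
      using Suc(1)[OF S'] S'(1) by auto
    have c: "\<Sum>{..<card S} = n + \<Sum>{..<n}" unfolding Suc(2)[symmetric] by simp
    show ?case
    proof (intro conjI impI)
      show "\<Sum>{..<card S} \<le> \<Sum>S" unfolding c sumS using IH nM by simp
      assume "\<Sum>S = \<Sum>{..<card S}"
      then have "M = n" "S - {M} = {..<n}" using c sumS IH nM by auto
      then have "S = insert n {..<n}" using M insert_Diff by metis
      then show "S = {..<card S}" unfolding Suc(2)[symmetric] by (simp add: lessThan_Suc)
    qed
  qed
  then show "\<Sum>{..<card S} \<le> \<Sum>S" and "\<Sum>S = \<Sum>{..<card S} \<Longrightarrow> S = {..<card S}" by blast+
qed

lemma partitions_ofD:
  assumes "lam \<in> partitions_of m"
  shows "sum_list lam = m" and "i \<le> j \<Longrightarrow> j < length lam \<Longrightarrow> lam ! j \<le> lam ! i"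
    and "i < length lam \<Longrightarrow> 0 < lam ! i"
proof -
  have lam: "sorted_wrt (\<ge>) lam" "\<forall>k\<in>set lam. 0 < k" "sum_list lam = m"
    using assms unfolding partitions_of_def by blast+
  show "sum_list lam = m" by (rule lam)
  show "0 < lam ! i" if "i < length lam" using lam(2) that by simp
  show "lam ! j \<le> lam ! i" if "i \<le> j" "j < length lam"
    using lam(1) that unfolding sorted_wrt_iff_nth_less by (cases "i = j") auto
qed

lemma card_tab_row:
  assumes "sum_list lam = m"
  shows "card {x. x < m \<and> tab_row lam x = r} = (if r < length lam then lam ! r else 0)"
proof (cases "r < length lam")
  case True
  have "bij_betw (tableau_entry lam r) {..<lam ! r} {x. x < m \<and> tab_row lam x = r}"
    by (rule bij_betw_byWitness[where f'="tab_col lam"])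
      (use True assms tableau_coordinates tableau_entry_coordinates in fastforce)+
  then have "card {..<lam ! r} = card {x. x < m \<and> tab_row lam x = r}" by (rule bij_betw_same_card)
  then show ?thesis using True by simp
next
  case False
  then have "{x. x < m \<and> tab_row lam x = r} = {}" using tableau_coordinates(1) assms by blast
  then show ?thesis using False by simp
qed

text \<open>The statistic usually written n(lam): row \<open>r\<close>, counted from 0, contributes
  \<open>r\<close> times its length. Comparing this one number takes the place of the dominance
  order.\<close>

definition row_sum :: "nat list \<Rightarrow> nat" where
  "row_sum lam = (\<Sum>x<sum_list lam. tab_row lam x)"

text \<open>Since the parts decrease weakly, a column with a box in row \<open>r\<close> has one in
  every earlier row.\<close>

lemma tab_row_image_column:
  assumes lam: "lam \<in> partitions_of m"
  shows "tab_row lam ` {x. x < m \<and> tab_col lam x = c} = {..<card {x. x < m \<and> tab_col lam x = c}}"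
    and "inj_on (tab_row lam) {x. x < m \<and> tab_col lam x = c}"
proof -
  let ?C = "{x. x < m \<and> tab_col lam x = c}"
  note s = partitions_ofD(1)[OF lam]
  show inj: "inj_on (tab_row lam) ?C"
  proof (rule inj_onI)
    fix x y assume "x \<in> ?C" "y \<in> ?C" "tab_row lam x = tab_row lam y"
    with tableau_coordinates(3)[of x lam] tableau_coordinates(3)[of y lam] s show "x = y" by simp
  qed
  have down: "s \<in> tab_row lam ` ?C" if r: "r \<in> tab_row lam ` ?C" and sr: "s < r" for r s
  proof -
    obtain x where x: "x < m" "tab_col lam x = c" "r = tab_row lam x" using r by auto
    have "r < length lam" "c < lam ! r" using tableau_coordinates[of x lam] x s by auto
    then have "s < length lam" "c < lam ! s"
      using partitions_ofD(2)[OF lam, of s r] sr by auto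
    from tableau_entry_coordinates[OF this] s show ?thesis
      by (intro image_eqI[of _ _ "tableau_entry lam s c"]) auto
  qed
  have "\<exists>n. tab_row lam ` ?C = {..<n}"
  proof (cases "tab_row lam ` ?C = {}")
    case False
    have fin: "finite (tab_row lam ` ?C)" by simp
    let ?M = "Max (tab_row lam ` ?C)"
    have "?M \<in> tab_row lam ` ?C" using False fin by (rule Max_in[rotated])
    have "tab_row lam ` ?C = {..<Suc ?M}"
    proof (rule equalityI; rule subsetI)
      fix r assume "r \<in> tab_row lam ` ?C"
      then show "r \<in> {..<Suc ?M}" using Max_ge[OF fin] by (simp add: less_Suc_eq_le)
    next
      fix r assume "r \<in> {..<Suc ?M}"
      then have "r = ?M \<or> r < ?M" by (simp add: less_Suc_eq disj_commute)
      then show "r \<in> tab_row lam ` ?C" using down[OF \<open>?M \<in> _\<close>] \<open>?M \<in> _\<close> by metis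
    qed
    then show ?thesis by blast
  qed (auto intro: exI[of _ 0])
  then obtain n where n: "tab_row lam ` ?C = {..<n}" by blast
  have "card ?C = card (tab_row lam ` ?C)" using inj by (simp add: card_image)
  then show "tab_row lam ` ?C = {..<card ?C}" using n by simp
qed

lemma sum_by_columns: fixes f :: "nat \<Rightarrow> nat"
  shows "(\<Sum>x<m. f x) = (\<Sum>c\<in>h ` {..<m}. \<Sum>x\<in>{x. x < m \<and> h x = c}. f x)"
  using sum.image_gen[of "{..<m}" f h, OF finite_lessThan] by simp

text \<open>The rows of \<open>lam\<close> met by a column of \<open>mu\<close> with
  \<open>k\<close> boxes are \<open>k\<close> distinct numbers, so their sum is at least 0 + ... +
  (k - 1), which is what that column contributes to \<open>row_sum mu\<close>. Equality forces
  initial segments in every column, and then \<open>g\<close> decomposes into a column permutation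
  followed by a row permutation.\<close>

lemma columns_into_rows:
  assumes lam: "lam \<in> partitions_of m" and mu: "mu \<in> partitions_of m" and g: "g \<in> sym_group m"
    and inj: "\<And>x y. x < m \<Longrightarrow> y < m \<Longrightarrow> tab_col mu x = tab_col mu y \<Longrightarrow>
      tab_row lam (g x) = tab_row lam (g y) \<Longrightarrow> x = y"
  shows "row_sum mu \<le> row_sum lam"
    and "row_sum lam = row_sum mu \<Longrightarrow>
      lam = mu \<and> (\<exists>p\<in>row_stabilizer lam. \<exists>q\<in>col_stabilizer lam. g = p \<circ> q)"
proof -
  note sl = partitions_ofD(1)[OF lam] and sm = partitions_ofD(1)[OF mu]
  have gm: "g permutes {..<m}" using g by (simp add: sym_group_def)
  define C where "C c = {x. x < m \<and> tab_col mu x = c}" for c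
  have finC: "finite (C c)" for c by (simp add: C_def)
  have injS: "inj_on (\<lambda>x. tab_row lam (g x)) (C c)" for c
    by (rule inj_onI) (auto simp: C_def intro: inj)
  define S where "S c = (\<lambda>x. tab_row lam (g x)) ` C c" for c
  have cardS: "card (S c) = card (C c)" for c unfolding S_def by (rule card_image[OF injS])
  have sumS: "\<Sum>(S c) = (\<Sum>x\<in>C c. tab_row lam (g x))" for c
    unfolding S_def by (simp add: sum.reindex[OF injS])
  have sumD: "\<Sum>{..<card (C c)} = (\<Sum>x\<in>C c. tab_row mu x)" for c
    using tab_row_image_column[OF mu, of c]
    by (simp flip: C_def) (metis (no_types) sum.reindex_cong)
  have nl: "row_sum lam = (\<Sum>c\<in>tab_col mu ` {..<m}. \<Sum>(S c))"
  proof -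
    have "row_sum lam = (\<Sum>x<m. tab_row lam (g x))"
      unfolding row_sum_def sl using sum.permute[OF gm, of "tab_row lam"] by (simp add: o_def)
    then show ?thesis by (simp add: sumS sum_by_columns[of _ _ "tab_col mu"] C_def)
  qed
  have nm: "row_sum mu = (\<Sum>c\<in>tab_col mu ` {..<m}. \<Sum>{..<card (C c)})"
    unfolding sumD unfolding row_sum_def sm C_def by (rule sum_by_columns)
  have le: "\<Sum>{..<card (C c)} \<le> \<Sum>(S c)" for c
    using sum_lessThan_card_le(1)[of "S c"] finC by (simp add: cardS) (simp add: S_def)
  show "row_sum mu \<le> row_sum lam"
    unfolding nl nm using le by (rule sum_mono)
  assume eq: "row_sum lam = row_sum mu"
  have SD: "S c = tab_row mu ` C c" if "c \<in> tab_col mu ` {..<m}" for c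
  proof -
    have "\<Sum>(S c) = \<Sum>{..<card (C c)}"
    proof (rule ccontr)
      assume "\<Sum>(S c) \<noteq> \<Sum>{..<card (C c)}"
      then have "\<Sum>{..<card (C c)} < \<Sum>(S c)" using le[of c] by simp
      then have "row_sum mu < row_sum lam"
        unfolding nl nm using le that by (intro sum_strict_mono_ex1) auto
      then show False using eq by simp
    qed
    then show ?thesis
      using sum_lessThan_card_le(2)[of "S c"] cardS[of c] tab_row_image_column(1)[OF mu, of c] finC
      by (simp add: C_def S_def)
  qed
  \<comment> \<open>\<open>q\<close> moves \<open>x\<close> inside its column to the row prescribed
    by \<open>g x\<close>; what remains, \<open>g\<close> after the inverse of \<open>q\<close>,
    preserves rows.\<close>
  define q where "q x = (if x < m then tableau_entry mu (tab_row lam (g x)) (tab_col mu x) else x)" for x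
  have q: "q x < m" "tab_row mu (q x) = tab_row lam (g x)" "tab_col mu (q x) = tab_col mu x"
    if "x < m" for x
  proof -
    have "tab_row lam (g x) \<in> S (tab_col mu x)" using that by (auto simp: S_def C_def)
    then have "tab_row lam (g x) \<in> tab_row mu ` C (tab_col mu x)" using SD that by blast
    then obtain y where y: "y < m" "tab_col mu y = tab_col mu x" "tab_row mu y = tab_row lam (g x)"
      by (auto simp: C_def)
    then have "q x = y" using tableau_coordinates(3)[of y mu] sm that by (simp add: q_def)
    then show "q x < m" "tab_row mu (q x) = tab_row lam (g x)" "tab_col mu (q x) = tab_col mu x"
      using y by auto
  qed
  have "inj_on q {..<m}"
    by (rule inj_onI) (metis inj q(2,3) lessThan_iff)
  then have "bij_betw q {..<m} {..<m}"
    using q(1) by (intro bij_betw_imageI endo_inj_surj) auto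
  then have qm: "q permutes {..<m}"
    by (rule bij_imp_permutes) (simp add: q_def)
  \<comment> \<open>On the places below \<open>m\<close>, \<open>tab_row mu\<close> after
    \<open>q\<close> agrees with \<open>tab_row lam\<close> after \<open>g\<close>, and
    \<open>q\<close> and \<open>g\<close> are permutations; so corresponding rows of the two shapes
    have equally many boxes.\<close>
  have "card {x. x < m \<and> tab_row mu x = r} = card {x. x < m \<and> tab_row lam x = r}" for r
  proof -
    have "card {x. x < m \<and> tab_row f x = r} = card {x. x < m \<and> tab_row f (h x) = r}"
      if h: "h permutes {..<m}" for h f
    proof -
      have "bij_betw h {x. x < m \<and> tab_row f (h x) = r} {x. x < m \<and> tab_row f x = r}"
        by (rule bij_betw_byWitness[where f'="inv_into UNIV h"])
          (use permutes_in_image[OF h] permutes_in_image[OF permutes_inv[OF h]]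
            permutes_inverses[OF h] in auto)
      then show ?thesis by (simp add: bij_betw_same_card)
    qed
    note c = this
    have "{x. x < m \<and> tab_row mu (q x) = r} = {x. x < m \<and> tab_row lam (g x) = r}"
      using q by auto
    then show ?thesis using c[OF qm, of mu] c[OF gm, of lam] by simp
  qed
  then have nth: "(if r < length mu then mu ! r else 0) = (if r < length lam then lam ! r else 0)" for r
    unfolding card_tab_row[OF sl] card_tab_row[OF sm] .
  have "length mu = length lam"
    using nth[of "length mu"] nth[of "length lam"] partitions_ofD(3)[OF lam, of "length mu"]
      partitions_ofD(3)[OF mu, of "length lam"]
    by (metis less_irrefl linorder_neqE_nat)
  then have lm: "lam = mu" using nth by (intro nth_equalityI) (auto split: if_splits, metis)
  have "q \<in> col_stabilizer lam"
    unfolding col_stabilizer_eq[OF sl] using q lm qm by (simp add: sym_group_def)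
  moreover have "g \<circ> inv_into UNIV q \<in> row_stabilizer lam"
    unfolding row_stabilizer_eq[OF sl]
  proof (intro CollectI conjI allI impI)
    show "g \<circ> inv_into UNIV q \<in> sym_group m"
      using gm permutes_inv[OF qm] by (simp add: sym_group_def permutes_compose)
    fix x assume "x < m"
    then have "inv_into UNIV q x < m" using permutes_in_image[OF permutes_inv[OF qm], of x] by simp
    from q(2)[OF this] show "tab_row lam ((g \<circ> inv_into UNIV q) x) = tab_row lam x"
      using lm permutes_inverses[OF qm] by simp
  qed
  moreover have "g = (g \<circ> inv_into UNIV q) \<circ> q"
    using permutes_inv_o[OF qm] by (simp add: o_assoc[symmetric])
  ultimately show "lam = mu \<and> (\<exists>p\<in>row_stabilizer lam. \<exists>q\<in>col_stabilizer lam. g = p \<circ> q)"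
    using lm by blast
qed

section \<open>Linear maps on formal linear combinations\<close>

definition lc_lin :: "(('k \<Rightarrow>\<^sub>0 complex) \<Rightarrow> ('l \<Rightarrow>\<^sub>0 complex)) \<Rightarrow> bool" where
  "lc_lin T \<longleftrightarrow> (\<forall>x y. T (x + y) = T x + T y) \<and> (\<forall>a x. T (lc_scale a x) = lc_scale a (T x))"

lemma lc_lin_add: "lc_lin T \<Longrightarrow> T (x + y) = T x + T y"
  and lc_lin_scale: "lc_lin T \<Longrightarrow> T (lc_scale a x) = lc_scale a (T x)"
  by (auto simp: lc_lin_def)

lemma lc_lin_zero: "lc_lin T \<Longrightarrow> T 0 = 0"
  using lc_lin_scale[of T 0 0] by simp

lemma lc_lin_sum: "lc_lin T \<Longrightarrow> T (\<Sum>i\<in>I. f i) = (\<Sum>i\<in>I. T (f i))"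
  by (induction I rule: infinite_finite_induct) (auto simp: lc_lin_zero lc_lin_add)

lemma lc_lin_compose: "lc_lin T \<Longrightarrow> lc_lin S \<Longrightarrow> lc_lin (\<lambda>v. T (S v))"
  by (simp add: lc_lin_def)

lemma lc_lin_sumI: "(\<And>i. i \<in> I \<Longrightarrow> lc_lin (T i)) \<Longrightarrow> lc_lin (\<lambda>v. \<Sum>i\<in>I. T i v)"
  by (auto simp: lc_lin_def sum.distrib lc.scale_sum_right)

lemma lc_lin_scaleI: "lc_lin T \<Longrightarrow> lc_lin (\<lambda>v. lc_scale a (T v))"
  by (auto simp: lc_lin_def lc.scale_right_distrib mult.commute)

lemma lc_scale_single [simp]: "lc_scale a (single k b) = single k (a * b)"
  by (rule poly_mapping_eqI) (simp add: lookup_single when_def)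

lemma lc_expand: 
  assumes "finite S" "keys f \<subseteq> S"
  shows "f = (\<Sum>k\<in>S. lc_scale (lookup f k) (single k 1))"
proof (rule poly_mapping_eqI)
  fix k
  have "lookup f k = 0" if "k \<notin> S"
    using that assms(2) by (auto simp: in_keys_iff)
  then show "lookup f k =
      lookup (\<Sum>k\<in>S. lc_scale (lookup f k) (single k 1)) k"
    using assms(1) by (auto simp: lookup_sum lookup_single when_def)
qed

lemma lc_lin_eqI:
  assumes "lc_lin T" "lc_lin S" "\<And>k. k \<in> keys f \<Longrightarrow> T (single k 1) = S (single k 1)"
  shows "T f = S f"
proof -
  have "T f = (\<Sum>k\<in>keys f. lc_scale (lookup f k) (T (single k 1)))"
    by (subst lc_expand[OF finite_keys subset_refl, of f])
      (simp only: lc_lin_sum[OF assms(1)] lc_lin_scale[OF assms(1)])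
  also have "\<dots> = (\<Sum>k\<in>keys f. lc_scale (lookup f k) (S (single k 1)))"
    using assms(3) by simp
  also have "\<dots> = S f"
    by (subst (3) lc_expand[OF finite_keys subset_refl, of f])
      (simp only: lc_lin_sum[OF assms(2)] lc_lin_scale[OF assms(2)])
  finally show ?thesis .
qed

definition lc_ext :: "('k \<Rightarrow> ('l \<Rightarrow>\<^sub>0 complex)) \<Rightarrow> ('k \<Rightarrow>\<^sub>0 complex) \<Rightarrow> ('l \<Rightarrow>\<^sub>0 complex)" where
  "lc_ext D f = (\<Sum>k\<in>keys f. lc_scale (lookup f k) (D k))"

lemma lc_ext_eq:
  assumes "finite S" "keys f \<subseteq> S"
  shows "lc_ext D f = (\<Sum>k\<in>S. lc_scale (lookup f k) (D k))"
  unfolding lc_ext_def using assms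
  by (intro sum.mono_neutral_left) (auto simp: in_keys_iff)

lemma lc_lin_ext: "lc_lin (lc_ext D)"
  unfolding lc_lin_def
proof (intro conjI allI)
  fix x y :: "'a \<Rightarrow>\<^sub>0 complex" and a :: complex
  let ?S = "keys x \<union> keys y"
  have "finite ?S" by simp
  moreover have "keys (x + y) \<subseteq> ?S" by (rule keys_add)
  ultimately show "lc_ext D (x + y) = lc_ext D x + lc_ext D y"
    by (subst (1 2 3) lc_ext_eq[where S="?S"]) (auto simp: lookup_add lc.scale_left_distrib sum.distrib)
  have "keys (lc_scale a x) \<subseteq> keys x"
    by (auto simp: in_keys_iff)
  then show "lc_ext D (lc_scale a x) = lc_scale a (lc_ext D x)"
    by (subst (1 2) lc_ext_eq[where S="keys x"]) (auto simp: lc.scale_sum_right)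
qed

lemma lc_ext_single [simp]: "lc_ext D (single k a) = lc_scale a (D k)"
  by (subst lc_ext_eq[where S="{k}"]) auto

lemma lc_map_eq_ext: "lc_map \<phi> = lc_ext (\<lambda>k. single (\<phi> k) 1)"
  by (simp add: fun_eq_iff lc_map_def lc_ext_def)

lemma lc_lin_map: "lc_lin (lc_map \<phi>)"
  unfolding lc_map_eq_ext by (rule lc_lin_ext)

lemma lc_map_single [simp]: "lc_map \<phi> (single k a) = single (\<phi> k) a"
  by (simp add: lc_map_eq_ext)

lemma lc_map_compose: "lc_map \<phi> (lc_map \<psi> f) = lc_map (\<phi> \<circ> \<psi>) f"
  by (rule lc_lin_eqI[where T="\<lambda>f. lc_map \<phi> (lc_map \<psi> f)"]) (simp_all add: lc_lin_map lc_lin_compose)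

lemma lc_map_id: "lc_map (\<lambda>x. x) f = f"
  by (rule lc_lin_eqI[where S="\<lambda>f. f"]) (simp_all add: lc_lin_map, simp add: lc_lin_def)

lemma lookup_lc_map_inj:
  assumes "inj \<phi>"
  shows "lookup (lc_map \<phi> f) (\<phi> k) = lookup f k"
  unfolding lc_map_def using assms
  by (auto simp: lookup_sum lookup_single when_def inj_eq in_keys_iff)

lemma keys_lc_map: "keys (lc_map \<phi> f) \<subseteq> \<phi> ` keys f"
proof
  fix k assume "k \<in> keys (lc_map \<phi> f)"
  then have "(\<Sum>l\<in>keys f. lookup (single (\<phi> l) (lookup f l)) k) \<noteq> 0"
    by (simp add: lc_map_def lookup_sum in_keys_iff)
  then obtain l where "l \<in> keys f"
      "lookup (single (\<phi> l) (lookup f l)) k \<noteq> 0"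
    by (rule sum.not_neutral_contains_not_neutral)
  then show "k \<in> \<phi> ` keys f" by (auto simp: lookup_single when_def split: if_splits)
qed

section \<open>Young symmetrizers\<close>

lemma sym_groupD: "g \<in> sym_group m \<Longrightarrow> g permutes {..<m}" "g \<in> sym_group m \<Longrightarrow> permutation g"
  by (auto simp: sym_group_def permutation_permutes)

lemma finite_sym_group [simp]: "finite (sym_group m)"
  by (simp add: sym_group_def finite_permutations)

lemma id_in_sym_group [simp]: "id \<in> sym_group m"
  by (simp add: sym_group_def permutes_id)

lemma compose_in_sym_group: "g \<in> sym_group m \<Longrightarrow> h \<in> sym_group m \<Longrightarrow> g \<circ> h \<in> sym_group m"
  by (simp add: sym_group_def permutes_compose)

lemma inv_in_sym_group: "g \<in> sym_group m \<Longrightarrow> inv_into UNIV g \<in> sym_group m"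
  by (simp add: sym_group_def permutes_inv)

lemma sym_group_inverses: "g \<in> sym_group m \<Longrightarrow> g (inv_into UNIV g x) = x"
    "g \<in> sym_group m \<Longrightarrow> inv_into UNIV g (g x) = x"
  by (auto simp: sym_group_def permutes_inverses)

lemma sym_group_less: "g \<in> sym_group m \<Longrightarrow> g x < m \<longleftrightarrow> x < m"
  using permutes_in_image[of g "{..<m}" x] by (simp add: sym_group_def)

abbreviation "sgn_perm q \<equiv> (of_int (sign q) :: complex)"

lemma sgn_perm_square [simp]: "sgn_perm q * sgn_perm q = 1"
  by (simp add: sign_def)

lemma sgn_perm_compose: "p \<in> sym_group m \<Longrightarrow> q \<in> sym_group m \<Longrightarrow> sgn_perm (p \<circ> q) = sgn_perm p * sgn_perm q"
  by (simp add: sign_compose sym_groupD(2))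

definition perm_subgroup :: "nat \<Rightarrow> (nat \<Rightarrow> nat) set \<Rightarrow> bool" where
  "perm_subgroup m H \<longleftrightarrow> H \<subseteq> sym_group m \<and> id \<in> H \<and> (\<forall>g\<in>H. \<forall>h\<in>H. g \<circ> h \<in> H) \<and> (\<forall>g\<in>H. inv_into UNIV g \<in> H)"

lemma perm_subgroup_stabilizer: "perm_subgroup m {p \<in> sym_group m. \<forall>x<m. f (p x) = f x}"
  unfolding perm_subgroup_def
proof (intro conjI ballI)
  fix g assume g: "g \<in> {p \<in> sym_group m. \<forall>x<m. f (p x) = f x}"
  show "inv_into UNIV g \<in> {p \<in> sym_group m. \<forall>x<m. f (p x) = f x}"
  proof (intro CollectI conjI allI impI)
    show gi: "inv_into UNIV g \<in> sym_group m" using g by (simp add: inv_in_sym_group)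
    fix x assume "x < m"
    then have "f (g (inv_into UNIV g x)) = f (inv_into UNIV g x)"
      using g sym_group_less[OF gi] by simp
    then show "f (inv_into UNIV g x) = f x" using g sym_group_inverses(1)[of g m x] by simp
  qed
next
  fix g h assume gh: "g \<in> {p \<in> sym_group m. \<forall>x<m. f (p x) = f x}" "h \<in> {p \<in> sym_group m. \<forall>x<m. f (p x) = f x}"
  then have "h x < m" if "x < m" for x using sym_group_less[of h m x] that by simp
  then show "g \<circ> h \<in> {p \<in> sym_group m. \<forall>x<m. f (p x) = f x}"
    using gh by (simp add: compose_in_sym_group)
qed auto

lemma perm_subgroup_row: "sum_list lam = m \<Longrightarrow> perm_subgroup m (row_stabilizer lam)"
  and perm_subgroup_col: "sum_list lam = m \<Longrightarrow> perm_subgroup m (col_stabilizer lam)"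
  by (simp_all add: row_stabilizer_eq col_stabilizer_eq perm_subgroup_stabilizer)

lemma perm_subgroup_sum_left:
  assumes "perm_subgroup m H" "p \<in> H"
  shows "(\<Sum>q\<in>H. f (p \<circ> q)) = (\<Sum>q\<in>H. f q)"
proof -
  have pS: "p \<in> sym_group m" using assms by (auto simp: perm_subgroup_def)
  show ?thesis
    by (rule sum.reindex_bij_witness[where i="\<lambda>q. inv_into UNIV p \<circ> q" and j="\<lambda>q. p \<circ> q"])
      (use assms sym_group_inverses[OF pS] in \<open>auto simp: perm_subgroup_def fun_eq_iff o_def\<close>)
qed

lemma perm_subgroup_sum_right:
  assumes "perm_subgroup m H" "p \<in> H"
  shows "(\<Sum>q\<in>H. f (q \<circ> p)) = (\<Sum>q\<in>H. f q)"
proof -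
  have pS: "p \<in> sym_group m" using assms by (auto simp: perm_subgroup_def)
  show ?thesis
    by (rule sum.reindex_bij_witness[where i="\<lambda>q. q \<circ> inv_into UNIV p" and j="\<lambda>q. q \<circ> p"])
      (use assms sym_group_inverses[OF pS] in \<open>auto simp: perm_subgroup_def fun_eq_iff o_def\<close>)
qed

text \<open>Stated for any action \<open>F\<close>, since the same operators are applied to the
  group algebra under left multiplication and to polynomials under renaming of variables.\<close>

definition row_op :: "nat list \<Rightarrow> ((nat \<Rightarrow> nat) \<Rightarrow> ('k \<Rightarrow>\<^sub>0 complex) \<Rightarrow> ('k \<Rightarrow>\<^sub>0 complex)) \<Rightarrow> ('k \<Rightarrow>\<^sub>0 complex) \<Rightarrow> ('k \<Rightarrow>\<^sub>0 complex)" where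
  "row_op lam F v = (\<Sum>p\<in>row_stabilizer lam. F p v)"

definition col_op :: "nat list \<Rightarrow> ((nat \<Rightarrow> nat) \<Rightarrow> ('k \<Rightarrow>\<^sub>0 complex) \<Rightarrow> ('k \<Rightarrow>\<^sub>0 complex)) \<Rightarrow> ('k \<Rightarrow>\<^sub>0 complex) \<Rightarrow> ('k \<Rightarrow>\<^sub>0 complex)" where
  "col_op lam F v = (\<Sum>q\<in>col_stabilizer lam. lc_scale (sgn_perm q) (F q v))"

definition young_op :: "nat list \<Rightarrow> ((nat \<Rightarrow> nat) \<Rightarrow> ('k \<Rightarrow>\<^sub>0 complex) \<Rightarrow> ('k \<Rightarrow>\<^sub>0 complex)) \<Rightarrow> ('k \<Rightarrow>\<^sub>0 complex) \<Rightarrow> ('k \<Rightarrow>\<^sub>0 complex)" where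
  "young_op lam F v = row_op lam F (col_op lam F v)"

locale sym_rep =
  fixes F :: "(nat \<Rightarrow> nat) \<Rightarrow> ('k \<Rightarrow>\<^sub>0 complex) \<Rightarrow> ('k \<Rightarrow>\<^sub>0 complex)"
  assumes lin: "lc_lin (F g)" and comp: "F (g \<circ> h) v = F g (F h v)" and F_id: "F id v = v"
begin

lemma lin_row_op: "lc_lin (row_op lam F)"
  unfolding row_op_def[abs_def] by (intro lc_lin_sumI lin)

lemma lin_col_op: "lc_lin (col_op lam F)"
  unfolding col_op_def[abs_def] by (intro lc_lin_sumI lc_lin_scaleI lin)

lemma lin_young_op: "lc_lin (young_op lam F)"
  unfolding young_op_def[abs_def] by (rule lc_lin_compose[OF lin_row_op lin_col_op])

lemma row_op_left: "sum_list lam = m \<Longrightarrow> p \<in> row_stabilizer lam \<Longrightarrow> F p (row_op lam F v) = row_op lam F v"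
  using perm_subgroup_sum_left[OF perm_subgroup_row, of lam m p "\<lambda>q. F q v"]
  by (simp add: row_op_def lc_lin_sum[OF lin] comp)

lemma row_op_right: "sum_list lam = m \<Longrightarrow> p \<in> row_stabilizer lam \<Longrightarrow> row_op lam F (F p v) = row_op lam F v"
  using perm_subgroup_sum_right[OF perm_subgroup_row, of lam m p "\<lambda>q. F q v"]
  by (simp add: row_op_def comp)

lemma col_sgn:
  assumes "sum_list lam = m" "p \<in> col_stabilizer lam" "q \<in> col_stabilizer lam"
  shows "sgn_perm (p \<circ> q) = sgn_perm p * sgn_perm q"
  using assms perm_subgroup_col[of lam m] sgn_perm_compose by (auto simp: perm_subgroup_def)

lemma col_op_left:
  assumes "sum_list lam = m" "p \<in> col_stabilizer lam"
  shows "F p (col_op lam F v) = lc_scale (sgn_perm p) (col_op lam F v)"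
proof -
  have "col_op lam F v = (\<Sum>q\<in>col_stabilizer lam. lc_scale (sgn_perm (p \<circ> q)) (F (p \<circ> q) v))"
    unfolding col_op_def by (rule perm_subgroup_sum_left[symmetric, OF perm_subgroup_col assms(2)]) (rule assms)
  also have "\<dots> = (\<Sum>q\<in>col_stabilizer lam. lc_scale (sgn_perm p) (lc_scale (sgn_perm q) (F p (F q v))))"
    using col_sgn[OF assms] by (simp add: comp)
  also have "\<dots> = lc_scale (sgn_perm p) (F p (col_op lam F v))"
    by (simp add: col_op_def lc_lin_sum[OF lin] lc_lin_scale[OF lin] lc.scale_sum_right)
  finally have "lc_scale (sgn_perm p) (col_op lam F v)
      = lc_scale (sgn_perm p) (lc_scale (sgn_perm p) (F p (col_op lam F v)))" by simp
  then show ?thesis by (simp del: of_int_mult)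
qed

lemma col_op_right:
  assumes "sum_list lam = m" "p \<in> col_stabilizer lam"
  shows "col_op lam F (F p v) = lc_scale (sgn_perm p) (col_op lam F v)"
proof -
  have "col_op lam F v = (\<Sum>q\<in>col_stabilizer lam. lc_scale (sgn_perm (q \<circ> p)) (F (q \<circ> p) v))"
    unfolding col_op_def by (rule perm_subgroup_sum_right[symmetric, OF perm_subgroup_col assms(2)]) (rule assms)
  also have "\<dots> = (\<Sum>q\<in>col_stabilizer lam. lc_scale (sgn_perm p) (lc_scale (sgn_perm q) (F q (F p v))))"
    using col_sgn[OF assms(1) _ assms(2)] by (simp add: comp mult.commute)
  also have "\<dots> = lc_scale (sgn_perm p) (col_op lam F (F p v))"
    by (simp add: col_op_def lc.scale_sum_right)
  finally have "lc_scale (sgn_perm p) (col_op lam F v)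
      = lc_scale (sgn_perm p) (lc_scale (sgn_perm p) (col_op lam F (F p v)))" by simp
  then show ?thesis by (simp del: of_int_mult)
qed

end

section \<open>Products of Young symmetrizers in the group algebra\<close>

abbreviation left_mult :: "(nat \<Rightarrow> nat) \<Rightarrow> ((nat \<Rightarrow> nat) \<Rightarrow>\<^sub>0 complex) \<Rightarrow> ((nat \<Rightarrow> nat) \<Rightarrow>\<^sub>0 complex)" where
  "left_mult g \<equiv> lc_map ((\<circ>) g)"

abbreviation right_mult :: "(nat \<Rightarrow> nat) \<Rightarrow> ((nat \<Rightarrow> nat) \<Rightarrow>\<^sub>0 complex) \<Rightarrow> ((nat \<Rightarrow> nat) \<Rightarrow>\<^sub>0 complex)" where
  "right_mult g \<equiv> lc_map (\<lambda>h. h \<circ> g)"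

abbreviation unit_elt :: "(nat \<Rightarrow> nat) \<Rightarrow>\<^sub>0 complex" where
  "unit_elt \<equiv> single id 1"

interpretation left: sym_rep left_mult
proof
  show "left_mult (g \<circ> h) v = left_mult g (left_mult h v)" for g h v
  proof -
    have "(\<circ>) (g \<circ> h) = (\<circ>) g \<circ> ((\<circ>) h :: (nat \<Rightarrow> nat) \<Rightarrow> _)" by (auto simp: fun_eq_iff)
    then show ?thesis by (simp add: lc_map_compose)
  qed
  show "left_mult id v = v" for v
  proof -
    have "(\<circ>) id = (\<lambda>x :: nat \<Rightarrow> nat. x)" by (auto simp: fun_eq_iff)
    then show ?thesis by (simp only: lc_map_id)
  qed
qed (rule lc_lin_map)

lemma left_right_commute: "right_mult g (left_mult h v) = left_mult h (right_mult g v)"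
  by (simp add: lc_map_compose) (simp add: o_def)

lemma row_op_right_mult: "right_mult g (row_op lam left_mult v) = row_op lam left_mult (right_mult g v)"
  by (simp add: row_op_def lc_lin_sum[OF lc_lin_map] left_right_commute)

lemma col_op_right_mult: "right_mult g (col_op lam left_mult v) = col_op lam left_mult (right_mult g v)"
  by (simp add: col_op_def lc_lin_sum[OF lc_lin_map] lc_lin_scale[OF lc_lin_map] left_right_commute)

lemma right_mult_unit: "right_mult g unit_elt = left_mult g unit_elt"
  by simp

text \<open>With the symmetrizer written as an operator applied to the unit, right multiplications,
  which commute with all left operators, can be moved to the unit, where they coincide with left
  multiplications.\<close>

lemma young_symmetrizer_eq: "young_symmetrizer lam = young_op lam left_mult unit_elt"
  by (simp add: young_symmetrizer_def young_op_def row_op_def col_op_def lc_lin_sum[OF lc_lin_map])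

definition group_alg :: "nat \<Rightarrow> ((nat \<Rightarrow> nat) \<Rightarrow>\<^sub>0 complex) set" where
  "group_alg m = {x. keys x \<subseteq> sym_group m}"

lemma subspace_group_alg: "lc.subspace (group_alg m)"
  unfolding lc.subspace_def group_alg_def
proof (intro conjI ballI allI)
  fix x y :: "(nat \<Rightarrow> nat) \<Rightarrow>\<^sub>0 complex" and c :: complex
  assume "x \<in> {x. keys x \<subseteq> sym_group m}"
  then show "lc_scale c x \<in> {x. keys x \<subseteq> sym_group m}"
    by (auto simp: in_keys_iff)
  assume "y \<in> {x. keys x \<subseteq> sym_group m}"
  then show "x + y \<in> {x. keys x \<subseteq> sym_group m}"
    using \<open>x \<in> _\<close> keys_add[of x y] by blast
qed simp

lemma left_mult_group_alg: "g \<in> sym_group m \<Longrightarrow> x \<in> group_alg m \<Longrightarrow> left_mult g x \<in> group_alg m"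
  using keys_lc_map[of "(\<circ>) g" x] compose_in_sym_group[of g m] unfolding group_alg_def by blast

lemma stabilizers_subset: "sum_list lam = m \<Longrightarrow> row_stabilizer lam \<subseteq> sym_group m"
    "sum_list lam = m \<Longrightarrow> col_stabilizer lam \<subseteq> sym_group m"
  by (auto simp: row_stabilizer_def col_stabilizer_def)

lemma finite_stabilizers [simp]: "finite (row_stabilizer lam)" "finite (col_stabilizer lam)"
  by (auto simp: row_stabilizer_def col_stabilizer_def)

lemma row_op_subspace:
  assumes "lc.subspace V" "\<And>g v. g \<in> sym_group m \<Longrightarrow> v \<in> V \<Longrightarrow> F g v \<in> V" "sum_list lam = m" "v \<in> V"
  shows "row_op lam F v \<in> V"
  unfolding row_op_def using assms stabilizers_subset[of lam m] by (intro lc.subspace_sum) auto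

lemma col_op_subspace:
  assumes "lc.subspace V" "\<And>g v. g \<in> sym_group m \<Longrightarrow> v \<in> V \<Longrightarrow> F g v \<in> V" "sum_list lam = m" "v \<in> V"
  shows "col_op lam F v \<in> V"
  unfolding col_op_def using assms stabilizers_subset[of lam m]
  by (intro lc.subspace_sum lc.subspace_scale) auto

lemma young_op_subspace:
  assumes "lc.subspace V" "\<And>g v. g \<in> sym_group m \<Longrightarrow> v \<in> V \<Longrightarrow> F g v \<in> V" "sum_list lam = m" "v \<in> V"
  shows "young_op lam F v \<in> V"
  unfolding young_op_def by (intro row_op_subspace[where m=m] col_op_subspace[where m=m] assms)

lemma unit_group_alg: "unit_elt \<in> group_alg m"
  by (simp add: group_alg_def)

lemma lookup_left_mult:
  assumes "g \<in> sym_group m"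
  shows "lookup (left_mult g x) (g \<circ> h) = lookup x h"
proof -
  have "inj ((\<circ>) g)"
    using sym_group_inverses(2)[OF assms] by (intro injI) (simp add: fun_eq_iff, metis)
  from lookup_lc_map_inj[OF this] show ?thesis .
qed

lemma lookup_right_mult:
  assumes "g \<in> sym_group m"
  shows "lookup (right_mult g x) (h \<circ> g) = lookup x h"
proof -
  have "inj (\<lambda>h. h \<circ> g)"
    using sym_group_inverses(1)[OF assms] by (intro injI) (simp add: fun_eq_iff, metis)
  from lookup_lc_map_inj[OF this, of x h] show ?thesis .
qed

text \<open>Sign reversing involution: this is how all the products of symmetrizers below vanish.\<close>

lemma lookup_eq_0_if_signs_differ:
  assumes t: "t \<in> sym_group m" "t' \<in> sym_group m" "t \<circ> g = g \<circ> t'"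
    and z: "left_mult t z = lc_scale a z" "right_mult t' z = lc_scale b z" "a \<noteq> b"
  shows "lookup z g = 0"
proof -
  have "lookup z g = lookup (left_mult t z) (t \<circ> g)"
    by (rule lookup_left_mult[OF t(1), symmetric])
  then have 1: "lookup z g = a * lookup z (t \<circ> g)" unfolding z by simp
  have "lookup z g = lookup (right_mult t' z) (g \<circ> t')"
    by (rule lookup_right_mult[OF t(2), symmetric])
  then have 2: "lookup z g = b * lookup z (t \<circ> g)" unfolding z t by simp
  show ?thesis using 1 2 z(3) by (simp add: mult_right_cancel)
qed

lemma transpose_sym_group: "x < m \<Longrightarrow> y < m \<Longrightarrow> transpose x y \<in> sym_group m"
  by (simp add: sym_group_def permutes_swap_id)

lemma transpose_row_stabilizer:
  "sum_list lam = m \<Longrightarrow> x < m \<Longrightarrow> y < m \<Longrightarrow> tab_row lam x = tab_row lam y \<Longrightarrow> transpose x y \<in> row_stabilizer lam"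
  by (auto simp: row_stabilizer_eq transpose_sym_group transpose_def)

lemma transpose_col_stabilizer:
  "sum_list lam = m \<Longrightarrow> x < m \<Longrightarrow> y < m \<Longrightarrow> tab_col lam x = tab_col lam y \<Longrightarrow> transpose x y \<in> col_stabilizer lam"
  by (auto simp: col_stabilizer_eq transpose_sym_group transpose_def)

lemma transpose_conj:
  assumes "g \<in> sym_group m"
  shows "transpose (g x) (g y) \<circ> g = g \<circ> transpose x y"
  using sym_group_inverses(2)[OF assms] by (auto simp: fun_eq_iff transpose_def) metis+

lemma sgn_perm_transpose: "x \<noteq> y \<Longrightarrow> sgn_perm (transpose x y) = -1"
  by (simp add: sign_swap_id)

text \<open>The transposition of \<open>g x\<close> and \<open>g y\<close> is a row permutation,
  that of \<open>x\<close> and \<open>y\<close> a column permutation, and \<open>g\<close>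
  conjugates one to the other. The first fixes \<open>z\<close> from the left, the second negates it
  from the right, so the coefficient at \<open>g\<close> equals its own negative.\<close>

lemma lookup_young_vanish:
  assumes lam: "sum_list lam = m" and mu: "sum_list mu = m" and g: "g \<in> sym_group m"
    and xy: "x < m" "y < m" "x \<noteq> y" "tab_col mu x = tab_col mu y" "tab_row lam (g x) = tab_row lam (g y)"
    and L: "\<And>p. p \<in> row_stabilizer lam \<Longrightarrow> left_mult p z = z"
    and R: "\<And>q. q \<in> col_stabilizer mu \<Longrightarrow> right_mult q z = lc_scale (sgn_perm q) z"
  shows "lookup z g = 0"
proof (rule lookup_eq_0_if_signs_differ[OF _ _ transpose_conj[OF g, of x y]])
  have gxy: "g x < m" "g y < m" using xy sym_group_less[OF g] by auto
  show "transpose (g x) (g y) \<in> sym_group m" "transpose x y \<in> sym_group m"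
    using gxy xy by (auto intro: transpose_sym_group)
  show "left_mult (transpose (g x) (g y)) z = lc_scale 1 z"
    using L[OF transpose_row_stabilizer[OF lam gxy xy(5)]] by simp
  show "right_mult (transpose x y) z = lc_scale (-1) z"
    using R[OF transpose_col_stabilizer[OF mu xy(1,2,4)]] sgn_perm_transpose[OF xy(3)] by simp
qed simp

lemma group_alg_eqI:
  assumes "x \<in> group_alg m" "y \<in> group_alg m"
    "\<And>g. g \<in> sym_group m \<Longrightarrow> lookup x g = lookup y g"
  shows "x = y"
proof (rule poly_mapping_eqI)
  fix g show "lookup x g = lookup y g"
  proof (cases "g \<in> sym_group m")
    case False
    then have "g \<notin> keys x" "g \<notin> keys y"
      using assms(1,2) by (auto simp: group_alg_def)
    then show ?thesis by (simp add: in_keys_iff)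
  qed (rule assms(3))
qed

lemma young_op_left:
  "sum_list lam = m \<Longrightarrow> p \<in> row_stabilizer lam \<Longrightarrow>
    left_mult p (young_op lam left_mult v) = young_op lam left_mult v"
  unfolding young_op_def by (rule left.row_op_left)

lemma young_symmetrizer_right:
  assumes "sum_list mu = m" "q \<in> col_stabilizer mu"
  shows "right_mult q (young_symmetrizer mu) = lc_scale (sgn_perm q) (young_symmetrizer mu)"
  unfolding young_symmetrizer_eq young_op_def row_op_right_mult col_op_right_mult right_mult_unit
    left.col_op_right[OF assms] lc_lin_scale[OF left.lin_row_op] ..

lemma young_op_right_mult: "right_mult g (young_op lam left_mult v) = young_op lam left_mult (right_mult g v)"
  by (simp add: young_op_def row_op_right_mult col_op_right_mult)

lemma young_group_alg:
  assumes "sum_list lam = m" "x \<in> group_alg m"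
  shows "young_op lam left_mult x \<in> group_alg m"
  using young_op_subspace[OF subspace_group_alg left_mult_group_alg assms] .

text \<open>\<open>columns_into_rows\<close> compares the shapes in one direction only, hence two
  cases. If \<open>row_sum lam\<close> is not the larger number, every coefficient of the whole
  product vanishes by the sign argument; otherwise the same argument already kills the factor in the
  middle.\<close>

lemma young_product_vanish:
  assumes lam: "lam \<in> partitions_of m" and mu: "mu \<in> partitions_of m" and "lam \<noteq> mu"
    and h: "h \<in> sym_group m"
  shows "young_op lam left_mult (left_mult h (young_symmetrizer mu)) = 0"
proof (cases "row_sum lam \<le> row_sum mu")
  note s = partitions_ofD(1)[OF lam] partitions_ofD(1)[OF mu]
  case True
  let ?z = "young_op lam left_mult (left_mult h (young_symmetrizer mu))"
  have zA: "?z \<in> group_alg m"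
    unfolding young_symmetrizer_eq by (intro young_group_alg left_mult_group_alg unit_group_alg s h)
  show ?thesis
  proof (rule group_alg_eqI[OF zA lc.subspace_0[OF subspace_group_alg]])
    fix g assume g: "g \<in> sym_group m"
    obtain x y where xy: "x < m" "y < m" "x \<noteq> y" "tab_col mu x = tab_col mu y"
        "tab_row lam (g x) = tab_row lam (g y)"
      using columns_into_rows[OF lam mu g] True \<open>lam \<noteq> mu\<close> le_antisym by metis
    have "lookup ?z g = 0"
      by (rule lookup_young_vanish[OF s g xy])
        (simp_all add: young_op_left[OF s(1)] young_symmetrizer_right[OF s(2)] young_op_right_mult left_right_commute
          lc_lin_scale[OF left.lin_young_op] lc_lin_scale[OF lc_lin_map])
    then show "lookup ?z g = lookup 0 g" by simp
  qed
next
  note s = partitions_ofD(1)[OF lam] partitions_ofD(1)[OF mu]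
  case False
  \<comment> \<open>The middle factor consists of the column antisymmetrizer of \<open>lam\<close>,
    the element \<open>h\<close> and the row symmetrizer of \<open>mu\<close>. Now columns of
    \<open>lam\<close> meet rows of \<open>mu\<close>, so the combinatorial criterion is applied to
    the inverse of \<open>g\<close>.\<close>
  have mid: "col_op lam left_mult (left_mult h (row_op mu left_mult unit_elt)) = 0" (is "?y = 0")
  proof (rule group_alg_eqI[OF _ lc.subspace_0[OF subspace_group_alg]])
    show "?y \<in> group_alg m"
      by (intro col_op_subspace[OF subspace_group_alg left_mult_group_alg s(1)]
          row_op_subspace[OF subspace_group_alg left_mult_group_alg s(2)] left_mult_group_alg unit_group_alg h)
    fix g assume g: "g \<in> sym_group m"
    define g' where "g' = inv_into UNIV g"
    have g': "g' \<in> sym_group m" using g by (simp add: g'_def inv_in_sym_group)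
    obtain x y where xy: "x < m" "y < m" "x \<noteq> y" "tab_col lam x = tab_col lam y"
        "tab_row mu (g' x) = tab_row mu (g' y)"
    proof (rule ccontr)
      assume "\<not> thesis"
      then have "row_sum lam \<le> row_sum mu"
        using that by (intro columns_into_rows(1)[OF mu lam g']) blast
      then show False using False by simp
    qed
    have g'xy: "g' x < m" "g' y < m" using xy sym_group_less[OF g'] by auto
    have t': "transpose (g' x) (g' y) \<in> row_stabilizer mu"
      by (rule transpose_row_stabilizer[OF s(2) g'xy xy(5)])
    have t: "transpose x y \<in> col_stabilizer lam"
      by (rule transpose_col_stabilizer[OF s(1) xy(1,2,4)])
    have "lookup ?y g = 0"
    proof (rule lookup_eq_0_if_signs_differ)
      show "transpose x y \<in> sym_group m" "transpose (g' x) (g' y) \<in> sym_group m"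
        using xy g'xy by (auto intro: transpose_sym_group)
      show "transpose x y \<circ> g = g \<circ> transpose (g' x) (g' y)"
        using transpose_conj[OF g, of "g' x" "g' y"] sym_group_inverses(1)[OF g] by (simp add: g'_def)
      show "left_mult (transpose x y) ?y = lc_scale (-1) ?y"
        unfolding left.col_op_left[OF s(1) t] sgn_perm_transpose[OF xy(3)] ..
      show "right_mult (transpose (g' x) (g' y)) ?y = lc_scale 1 ?y"
        unfolding col_op_right_mult left_right_commute row_op_right_mult right_mult_unit
          left.row_op_right[OF s(2) t'] by simp
    qed simp
    then show "lookup ?y g = lookup 0 g" by simp
  qed
  \<comment> \<open>Right multiplication carries the vanishing from the unit to all the other terms
    of the symmetrizer of \<open>mu\<close>.\<close>
  have "col_op lam left_mult (left_mult h (row_op mu left_mult (left_mult q unit_elt))) = 0" for q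
    unfolding right_mult_unit[symmetric] row_op_right_mult[symmetric] left_right_commute[symmetric]
      col_op_right_mult[symmetric] mid by (simp add: lc_lin_zero[OF lc_lin_map])
  then have "col_op lam left_mult (left_mult h (young_symmetrizer mu)) = 0"
    unfolding young_symmetrizer_eq young_op_def col_op_def[of mu]
    by (simp del: lc_map_single lc_scale_single
        add: lc_lin_sum[OF left.lin_row_op] lc_lin_scale[OF left.lin_row_op] lc_lin_sum[OF lc_lin_map]
        lc_lin_scale[OF lc_lin_map] lc_lin_sum[OF left.lin_col_op] lc_lin_scale[OF left.lin_col_op])
  then show ?thesis
    unfolding young_op_def by (simp add: lc_lin_zero[OF left.lin_row_op])
qed

text \<open>If a row permutation times a column permutation is the identity, the column permutation
  preserves rows as well and is trivial. So the symmetrizer is non-zero, and the coefficient at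
  \<open>id\<close> reads off the factor of any multiple of it.\<close>

lemma lookup_young_id:
  assumes "sum_list lam = m"
  shows "lookup (young_symmetrizer lam) id = 1"
proof -
  have triv: "p = id \<and> q = id"
    if pq: "p \<in> row_stabilizer lam" "q \<in> col_stabilizer lam" "p \<circ> q = id" for p q
  proof -
    note st = pq(1)[unfolded row_stabilizer_eq[OF assms]] pq(2)[unfolded col_stabilizer_eq[OF assms]]
    have "q x = x" for x
    proof (cases "x < m")
      case True
      then have qx: "q x < m" using st sym_group_less by auto
      have "tab_row lam (p (q x)) = tab_row lam (q x)" using st qx by auto
      moreover have "p (q x) = x" using pq(3) by (simp add: fun_eq_iff)
      ultimately have "tab_row lam (q x) = tab_row lam x" by simp
      moreover have "tab_col lam (q x) = tab_col lam x" using st True by auto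
      ultimately show ?thesis
        using tableau_coordinates(3)[of x lam] tableau_coordinates(3)[of "q x" lam] True qx assms by simp
    next
      case False
      then show ?thesis using st(2) by (auto simp: sym_group_def permutes_not_in)
    qed
    then have "q = id" by (simp add: fun_eq_iff)
    then show ?thesis using pq(3) by simp
  qed
  have "lookup (young_symmetrizer lam) id
      = (\<Sum>p\<in>row_stabilizer lam. \<Sum>q\<in>col_stabilizer lam. if p \<circ> q = id then sgn_perm q else 0)"
    by (simp add: young_symmetrizer_def lookup_sum lookup_single when_def)
  also have "\<dots> = (\<Sum>p\<in>row_stabilizer lam. \<Sum>q\<in>col_stabilizer lam. if p = id then if q = id then 1 else 0 else 0)"
    by (intro sum.cong refl) (auto dest: triv)
  also have "\<dots> = (\<Sum>p\<in>row_stabilizer lam. if p = id then \<Sum>q\<in>col_stabilizer lam. if q = id then 1 else 0 else 0)"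
    by (intro sum.cong refl) auto
  also have "\<dots> = 1"
    using perm_subgroup_row[OF assms] perm_subgroup_col[OF assms] by (simp add: perm_subgroup_def)
  finally show ?thesis .
qed

text \<open>By the sign argument the coefficient at \<open>g\<close> vanishes unless
  \<open>g\<close> is a row permutation times a column permutation; at such
  \<open>p \<circ> q\<close> the two symmetries express it through the coefficient at
  \<open>id\<close>.\<close>

lemma young_proportional:
  assumes lam: "lam \<in> partitions_of m" and z: "z \<in> group_alg m"
    and L: "\<And>p. p \<in> row_stabilizer lam \<Longrightarrow> left_mult p z = z"
    and R: "\<And>q. q \<in> col_stabilizer lam \<Longrightarrow> right_mult q z = lc_scale (sgn_perm q) z"
  shows "z = lc_scale (lookup z id) (young_symmetrizer lam)"
proof (rule group_alg_eqI[OF z])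
  note s = partitions_ofD(1)[OF lam]
  let ?c = "young_symmetrizer lam"
  show "lc_scale (lookup z id) ?c \<in> group_alg m"
    unfolding young_symmetrizer_eq by (intro lc.subspace_scale subspace_group_alg young_group_alg s unit_group_alg)
  have Lc: "left_mult p ?c = ?c" if "p \<in> row_stabilizer lam" for p
    unfolding young_symmetrizer_eq by (rule young_op_left[OF s that])
  have Rc: "right_mult q ?c = lc_scale (sgn_perm q) ?c" if "q \<in> col_stabilizer lam" for q
    by (rule young_symmetrizer_right[OF s that])
  have val: "lookup x (p \<circ> q) = sgn_perm q * lookup x id"
    if p: "p \<in> row_stabilizer lam" and q: "q \<in> col_stabilizer lam"
      and L: "\<And>p. p \<in> row_stabilizer lam \<Longrightarrow> left_mult p x = x"
      and R: "\<And>q. q \<in> col_stabilizer lam \<Longrightarrow> right_mult q x = lc_scale (sgn_perm q) x" for p q x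
  proof -
    have pq: "p \<in> sym_group m" "q \<in> sym_group m" using p q stabilizers_subset[OF s] by auto
    have "lookup x id = lookup x p"
      using lookup_left_mult[OF pq(1), of x id] L[OF p] by simp
    also have "\<dots> = sgn_perm q * lookup x (p \<circ> q)"
      using lookup_right_mult[OF pq(2), of x p] R[OF q] by simp
    finally have "sgn_perm q * lookup x id = (sgn_perm q * sgn_perm q) * lookup x (p \<circ> q)"
      by simp
    then show ?thesis by (simp only: sgn_perm_square mult_1)
  qed
  fix g assume g: "g \<in> sym_group m"
  show "lookup z g = lookup (lc_scale (lookup z id) ?c) g"
  proof (cases "\<exists>x y. x < m \<and> y < m \<and> x \<noteq> y \<and> tab_col lam x = tab_col lam y \<and> tab_row lam (g x) = tab_row lam (g y)")
    case True
    then obtain x y where xy: "x < m" "y < m" "x \<noteq> y" "tab_col lam x = tab_col lam y"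
        "tab_row lam (g x) = tab_row lam (g y)" by blast
    show ?thesis
      using lookup_young_vanish[OF s s g xy L R] lookup_young_vanish[OF s s g xy Lc Rc] by simp
  next
    case False
    then obtain p q where "p \<in> row_stabilizer lam" "q \<in> col_stabilizer lam" "g = p \<circ> q"
      using columns_into_rows(2)[OF lam lam g] by blast
    then show ?thesis using val[of p q, OF _ _ L R] val[of p q, OF _ _ Lc Rc] lookup_young_id[OF s] by simp
  qed
qed

definition young_scalar :: "nat list \<Rightarrow> (nat \<Rightarrow> nat) \<Rightarrow> complex" where
  "young_scalar lam h =
     lookup (young_op lam left_mult (left_mult h (young_symmetrizer lam))) id"

lemma young_product_same:
  assumes lam: "lam \<in> partitions_of m" and h: "h \<in> sym_group m"
  shows "young_op lam left_mult (left_mult h (young_symmetrizer lam))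
    = lc_scale (young_scalar lam h) (young_symmetrizer lam)"
  unfolding young_scalar_def
proof (rule young_proportional[OF lam])
  note s = partitions_ofD(1)[OF lam]
  show "young_op lam left_mult (left_mult h (young_symmetrizer lam)) \<in> group_alg m"
    unfolding young_symmetrizer_eq by (intro young_group_alg left_mult_group_alg unit_group_alg s h)
  show "left_mult p (young_op lam left_mult v) = young_op lam left_mult v"
    if "p \<in> row_stabilizer lam" for p v
    by (rule young_op_left[OF s that])
  show "right_mult q (young_op lam left_mult (left_mult h (young_symmetrizer lam)))
      = lc_scale (sgn_perm q) (young_op lam left_mult (left_mult h (young_symmetrizer lam)))"
    if "q \<in> col_stabilizer lam" for q
    unfolding young_op_right_mult left_right_commute young_symmetrizer_right[OF s that]
      lc_lin_scale[OF left.lin_young_op] lc_lin_scale[OF lc_lin_map] ..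
qed

text \<open>Classically the product of the hook lengths, that is \<open>m!\<close> divided by the
  degree of the irreducible character. What matters below is that it is non-zero.\<close>

definition young_const :: "nat list \<Rightarrow> complex" where
  "young_const lam = young_scalar lam id"

lemma young_square:
  assumes lam: "lam \<in> partitions_of m"
  shows "young_op lam left_mult (young_symmetrizer lam) = lc_scale (young_const lam) (young_symmetrizer lam)"
  using young_product_same[OF lam, of id] left.F_id by (simp add: young_const_def)

context sym_rep
begin

lemma act_left: "lc_ext (\<lambda>g. F g v) (left_mult h x) = F h (lc_ext (\<lambda>g. F g v) x)"
  by (rule lc_lin_eqI[where T="\<lambda>x. lc_ext (\<lambda>g. F g v) (left_mult h x)"
        and S="\<lambda>x. F h (lc_ext (\<lambda>g. F g v) x)"])
    (rule lc_lin_compose[OF lc_lin_ext lc_lin_map], rule lc_lin_compose[OF lin lc_lin_ext], simp add: comp)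

text \<open>\<open>lc_ext (\<lambda>g. F g v)\<close> sends an element of the group algebra to its
  action on \<open>v\<close>; in this way identities between symmetrizers carry over to every
  module.\<close>

lemma act_young: "lc_ext (\<lambda>g. F g v) (young_op lam left_mult x) = young_op lam F (lc_ext (\<lambda>g. F g v) x)"
  by (simp add: young_op_def row_op_def col_op_def lc_lin_sum[OF lc_lin_ext] lc_lin_scale[OF lc_lin_ext] act_left)

lemma young_op_square:
  assumes lam: "lam \<in> partitions_of m"
  shows "young_op lam F (young_op lam F v) = lc_scale (young_const lam) (young_op lam F v)"
proof -
  have 1: "lc_ext (\<lambda>g. F g v) (young_symmetrizer lam) = young_op lam F v"
    unfolding young_symmetrizer_eq act_young by (simp add: F_id)
  have "lc_ext (\<lambda>g. F g v) (young_op lam left_mult (young_symmetrizer lam)) = young_op lam F (young_op lam F v)"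
    unfolding act_young 1 ..
  then show ?thesis
    unfolding young_square[OF lam] lc_lin_scale[OF lc_lin_ext] 1 by simp
qed

end

lemma group_alg_span: "group_alg m \<subseteq> lc.span ((\<lambda>g. single g 1) ` sym_group m)"
proof
  fix x assume "x \<in> group_alg m"
  then have "x = (\<Sum>k\<in>sym_group m. lc_scale (lookup x k) (single k 1))"
    by (intro lc_expand) (auto simp: group_alg_def)
  also have "\<dots> \<in> lc.span ((\<lambda>g. single g 1) ` sym_group m)"
    by (intro lc.span_sum lc.span_scale lc.span_base imageI)
  finally show "x \<in> lc.span ((\<lambda>g. single g 1) ` sym_group m)" .
qed

lemma subspace_zero: "lc.subspace {0}"
  by (simp add: lc.subspace_def)

lemma quot_group_alg: "quot (group_alg m) {0}"
proof
  show "\<exists>S. finite S \<and> group_alg m \<subseteq> lc.span S"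
    using group_alg_span[of m] by (intro exI conjI) simp_all
qed (simp_all add: subspace_group_alg subspace_zero lc.subspace_0[OF subspace_group_alg])

lemma lc_lin_end_on: "lc_lin T \<Longrightarrow> (\<And>v. v \<in> V \<Longrightarrow> T v \<in> V) \<Longrightarrow> end_on V T"
  by (simp add: end_on_def lc_lin_def)

lemma lc_lin_span:
  assumes "lc_lin T" "lc.subspace U" "\<And>x. x \<in> S \<Longrightarrow> T x \<in> U" "v \<in> lc.span S"
  shows "T v \<in> U"
proof -
  have "lc.subspace {v. T v \<in> U}"
    unfolding lc.subspace_def
    using assms(1,2) by (simp add: lc_lin_zero lc_lin_add lc_lin_scale lc.subspace_0 lc.subspace_add lc.subspace_scale)
  then have "lc.span S \<subseteq> {v. T v \<in> U}"
    using assms(3) by (intro lc.span_minimal) auto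
  then show ?thesis using assms(4) by blast
qed

text \<open>The trace of the right multiplication by the Young symmetrizer on the group algebra is \<open>m!\<close>;
  if the symmetrizer squared to zero, it would be nilpotent.\<close>

lemma young_const_nonzero:
  assumes lam: "lam \<in> partitions_of m"
  shows "young_const lam \<noteq> 0"
proof
  assume k0: "young_const lam = 0"
  note s = partitions_ofD(1)[OF lam]
  let ?c = "young_symmetrizer lam"
  \<comment> \<open>Right multiplication by the symmetrizer. It commutes with left multiplications,
    so each of its diagonal entries is the coefficient of the symmetrizer at \<open>id\<close>,
    which is 1.\<close>
  define T where "T x = (\<Sum>p\<in>row_stabilizer lam. \<Sum>q\<in>col_stabilizer lam.
      lc_scale (sgn_perm q) (right_mult (p \<circ> q) x))" for x
  have linT: "lc_lin T"
    unfolding T_def[abs_def] by (intro lc_lin_sumI lc_lin_scaleI lc_lin_map)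
  have comm: "T (left_mult g x) = left_mult g (T x)" for g x
    by (simp add: T_def left_right_commute lc_lin_sum[OF lc_lin_map] lc_lin_scale[OF lc_lin_map])
  have Tunit: "T unit_elt = ?c"
    by (simp add: T_def young_symmetrizer_def)
  have comm': "T (young_op lam left_mult x) = young_op lam left_mult (T x)" for x
    by (simp add: young_op_def row_op_def col_op_def comm lc_lin_sum[OF linT] lc_lin_scale[OF linT])
  have Tc: "T ?c = 0"
    using comm'[of unit_elt] young_square[OF lam] k0 by (simp add: young_symmetrizer_eq[symmetric] Tunit)
  have Tg: "T (single g 1) = left_mult g ?c" for g
    using comm[of g unit_elt] by (simp add: Tunit)
  have TT: "T (T x) = 0" for x
    by (rule lc_lin_eqI[OF lc_lin_compose[OF linT linT], of "\<lambda>x. 0"])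
      (simp_all add: Tg comm Tc lc_lin_zero[OF lc_lin_map], simp add: lc_lin_def)
  have cA: "?c \<in> group_alg m"
    unfolding young_symmetrizer_eq by (intro young_group_alg s unit_group_alg)
  have TA: "T x \<in> group_alg m" if "x \<in> group_alg m" for x
  proof -
    have "T x = T (\<Sum>k\<in>sym_group m. lc_scale (lookup x k) (single k 1))"
      using that by (subst lc_expand[of "sym_group m" x]) (auto simp: group_alg_def)
    also have "\<dots> = (\<Sum>k\<in>sym_group m. lc_scale (lookup x k) (left_mult k ?c))"
      by (simp only: lc_lin_sum[OF linT] lc_lin_scale[OF linT] Tg)
    also have "\<dots> \<in> group_alg m"
      by (intro lc.subspace_sum[OF subspace_group_alg] lc.subspace_scale[OF subspace_group_alg]
          left_mult_group_alg cA)
    finally show ?thesis .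
  qed
  interpret quot "group_alg m" "{0}" by (rule quot_group_alg)
  have "quot_trace (group_alg m) {0} T
      = (\<Sum>g\<in>sym_group m. lookup (T (single g 1)) g)"
  proof (rule quot_trace_formula[where \<phi>="\<lambda>g v. lookup (T v) g" and u="\<lambda>g. single g 1"])
    show "lin_on (group_alg m) (\<lambda>v. lookup (T v) g)" for g
      using linT by (simp add: lin_on_def lc_lin_def lookup_add)
    show "lookup (T w) g = 0" if "w \<in> {0}" for g w
      using that lc_lin_zero[OF linT] by simp
    show "single g (1::complex) \<in> group_alg m" if "g \<in> sym_group m" for g
      using that by (simp add: group_alg_def)
    show "T v - (\<Sum>g\<in>sym_group m. lc_scale (lookup (T v) g) (single g 1)) \<in> {0}"
      if "v \<in> group_alg m" for v
      using lc_expand[of "sym_group m" "T v"] TA[OF that] by (auto simp: group_alg_def)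
  qed simp
  also have "\<dots> = (\<Sum>g\<in>sym_group m. 1)"
  proof (rule sum.cong[OF refl])
    fix g assume "g \<in> sym_group m"
    from lookup_left_mult[OF this, of ?c id] show "lookup (T (single g 1)) g = 1"
      unfolding Tg by (simp add: lookup_young_id[OF s])
  qed
  finally have tr: "quot_trace (group_alg m) {0} T = of_nat (card (sym_group m))" by simp
  \<comment> \<open>As \<open>T\<close> squares to zero, the rank lemma applies with factor 0 and
    makes the trace vanish.\<close>
  obtain n where "quot_trace (group_alg m) {0} T = 0 * of_nat n"
  proof (rule quot_trace_rank)
    show "end_on (group_alg m) T" by (rule lc_lin_end_on[OF linT TA])
  qed (auto simp: TT lc_lin_zero[OF linT])
  then have "card (sym_group m) = 0" using tr by simp
  then show False using id_in_sym_group[of m] by (metis card_0_eq empty_iff finite_sym_group)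
qed

section \<open>Characters of subquotient modules and their values at Young symmetrizers\<close>

locale sym_module = sym_rep F + quot V W
  for F :: "(nat \<Rightarrow> nat) \<Rightarrow> ('k \<Rightarrow>\<^sub>0 complex) \<Rightarrow> ('k \<Rightarrow>\<^sub>0 complex)"
    and V W :: "('k \<Rightarrow>\<^sub>0 complex) set" +
  fixes m :: nat
  assumes FV: "g \<in> sym_group m \<Longrightarrow> v \<in> V \<Longrightarrow> F g v \<in> V"
    and FW: "g \<in> sym_group m \<Longrightarrow> v \<in> W \<Longrightarrow> F g v \<in> W"
begin

definition chr :: "(nat \<Rightarrow> nat) \<Rightarrow> complex" where
  "chr g = quot_trace V W (F g)"

lemma F_end_on: "g \<in> sym_group m \<Longrightarrow> end_on V (F g)"
  by (rule lc_lin_end_on[OF lin FV])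

lemma chr_conj:
  assumes g: "g \<in> sym_group m" and h: "h \<in> sym_group m"
  shows "chr (h \<circ> g \<circ> inv_into UNIV h) = chr g"
proof -
  have h': "inv_into UNIV h \<in> sym_group m" using h by (rule inv_in_sym_group)
  have "chr (h \<circ> g \<circ> inv_into UNIV h) = quot_trace V W (\<lambda>v. F h (F g (F (inv_into UNIV h) v)))"
    unfolding chr_def by (rule arg_cong[where f="quot_trace V W"], rule ext, simp only: comp)
  also have "\<dots> = chr g"
    unfolding chr_def
  proof (rule quot_trace_conj)
    have "inv_into UNIV h \<circ> h = id" using sym_group_inverses(2)[OF h] by (simp add: fun_eq_iff)
    then show "F (inv_into UNIV h) (F h v) = v" for v
      by (simp add: comp[symmetric] F_id)
  qed (simp_all add: F_end_on g h h' FW)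
  finally show ?thesis .
qed

text \<open>By linearity of the trace: the left side is the character, extended linearly to the
  group algebra and evaluated at the Young symmetrizer.\<close>

lemma sum_chr_young:
  assumes "sum_list lam = m"
  shows "(\<Sum>p\<in>row_stabilizer lam. \<Sum>q\<in>col_stabilizer lam. sgn_perm q * chr (p \<circ> q))
    = quot_trace V W (young_op lam F)"
proof -
  note st = stabilizers_subset[OF assms]
  have "young_op lam F v = (\<Sum>pq\<in>row_stabilizer lam \<times> col_stabilizer lam.
      lc_scale (sgn_perm (snd pq)) (F (fst pq \<circ> snd pq) v))" for v
    by (simp add: young_op_def row_op_def col_op_def lc_lin_sum[OF lin] lc_lin_scale[OF lin] comp
        sum.cartesian_product case_prod_beta)
  then have "quot_trace V W (young_op lam F) = quot_trace V W (\<lambda>v. \<Sum>pq\<in>row_stabilizer lam \<times> col_stabilizer lam.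
      lc_scale (sgn_perm (snd pq)) (F (fst pq \<circ> snd pq) v))"
    by presburger
  also have "\<dots> = (\<Sum>pq\<in>row_stabilizer lam \<times> col_stabilizer lam. sgn_perm (snd pq) * quot_trace V W (F (fst pq \<circ> snd pq)))"
    by (rule quot_trace_sum) (use st in \<open>auto intro!: FV compose_in_sym_group\<close>)
  finally show ?thesis
    by (simp add: chr_def sum.cartesian_product case_prod_beta)
qed

lemma young_rank:
  assumes lam: "lam \<in> partitions_of m"
  obtains n where "quot_trace V W (young_op lam F) = young_const lam * of_nat n"
    and "\<And>R (l :: 'r \<Rightarrow> _). finite R \<Longrightarrow> (\<And>r. r \<in> R \<Longrightarrow> lin_on V (l r)) \<Longrightarrow>
        (\<And>v. v \<in> V \<Longrightarrow> (\<And>r. r \<in> R \<Longrightarrow> l r v = 0) \<Longrightarrow> young_op lam F v \<in> W) \<Longrightarrow> n \<le> card R"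
proof (rule quot_trace_rank)
  note s = partitions_ofD(1)[OF lam]
  show "end_on V (young_op lam F)"
    by (rule lc_lin_end_on[OF lin_young_op young_op_subspace[OF V FV s]])
  show "young_op lam F w \<in> W" if "w \<in> W" for w
    by (rule young_op_subspace[OF W FW s that])
  show "young_op lam F (young_op lam F v) - lc_scale (young_const lam) (young_op lam F v) \<in> W" for v
    using lc.subspace_0[OF W] by (simp add: young_op_square[OF lam])
qed (erule that, blast)

end

lemma specht_sym_module:
  assumes "sum_list mu = m"
  shows "sym_module left_mult (specht_module mu) {0} m"
proof
  show "lc.subspace (specht_module mu)" unfolding specht_module_def by (rule lc.subspace_span)
  then show "{0} \<subseteq> specht_module mu" using lc.subspace_0 by blast
  show "\<exists>S. finite S \<and> specht_module mu \<subseteq> lc.span S"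
    unfolding specht_module_def
    by (intro exI[of _ "(\<lambda>g. left_mult g (young_symmetrizer mu)) ` sym_group (sum_list mu)"]) simp
  show "left_mult g v \<in> specht_module mu" if g: "g \<in> sym_group m" and v: "v \<in> specht_module mu" for g v
  proof (rule lc_lin_span[OF lc_lin_map _ _ v[unfolded specht_module_def]])
    show "lc.subspace (specht_module mu)" unfolding specht_module_def by (rule lc.subspace_span)
    fix x assume "x \<in> (\<lambda>g. left_mult g (young_symmetrizer mu)) ` sym_group (sum_list mu)"
    then obtain h where h: "h \<in> sym_group m" "x = left_mult h (young_symmetrizer mu)"
      using assms by blast
    show "left_mult g x \<in> specht_module mu"
      unfolding specht_module_def assms h(2) left.comp[symmetric]
      by (rule lc.span_base, rule imageI, rule compose_in_sym_group[OF g h(1)])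
  qed
  show "left_mult g v \<in> {0}" if "v \<in> {0}" for g v
    using that by (simp add: lc_lin_zero[OF lc_lin_map])
qed (rule subspace_zero)

text \<open>On the Specht module of \<open>mu\<close> the symmetrizer of \<open>lam\<close> acts as
  zero if the shapes differ, and otherwise as a rank-one map onto its own multiples with eigenvalue
  \<open>young_const lam\<close>. So evaluations at symmetrizers are, up to factors, dual to the
  irreducible characters.\<close>

lemma irr_character_young:
  assumes lam: "lam \<in> partitions_of m" and mu: "mu \<in> partitions_of m"
  shows "(\<Sum>p\<in>row_stabilizer lam. \<Sum>q\<in>col_stabilizer lam. sgn_perm q * irr_character mu (p \<circ> q))
    = (if lam = mu then young_const lam else 0)"
proof -
  note s = partitions_ofD(1)[OF lam] partitions_ofD(1)[OF mu]
  interpret sp: sym_module left_mult "specht_module mu" "{0}" m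
    by (rule specht_sym_module[OF s(2)])
  have irr: "irr_character mu = sp.chr"
    by (simp add: fun_eq_iff irr_character_def sp.chr_def)
  let ?c = "young_symmetrizer lam"
  let ?T = "young_op lam left_mult"
  have tr: "(\<Sum>p\<in>row_stabilizer lam. \<Sum>q\<in>col_stabilizer lam. sgn_perm q * irr_character mu (p \<circ> q))
      = quot_trace (specht_module mu) {0} ?T"
    unfolding irr by (rule sp.sum_chr_young[OF s(1)])
  show ?thesis
  proof (cases "lam = mu")
    case False
    have T0: "?T v = 0" if "v \<in> specht_module mu" for v
    proof -
      have "?T v \<in> {0}"
        by (rule lc_lin_span[OF left.lin_young_op subspace_zero _ that[unfolded specht_module_def s]])
          (use young_product_vanish[OF lam mu False] in blast)
      then show ?thesis by simp
    qed
    have "quot_trace (specht_module mu) {0} ?T = (\<Sum>c\<in>({}::nat set). (\<lambda>_ _. 0) c 0)"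
      by (rule sp.quot_trace_formula[where \<phi>="\<lambda>_ _. 0"]) (use T0 in auto)
    then show ?thesis using tr False by simp
  next
    case True
    have Tv: "?T v = lc_scale (lookup (?T v) id) ?c" if "v \<in> specht_module mu" for v
    proof -
      \<comment> \<open>The multiples of the symmetrizer, described by a linear equation through the
        coefficient at \<open>id\<close>; being a subspace, it need only be tested on the generators
        of the Specht module.\<close>
      have "lc.subspace {w. w = lc_scale (lookup w id) ?c}" (is "lc.subspace ?U")
        unfolding lc.subspace_def
      proof (intro conjI ballI allI; (unfold mem_Collect_eq)?)
        fix x y :: "(nat \<Rightarrow> nat) \<Rightarrow>\<^sub>0 complex" and a
        assume x: "x = lc_scale (lookup x id) ?c"
        show "lc_scale a x = lc_scale (lookup (lc_scale a x) id) ?c"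
          by (subst x) (simp only: lookup_lc_scale lc.scale_scale)
        assume y: "y = lc_scale (lookup y id) ?c"
        show "x + y = lc_scale (lookup (x + y) id) ?c"
          unfolding lookup_add lc.scale_left_distrib x[symmetric] y[symmetric] ..
      qed simp
      moreover have "?T x \<in> ?U" if "x \<in> (\<lambda>g. left_mult g (young_symmetrizer mu)) ` sym_group m" for x
      proof -
        obtain h where h: "h \<in> sym_group m" "x = left_mult h ?c" using \<open>x \<in> _\<close> True by blast
        have Tx: "?T x = lc_scale (young_scalar lam h) ?c"
          unfolding h(2) by (rule young_product_same[OF lam h(1)])
        show ?thesis unfolding Tx by (simp add: lookup_young_id[OF s(1)])
      qed
      ultimately have "?T v \<in> ?U"
        by (rule lc_lin_span[OF left.lin_young_op _ _ that[unfolded specht_module_def s]])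
      then show ?thesis by simp
    qed
    have cS: "?c \<in> specht_module mu"
      unfolding specht_module_def True
      by (rule lc.span_base, rule image_eqI[of _ _ id]) (simp_all only: left.F_id id_in_sym_group)
    have "quot_trace (specht_module mu) {0} ?T = (\<Sum>u\<in>{?c}. lookup (?T u) id)"
    proof (rule sp.quot_trace_formula[where \<phi>="\<lambda>_ v. lookup (?T v) id" and u="\<lambda>u. u"])
      show "lin_on (specht_module mu) (\<lambda>v. lookup (?T v) id)"
        using left.lin_young_op[of lam] by (simp add: lin_on_def lc_lin_def lookup_add)
    qed (use cS Tv lc_lin_zero[OF left.lin_young_op] in auto)
    also have "\<dots> = young_const lam"
      by (simp add: young_square[OF lam] lookup_young_id[OF s(1)])
    finally show ?thesis using tr True by simp
  qed
qed

section \<open>Class functions\<close>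

lemma funpow_returns:
  fixes p :: "nat \<Rightarrow> nat"
  assumes "p permutes {..<m}"
  shows "\<exists>n>0. (p ^^ n) x = x"
proof (cases "x < m")
  case True
  have "(p ^^ i) x < m" for i
    using True permutes_in_image[OF assms] by (induction i) auto
  then have "range (\<lambda>i. (p ^^ i) x) \<subseteq> {..<m}" by blast
  then have "finite (range (\<lambda>i. (p ^^ i) x))" by (rule finite_subset) simp
  then have "\<not> inj (\<lambda>i. (p ^^ i) x)" using finite_imageD[of "\<lambda>i. (p ^^ i) x" UNIV] infinite_UNIV_nat by blast
  then obtain i j where ij: "(p ^^ i) x = (p ^^ j) x" "i < j"
    using linorder_injI[of "\<lambda>i. (p ^^ i) x"] by blast
  have "(p ^^ i) ((p ^^ (j - i)) x) = (p ^^ i) x"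
    using ij funpow_add[of i "j - i" p] by simp
  moreover have "inj (p ^^ i)" by (rule inj_fn[OF permutes_inj[OF assms]])
  ultimately have "(p ^^ (j - i)) x = x" by (simp add: inj_eq)
  then show ?thesis using ij(2) by (intro exI[of _ "j - i"]) simp
next
  case False
  then show ?thesis using permutes_not_in[OF assms] by (intro exI[of _ 1]) simp
qed

definition perm_orbit :: "(nat \<Rightarrow> nat) \<Rightarrow> nat \<Rightarrow> nat set" where
  "perm_orbit p x = range (\<lambda>i. (p ^^ i) x)"

lemma perm_orbit_cyclic:
  assumes p: "p permutes {..<m}"
  shows "finite (perm_orbit p x)" "0 < card (perm_orbit p x)"
    "(p ^^ i) x = (p ^^ j) x \<longleftrightarrow> i mod card (perm_orbit p x) = j mod card (perm_orbit p x)"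
proof -
  define l where "l = (LEAST n. 0 < n \<and> (p ^^ n) x = x)"
  have l: "0 < l" "(p ^^ l) x = x" and least: "\<And>n. 0 < n \<Longrightarrow> (p ^^ n) x = x \<Longrightarrow> l \<le> n"
    unfolding l_def using LeastI_ex[OF funpow_returns[OF p, of x, unfolded Bex_def]]
    by (auto intro: Least_le)
  have md: "(p ^^ (i mod l)) x = (p ^^ i) x" for i
    by (rule funpow_mod_eq[OF l(2)])
  have inj: "inj_on (\<lambda>i. (p ^^ i) x) {..<l}"
  proof (rule linorder_inj_onI)
    fix i j assume ij: "i < j" "i \<in> {..<l}" "j \<in> {..<l}"
    show "(p ^^ i) x \<noteq> (p ^^ j) x"
    proof
      assume eq: "(p ^^ i) x = (p ^^ j) x"
      have "(p ^^ i) ((p ^^ (j - i)) x) = (p ^^ i) x"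
        using ij eq funpow_add[of i "j - i" p] by simp
      moreover have "inj (p ^^ i)" by (rule inj_fn[OF permutes_inj[OF p]])
      ultimately have "(p ^^ (j - i)) x = x" by (simp add: inj_eq)
      then show False using least[of "j - i"] ij by simp
    qed
  qed auto
  have orb: "perm_orbit p x = (\<lambda>i. (p ^^ i) x) ` {..<l}"
  proof (rule equalityI; rule subsetI)
    fix y assume "y \<in> perm_orbit p x"
    then obtain i where "y = (p ^^ (i mod l)) x" by (auto simp: perm_orbit_def md)
    then show "y \<in> (\<lambda>i. (p ^^ i) x) ` {..<l}" using l(1) by simp
  qed (auto simp: perm_orbit_def)
  have card: "card (perm_orbit p x) = l" unfolding orb by (simp add: card_image[OF inj])
  show "finite (perm_orbit p x)" unfolding orb by simp
  show "0 < card (perm_orbit p x)" using card l by simp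
  show "(p ^^ i) x = (p ^^ j) x \<longleftrightarrow> i mod card (perm_orbit p x) = j mod card (perm_orbit p x)"
    using inj_on_eq_iff[OF inj, of "i mod l" "j mod l"] l(1) by (simp add: card md)
qed

lemma perm_orbit_eq:
  assumes p: "p permutes {..<m}" and y: "y \<in> perm_orbit p x"
  shows "perm_orbit p y = perm_orbit p x"
proof -
  have sub: "perm_orbit p v \<subseteq> perm_orbit p u" if uv: "v \<in> perm_orbit p u" for u v
  proof -
    obtain k where "v = (p ^^ k) u" using uv by (auto simp: perm_orbit_def)
    then have "(p ^^ i) v = (p ^^ (i + k)) u" for i by (simp add: funpow_add)
    then show ?thesis by (auto simp: perm_orbit_def)
  qed
  obtain k where k: "y = (p ^^ k) x" using y by (auto simp: perm_orbit_def)
  obtain n where n: "n > 0" "(p ^^ n) x = x" using funpow_returns[OF p] by blast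
  \<comment> \<open>The exponent completes \<open>k\<close> to a multiple of the return time
    \<open>n\<close>; since \<open>n > 0\<close>, the subtraction is not truncated.\<close>
  have "(p ^^ (k * n - k)) y = (p ^^ (k * n)) x"
    using n(1) by (simp add: k funpow_add[symmetric, unfolded o_def fun_eq_iff, rule_format])
  also have "\<dots> = x" using funpow_mod_eq[OF n(2), of "k * n"] by simp
  finally have "x \<in> perm_orbit p y" unfolding perm_orbit_def by (metis rangeI)
  then show ?thesis using sub[OF y] sub[of x y] by blast
qed

lemma self_in_perm_orbit: "x \<in> perm_orbit p x"
  unfolding perm_orbit_def by (rule range_eqI[of _ _ 0]) simp

text \<open>The multiset keeps orbits of equal size apart, and \<open>rev\<close> turns the
  ascending list into the descending order of partitions.\<close>

definition cycle_type :: "nat \<Rightarrow> (nat \<Rightarrow> nat) \<Rightarrow> nat list" where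
  "cycle_type m p = rev (sorted_list_of_multiset (image_mset card (mset_set (perm_orbit p ` {..<m}))))"

lemma perm_orbit_subset:
  assumes p: "p permutes {..<m}" and "x < m"
  shows "perm_orbit p x \<subseteq> {..<m}"
proof -
  have "(p ^^ i) x < m" for i
    using assms(2) permutes_in_image[OF p] by (induction i) auto
  then show ?thesis by (auto simp: perm_orbit_def)
qed

lemma cycle_type_partition:
  assumes p: "p permutes {..<m}"
  shows "cycle_type m p \<in> partitions_of m"
  unfolding partitions_of_def
proof (intro CollectI conjI)
  let ?M = "image_mset card (mset_set (perm_orbit p ` {..<m}))"
  show "sorted_wrt (\<ge>) (cycle_type m p)"
    unfolding cycle_type_def sorted_wrt_rev by simp
  show "\<forall>k\<in>set (cycle_type m p). 0 < k"
    using perm_orbit_cyclic(2)[OF p] by (auto simp: cycle_type_def)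
  have "sum_list (cycle_type m p) = sum_mset ?M"
    unfolding cycle_type_def by (metis mset_rev mset_sorted_list_of_multiset sum_mset_sum_list)
  also have "\<dots> = (\<Sum>A\<in>perm_orbit p ` {..<m}. card A)"
    by (simp add: sum_unfold_sum_mset)
  also have "\<dots> = card (\<Union>(perm_orbit p ` {..<m}))"
  proof (rule card_Union_disjoint[symmetric])
    show "pairwise disjnt (perm_orbit p ` {..<m})"
      unfolding pairwise_def disjnt_iff by (metis imageE perm_orbit_eq[OF p])
    show "finite A" if "A \<in> perm_orbit p ` {..<m}" for A
      using that perm_orbit_cyclic(1)[OF p] by auto
  qed
  also have "\<Union>(perm_orbit p ` {..<m}) = {..<m}"
    using perm_orbit_subset[OF p] self_in_perm_orbit by fastforce
  finally show "sum_list (cycle_type m p) = m" by simp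
qed

lemma bij_betw_of_image_mset_eq:
  assumes fin: "finite A" "finite B" and eq: "image_mset f (mset_set A) = image_mset g (mset_set B)"
  obtains h where "bij_betw h A B" "\<And>x. x \<in> A \<Longrightarrow> g (h x) = f x"
proof -
  have "card A = card B"
    using arg_cong[OF eq, of size] by simp
  then obtain e where e: "bij_betw e A B" using finite_same_card_bij[OF fin] by blast
  have "image_mset (g \<circ> e) (mset_set A) = image_mset g (mset_set B)"
    using e image_mset_mset_set[of e A] by (simp add: bij_betw_def flip: image_mset.compositionality)
  with eq have "image_mset f (mset_set A) = image_mset (g \<circ> e) (mset_set A)" by simp
  then obtain p where p: "p permutes A" "\<forall>x\<in>A. f x = (g \<circ> e) (p x)"
    by (rule image_mset_eq_implies_permutes[OF fin(1)])
  show thesis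
  proof (rule that[of "e \<circ> p"])
    show "bij_betw (e \<circ> p) A B"
      using permutes_imp_bij[OF p(1)] e by (rule bij_betw_trans)
  qed (use p in auto)
qed

text \<open>Orbits are matched by size and a base point is chosen in each. Sending the
  \<open>i\<close>-th iterate of a base point under \<open>p\<close> to the \<open>i\<close>-th
  iterate of the matching base point under \<open>q\<close> is well defined, because on both sides
  the iterates repeat with the orbit size as period.\<close>

lemma conjugate_if_same_cycle_type:
  assumes p: "p permutes {..<m}" and q: "q permutes {..<m}" and type: "cycle_type m p = cycle_type m q"
  obtains h where "h permutes {..<m}" "q = h \<circ> p \<circ> inv_into UNIV h"
proof -
  let ?O = "perm_orbit p ` {..<m}" and ?O' = "perm_orbit q ` {..<m}"
  have "image_mset card (mset_set ?O) = image_mset card (mset_set ?O')"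
    using type unfolding cycle_type_def by (metis mset_sorted_list_of_multiset rev_rev_ident)
  then obtain f where f: "bij_betw f ?O ?O'" "\<And>A. A \<in> ?O \<Longrightarrow> card (f A) = card A"
    using bij_betw_of_image_mset_eq[of ?O ?O' card card] by (metis finite_imageI finite_lessThan)
  define b where "b A = (SOME x. x \<in> A)" for A :: "nat set"
  have b: "b (perm_orbit r x) \<in> perm_orbit r x" for r x
    unfolding b_def using someI[of "\<lambda>y. y \<in> perm_orbit r x" x] self_in_perm_orbit by blast
  have borb: "perm_orbit p (b A) = A" if "A \<in> ?O" for A
    using that perm_orbit_eq[OF p b] by auto
  have borb': "perm_orbit q (b A) = A" if "A \<in> ?O'" for A
    using that perm_orbit_eq[OF q b] by auto
  define pos where "pos x = (SOME i. x = (p ^^ i) (b (perm_orbit p x)))" for x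
  have pos: "(p ^^ pos x) (b (perm_orbit p x)) = x" if "x < m" for x
  proof -
    have "x \<in> perm_orbit p (b (perm_orbit p x))"
      using borb[of "perm_orbit p x"] self_in_perm_orbit that by auto
    then have "\<exists>i. x = (p ^^ i) (b (perm_orbit p x))" by (auto simp: perm_orbit_def)
    from someI_ex[OF this] show ?thesis unfolding pos_def by simp
  qed
  define h where "h x = (if x < m then (q ^^ pos x) (b (f (perm_orbit p x))) else x)" for x
  have fO: "f (perm_orbit p x) \<in> ?O'" if "x < m" for x
    using f(1) that by (auto simp: bij_betw_def)
  have h_orbit: "perm_orbit q (h x) = f (perm_orbit p x)" if "x < m" for x
  proof -
    have "h x \<in> perm_orbit q (b (f (perm_orbit p x)))"
      using that by (simp add: h_def perm_orbit_def)
    from perm_orbit_eq[OF q this] show ?thesis unfolding borb'[OF fO[OF that]] .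
  qed
  have same: "(p ^^ i) (b A) = (p ^^ j) (b A) \<longleftrightarrow> (q ^^ i) (b (f A)) = (q ^^ j) (b (f A))"
    if "A \<in> ?O" for A i j
  proof -
    have "f A \<in> ?O'" using that f(1) by (auto simp: bij_betw_def)
    then show ?thesis
      using perm_orbit_cyclic(3)[OF p, of i "b A" j] perm_orbit_cyclic(3)[OF q, of i "b (f A)" j]
        borb[OF that] borb' f(2)[OF that] by simp
  qed
  have hm: "h x < m" if "x < m" for x
  proof -
    have "h x \<in> f (perm_orbit p x)" using h_orbit[OF that] self_in_perm_orbit by blast
    then show ?thesis using fO[OF that] perm_orbit_subset[OF q] by blast
  qed
  have inj: "inj_on h {..<m}"
  proof (rule inj_onI)
    fix x y assume xy: "x \<in> {..<m}" "y \<in> {..<m}" "h x = h y"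
    then have "f (perm_orbit p x) = f (perm_orbit p y)" using h_orbit[of x] h_orbit[of y] by simp
    then have same_orbit: "perm_orbit p x = perm_orbit p y"
      using f(1) xy by (auto simp: bij_betw_def inj_on_def)
    then have "(q ^^ pos x) (b (f (perm_orbit p x))) = (q ^^ pos y) (b (f (perm_orbit p x)))"
      using xy by (simp add: h_def)
    then have "(p ^^ pos x) (b (perm_orbit p x)) = (p ^^ pos y) (b (perm_orbit p x))"
      using same[of "perm_orbit p x" "pos x" "pos y"] xy(1) by blast
    moreover have "(p ^^ pos x) (b (perm_orbit p x)) = x" using pos xy(1) by blast
    moreover have "(p ^^ pos y) (b (perm_orbit p x)) = y" unfolding same_orbit using pos xy(2) by blast
    ultimately show "x = y" by metis
  qed
  have "bij_betw h {..<m} {..<m}"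
    using hm inj by (intro bij_betw_imageI endo_inj_surj) auto
  then have hp: "h permutes {..<m}" by (rule bij_imp_permutes) (simp add: h_def)
  have comm: "h (p x) = q (h x)" for x
  proof (cases "x < m")
    case True
    then have px: "p x < m" using permutes_in_image[OF p, of x] by simp
    have same_orbit: "perm_orbit p (p x) = perm_orbit p x"
      by (rule perm_orbit_eq[OF p]) (auto simp: perm_orbit_def intro: range_eqI[of _ _ 1])
    have "(p ^^ pos (p x)) (b (perm_orbit p x)) = (p ^^ Suc (pos x)) (b (perm_orbit p x))"
      using pos[OF px] pos[OF True] same_orbit by simp
    then have "(q ^^ pos (p x)) (b (f (perm_orbit p x))) = (q ^^ Suc (pos x)) (b (f (perm_orbit p x)))"
      using same[of "perm_orbit p x"] True by blast
    then show ?thesis using True px same_orbit by (simp add: h_def)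
  next
    case False
    then show ?thesis
      using permutes_not_in[OF p, of x] permutes_not_in[OF q, of x] by (simp add: h_def)
  qed
  have "q = h \<circ> p \<circ> inv_into UNIV h"
    using permutes_inverses(1)[OF hp] by (simp add: fun_eq_iff comm)
  with hp show thesis by (rule that)
qed

section \<open>Irreducible characters as a basis of the class functions\<close>

lemma finite_partitions_of: "finite (partitions_of m)"
proof (rule finite_subset)
  show "partitions_of m \<subseteq> {xs. set xs \<subseteq> {..m} \<and> length xs \<le> m}"
  proof
    fix lam assume lam: "lam \<in> partitions_of m"
    have "k \<le> m" if "k \<in> set lam" for k
      using member_le_sum_list[OF that] partitions_ofD(1)[OF lam] by simp
    moreover have "length lam \<le> sum_list lam"
      using lam unfolding partitions_of_def by (induction lam arbitrary: m) (fastforce+)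
    ultimately show "lam \<in> {xs. set xs \<subseteq> {..m} \<and> length xs \<le> m}"
      using partitions_ofD(1)[OF lam] by auto
  qed
qed (rule finite_lists_length_le, simp)

text \<open>Evaluation at the symmetrizer of \<open>lam\<close> kills every irreducible character
  except that of shape \<open>lam\<close>, so it extracts a single coefficient.\<close>

lemma young_sum_combination:
  assumes lam: "lam \<in> partitions_of m"
    and \<chi>: "\<And>g. g \<in> sym_group m \<Longrightarrow> \<chi> g = (\<Sum>mu\<in>partitions_of m. a mu * irr_character mu g)"
  shows "(\<Sum>p\<in>row_stabilizer lam. \<Sum>q\<in>col_stabilizer lam. sgn_perm q * \<chi> (p \<circ> q)) = a lam * young_const lam"
proof -
  let ?P = "partitions_of m"
  note s = partitions_ofD(1)[OF lam]
  have "(\<Sum>p\<in>row_stabilizer lam. \<Sum>q\<in>col_stabilizer lam. sgn_perm q * \<chi> (p \<circ> q)) =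
      (\<Sum>p\<in>row_stabilizer lam. \<Sum>q\<in>col_stabilizer lam.
        sgn_perm q * (\<Sum>mu\<in>?P. a mu * irr_character mu (p \<circ> q)))"
    using \<chi> stabilizers_subset[OF s] compose_in_sym_group by (simp add: subset_iff)
  also have "\<dots> = (\<Sum>mu\<in>?P. a mu * (\<Sum>p\<in>row_stabilizer lam. \<Sum>q\<in>col_stabilizer lam.
      sgn_perm q * irr_character mu (p \<circ> q)))"
    by (simp add: sum_distrib_left mult_ac sum.swap[of _ ?P])
  also have "\<dots> = (\<Sum>mu\<in>?P. a mu * (if lam = mu then young_const lam else 0))"
    using irr_character_young[OF lam] by simp
  also have "\<dots> = a lam * young_const lam"
    using lam finite_partitions_of by (simp add: if_distrib sum.delta cong: if_cong)
  finally show ?thesis .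
qed

text \<open>Class functions are determined by their values on representatives of the cycle types, of
  which there are at most as many as partitions. Hence \<open>\<chi>\<close> and the irreducible
  characters together satisfy a linear relation; evaluation at symmetrizers shows that it cannot
  involve the irreducible characters alone, so it can be solved for \<open>\<chi>\<close>.\<close>

lemma class_function_span:
  fixes \<chi> :: "(nat \<Rightarrow> nat) \<Rightarrow> complex"
  assumes cl: "\<And>g h. g \<in> sym_group m \<Longrightarrow> h \<in> sym_group m \<Longrightarrow> \<chi> (h \<circ> g \<circ> inv_into UNIV h) = \<chi> g"
  obtains a where "\<And>g. g \<in> sym_group m \<Longrightarrow> \<chi> g = (\<Sum>mu\<in>partitions_of m. a mu * irr_character mu g)"
proof -
  let ?P = "partitions_of m"
  have irr_cl: "irr_character mu (h \<circ> g \<circ> inv_into UNIV h) = irr_character mu g"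
    if "mu \<in> ?P" "g \<in> sym_group m" "h \<in> sym_group m" for mu g h
  proof -
    interpret sp: sym_module left_mult "specht_module mu" "{0}" m
      by (rule specht_sym_module[OF partitions_ofD(1)[OF that(1)]])
    show ?thesis using sp.chr_conj[OF that(2,3)] by (simp add: irr_character_def sp.chr_def)
  qed
  define T where "T = cycle_type m ` sym_group m"
  define rep where "rep t = (SOME g. g \<in> sym_group m \<and> cycle_type m g = t)" for t
  have rep: "rep t \<in> sym_group m" "cycle_type m (rep t) = t" if "t \<in> T" for t
  proof -
    have "\<exists>g. g \<in> sym_group m \<and> cycle_type m g = t" using that by (auto simp: T_def)
    from someI_ex[OF this] show "rep t \<in> sym_group m" "cycle_type m (rep t) = t"
      by (auto simp: rep_def)
  qed
  have val: "\<phi> g = \<phi> (rep (cycle_type m g))"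
    if g: "g \<in> sym_group m"
      and \<phi>: "\<And>g h. g \<in> sym_group m \<Longrightarrow> h \<in> sym_group m \<Longrightarrow> \<phi> (h \<circ> g \<circ> inv_into UNIV h) = \<phi> g"
    for g and \<phi> :: "(nat \<Rightarrow> nat) \<Rightarrow> complex"
  proof -
    have "cycle_type m g \<in> T" using g by (simp add: T_def)
    note r = rep[OF this]
    obtain h where h: "h permutes {..<m}" "rep (cycle_type m g) = h \<circ> g \<circ> inv_into UNIV h"
      using conjugate_if_same_cycle_type[OF sym_groupD(1)[OF g] sym_groupD(1)[OF r(1)] r(2)[symmetric]]
      by blast
    show ?thesis unfolding h(2) using \<phi>[OF g, of h] h(1) by (simp add: sym_group_def)
  qed
  \<comment> \<open>\<open>None\<close> indexes the class function \<open>\<chi>\<close>, and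
    \<open>Some mu\<close> the irreducible character of shape \<open>mu\<close>.\<close>
  define C where "C = insert None (Some ` ?P)"
  define v where "v c r = (case c of None \<Rightarrow> \<chi> (rep r) | Some mu \<Rightarrow> irr_character mu (rep r))" for c r
  have TP: "T \<subseteq> ?P" using cycle_type_partition by (auto simp: T_def sym_group_def)
  have cardC: "card C = Suc (card ?P)"
    unfolding C_def using finite_partitions_of by (simp add: card_image)
  have "card T \<le> card ?P" by (rule card_mono[OF finite_partitions_of TP])
  then have "\<not> card C \<le> card T" using cardC by simp
  moreover have "finite C" "finite T" using finite_partitions_of by (auto simp: C_def T_def)
  ultimately obtain a where a: "\<And>r. r \<in> T \<Longrightarrow> (\<Sum>c\<in>C. a c * v c r) = 0" "\<exists>c\<in>C. a c \<noteq> 0"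
    using card_le_by_functionals[of C T v] by blast
  have rel: "a None * \<chi> g + (\<Sum>mu\<in>?P. a (Some mu) * irr_character mu g) = 0" if g: "g \<in> sym_group m" for g
  proof -
    let ?t = "cycle_type m g"
    have "?t \<in> T" using g by (simp add: T_def)
    from a(1)[OF this] have "a None * \<chi> (rep ?t) + (\<Sum>mu\<in>?P. a (Some mu) * irr_character mu (rep ?t)) = 0"
      unfolding C_def using finite_partitions_of by (simp add: sum.reindex v_def)
    moreover have "irr_character mu g = irr_character mu (rep ?t)" if "mu \<in> ?P" for mu
      by (rule val[OF g irr_cl[OF that]])
    ultimately show ?thesis
      using val[of g \<chi>, OF g cl] by simp
  qed
  have "a None \<noteq> 0"
  proof
    assume a0: "a None = 0"
    have "a (Some lam) = 0" if lam: "lam \<in> ?P" for lam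
    proof -
      have "(\<lambda>_. 0) g = (\<Sum>mu\<in>?P. a (Some mu) * irr_character mu g)" if "g \<in> sym_group m" for g
        using rel[OF that] a0 by simp
      from young_sum_combination[OF lam this] show ?thesis
        using young_const_nonzero[OF lam] by simp
    qed
    then show False using a(2) a0 by (auto simp: C_def)
  qed
  show thesis
  proof (rule that[of "\<lambda>mu. - a (Some mu) / a None"])
    fix g assume "g \<in> sym_group m"
    from rel[OF this] have "a None * \<chi> g = (\<Sum>mu\<in>?P. - a (Some mu) * irr_character mu g)"
      by (simp add: sum_negf add_eq_0_iff2)
    then have "\<chi> g = (\<Sum>mu\<in>?P. - a (Some mu) * irr_character mu g) / a None"
      using nonzero_mult_div_cancel_left[OF \<open>a None \<noteq> 0\<close>, of "\<chi> g"] by simp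
    then show "\<chi> g = (\<Sum>mu\<in>?P. - a (Some mu) / a None * irr_character mu g)"
      by (simp add: sum_divide_distrib)
  qed
qed

context sym_module
begin

text \<open>Each coefficient of \<open>chr\<close> is the rank of a Young operator, hence a natural
  number; this is the existence that the definite description in \<open>char_mult\<close> requires.
  Evaluation at the symmetrizer gives uniqueness, and the rank is bounded by the number of
  functionals.\<close>

lemma char_mult_bound:
  assumes lam: "lam \<in> partitions_of m" and R: "finite R" "\<And>r. r \<in> R \<Longrightarrow> lin_on V (l r)"
    and l: "\<And>v. v \<in> V \<Longrightarrow> (\<And>r. r \<in> R \<Longrightarrow> l r v = 0) \<Longrightarrow> young_op lam F v \<in> W"
  shows "char_mult m chr lam \<le> card R"
proof -
  let ?P = "partitions_of m"
  obtain a where a: "\<And>g. g \<in> sym_group m \<Longrightarrow> chr g = (\<Sum>mu\<in>?P. a mu * irr_character mu g)"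
    using class_function_span[of m chr, OF chr_conj] by blast
  have "\<exists>n. a mu = of_nat n" if mu: "mu \<in> ?P" for mu
  proof -
    obtain n where "quot_trace V W (young_op mu F) = young_const mu * of_nat n"
      using young_rank[OF mu] by metis
    then have "a mu * young_const mu = young_const mu * of_nat n"
      using young_sum_combination[OF mu a] sum_chr_young[OF partitions_ofD(1)[OF mu]]
      by (simp only: mult.commute)
    then have "a mu = of_nat n" using young_const_nonzero[OF mu] by auto
    then show ?thesis by blast
  qed
  then obtain c where c: "\<And>mu. mu \<in> ?P \<Longrightarrow> a mu = of_nat (c mu)" by metis
  obtain n where n: "quot_trace V W (young_op lam F) = young_const lam * of_nat n" "n \<le> card R"
    using young_rank[OF lam] R l by metis
  have uniq: "c' lam = n" if c': "\<forall>g\<in>sym_group m. chr g = (\<Sum>mu\<in>?P. of_nat (c' mu) * irr_character mu g)" for c'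
  proof -
    have "of_nat (c' lam) * young_const lam = young_const lam * of_nat n"
      using young_sum_combination[OF lam, of chr "\<lambda>mu. of_nat (c' mu)"] c'
        sum_chr_young[OF partitions_ofD(1)[OF lam]] n(1) by (simp only: simp_thms Ball_def)
    then have "(of_nat (c' lam) :: complex) = of_nat n" using young_const_nonzero[OF lam] by simp
    then show ?thesis by simp
  qed
  have "\<forall>g\<in>sym_group m. chr g = (\<Sum>mu\<in>?P. of_nat (c mu) * irr_character mu g)"
    using a c by simp
  then have "char_mult m chr lam = n"
    unfolding char_mult_def using uniq by (intro the_equality) blast+
  then show ?thesis using n(2) by simp
qed

end

section \<open>Irreducible representations of \<open>sl\<^sub>2\<close>\<close>

definition sl2_H :: "complex mat" where
  "sl2_H = mat 2 2 (\<lambda>(i, j). if i = j then if i = 0 then 1 else -1 else 0)"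

definition sl2_E :: "complex mat" where
  "sl2_E = mat 2 2 (\<lambda>(i, j). if i = 0 \<and> j = 1 then 1 else 0)"

definition sl2_F :: "complex mat" where
  "sl2_F = mat 2 2 (\<lambda>(i, j). if i = 1 \<and> j = 0 then 1 else 0)"

text \<open>A basis with the commutation relations of \<open>so\<^sub>3\<close>: the bracket is the cross product.\<close>

definition sl2_basis :: "nat \<Rightarrow> complex mat" where
  "sl2_basis k = (if k = 0 then (- \<i> / 2) \<cdot>\<^sub>m sl2_H
     else if k = 1 then (- \<i> / 2) \<cdot>\<^sub>m (sl2_E + sl2_F)
     else (1 / 2) \<cdot>\<^sub>m (sl2_F + (-1) \<cdot>\<^sub>m sl2_E))"

lemma sl2_HEF [simp]: "sl2_H \<in> sl2" "sl2_E \<in> sl2" "sl2_F \<in> sl2"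
  by (auto simp: sl2_def sl2_H_def sl2_E_def sl2_F_def)

lemma sl2_closed: "A \<in> sl2 \<Longrightarrow> B \<in> sl2 \<Longrightarrow> A + B \<in> sl2" "A \<in> sl2 \<Longrightarrow> c \<cdot>\<^sub>m A \<in> sl2"
  by (auto simp: sl2_def algebra_simps simp flip: distrib_left)

lemma sl2_basis_in [simp]: "sl2_basis k \<in> sl2"
  by (auto simp: sl2_basis_def intro!: sl2_closed)

lemma mat2_eqI:
  assumes "A \<in> carrier_mat 2 2" "B \<in> carrier_mat 2 2"
    and "A $$ (0,0) = B $$ (0,0)" "A $$ (0,1) = B $$ (0,1)" "A $$ (1,0) = B $$ (1,0)" "A $$ (1,1) = B $$ (1,1)"
  shows "A = B"
proof (rule eq_matI)
  fix i j assume "i < dim_row B" "j < dim_col B"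
  then have "i = 0 \<or> i = 1" "j = 0 \<or> j = 1" using assms(2) by auto
  then show "A $$ (i, j) = B $$ (i, j)" using assms(3-6) by auto
qed (use assms in auto)

lemma sl2_carrier: "A \<in> sl2 \<Longrightarrow> A \<in> carrier_mat 2 2"
  by (simp add: sl2_def)

lemma sl2_index:
  assumes "i < 2" "j < 2"
  shows "sl2_H $$ (i, j) = (if i = j then if i = 0 then 1 else -1 else 0)"
    "sl2_E $$ (i, j) = (if i = 0 \<and> j = 1 then 1 else 0)"
    "sl2_F $$ (i, j) = (if i = 1 \<and> j = 0 then 1 else 0)"
  using assms by (auto simp: sl2_H_def sl2_E_def sl2_F_def)

lemma sl2_HEF_carrier [simp]: "sl2_H \<in> carrier_mat 2 2" "sl2_E \<in> carrier_mat 2 2" "sl2_F \<in> carrier_mat 2 2"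
    "sl2_basis k \<in> carrier_mat 2 2"
  by (auto intro: sl2_carrier)

lemma bracket2_index:
  assumes "A \<in> carrier_mat 2 2" "B \<in> carrier_mat 2 2" "i < 2" "j < 2"
  shows "(A * B - B * A) $$ (i, j) = (A $$ (i, 0) * B $$ (0, j) + A $$ (i, 1) * B $$ (1, j))
    - (B $$ (i, 0) * A $$ (0, j) + B $$ (i, 1) * A $$ (1, j :: nat) :: complex)"
  using assms by (simp add: scalar_prod_def) (simp add: numeral_2_eq_2)

lemma bracket2_carrier:
  "A \<in> carrier_mat 2 2 \<Longrightarrow> B \<in> carrier_mat 2 2 \<Longrightarrow> A * B - B * A \<in> carrier_mat 2 2"
  by auto

lemma sl2_brackets:
  "sl2_H * sl2_E - sl2_E * sl2_H = 2 \<cdot>\<^sub>m sl2_E"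
  "sl2_H * sl2_F - sl2_F * sl2_H = (-2) \<cdot>\<^sub>m sl2_F"
  "sl2_E * sl2_F - sl2_F * sl2_E = sl2_H"
proof -
  note c = sl2_HEF_carrier(1-3)
  note d = carrier_matD[OF c(1)] carrier_matD[OF c(2)] carrier_matD[OF c(3)]
  show "sl2_H * sl2_E - sl2_E * sl2_H = 2 \<cdot>\<^sub>m sl2_E"
    by (rule mat2_eqI[OF bracket2_carrier[OF c(1,2)]]; (subst bracket2_index[OF c(1,2)])?) (simp_all add: sl2_index d)
  show "sl2_H * sl2_F - sl2_F * sl2_H = (-2) \<cdot>\<^sub>m sl2_F"
    by (rule mat2_eqI[OF bracket2_carrier[OF c(1,3)]]; (subst bracket2_index[OF c(1,3)])?) (simp_all add: sl2_index d)
  show "sl2_E * sl2_F - sl2_F * sl2_E = sl2_H"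
    by (rule mat2_eqI[OF bracket2_carrier[OF c(2,3)]]; (subst bracket2_index[OF c(2,3)])?) (simp_all add: sl2_index d)
qed

section \<open>Weight vectors and the standard form of an irreducible representation\<close>

lemma smult_mult_mat_vec:
  "A \<in> carrier_mat n k \<Longrightarrow> v \<in> carrier_vec k \<Longrightarrow> (c \<cdot>\<^sub>m A) *\<^sub>v v = (c :: complex) \<cdot>\<^sub>v (A *\<^sub>v v)"
  by (intro eq_vecI) (auto simp: scalar_prod_def sum_distrib_left mult.assoc)

lemma mult_mat_vec_entry:
  "A \<in> carrier_mat d d \<Longrightarrow> v \<in> carrier_vec d \<Longrightarrow> r < d \<Longrightarrow> (A *\<^sub>v v) $ r = (\<Sum>s<d. A $$ (r, s) * v $ s)"
  by (simp add: scalar_prod_def lessThan_atLeast0)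

lemma commutator_shift:
  fixes X Y :: "complex mat"
  assumes X: "X \<in> carrier_mat d d" and Y: "Y \<in> carrier_mat d d" and Z: "Z \<in> carrier_mat d d"
    and comm: "X * Y - Y * X = Z" and v: "v \<in> carrier_vec d"
  shows "X *\<^sub>v (Y *\<^sub>v v) = Y *\<^sub>v (X *\<^sub>v v) + Z *\<^sub>v v"
proof -
  have XY: "X * Y \<in> carrier_mat d d" "Y * X \<in> carrier_mat d d" using X Y by auto
  have "X * Y = Y * X + Z" unfolding comm[symmetric] using X Y by (intro eq_matI) (auto simp del: index_mult_mat(1))
  then have "(X * Y) *\<^sub>v v = (Y * X) *\<^sub>v v + Z *\<^sub>v v"
    using add_mult_distrib_mat_vec[OF XY(2) Z v] by simp
  then show ?thesis using X Y v by simp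
qed

lemma weight_shift:
  fixes X Y :: "complex mat"
  assumes X: "X \<in> carrier_mat d d" and Y: "Y \<in> carrier_mat d d"
    and comm: "X * Y - Y * X = c \<cdot>\<^sub>m Y" and v: "v \<in> carrier_vec d" and Xv: "X *\<^sub>v v = a \<cdot>\<^sub>v v"
  shows "X *\<^sub>v (Y *\<^sub>v v) = (a + c) \<cdot>\<^sub>v (Y *\<^sub>v v)"
proof -
  have "X *\<^sub>v (Y *\<^sub>v v) = Y *\<^sub>v (a \<cdot>\<^sub>v v) + (c \<cdot>\<^sub>m Y) *\<^sub>v v"
    using commutator_shift[OF X Y _ comm v] Y Xv by simp
  then show ?thesis
    using mult_mat_vec[OF Y v] smult_mult_mat_vec[OF Y v] by (simp add: add_smult_distrib_vec)
qed

text \<open>Otherwise the \<open>w k\<close> would be eigenvectors of \<open>X\<close> for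
  infinitely many distinct eigenvalues.\<close>

lemma weights_terminate:
  fixes X :: "complex mat"
  assumes X: "X \<in> carrier_mat d d" and w: "\<And>k. w k \<in> carrier_vec d"
    and Xw: "\<And>k. X *\<^sub>v w k = (a + of_nat k * c) \<cdot>\<^sub>v w k" and c: "c \<noteq> 0"
  shows "\<exists>k. w k = 0\<^sub>v d"
proof (rule ccontr)
  assume "\<not> ?thesis"
  then have "a + of_nat k * c \<in> spectrum X" for k
    unfolding spectrum_def eigenvalue_def eigenvector_def using w Xw X by auto
  then have "range (\<lambda>k :: nat. a + of_nat k * c) \<subseteq> spectrum X" by blast
  then have "finite (range (\<lambda>k :: nat. a + of_nat k * c))"
    using card_finite_spectrum(1)[OF X] by (rule finite_subset)
  moreover have "inj (\<lambda>k :: nat. a + of_nat k * c)"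
    using c by (auto intro!: injI)
  ultimately show False using finite_imageD infinite_UNIV_nat by blast
qed

text \<open>The matrices of \<^const>\<open>sl2_basis\<close> in the basis \<open>F\<^sup>j v / j!\<close>, where \<open>v\<close> is a highest weight
  vector; in this normalisation reversing the basis exchanges \<open>E\<close> and \<open>F\<close>.\<close>

definition std_rep :: "nat \<Rightarrow> nat \<Rightarrow> nat \<Rightarrow> nat \<Rightarrow> complex" where
  "std_rep n k r c =
     (let h = (if r = c then of_nat n - 1 - 2 * of_nat c else 0);
          e = (if Suc r = c then of_nat n - of_nat c else 0);
          f = (if r = Suc c then of_nat r else 0)
      in if k = 0 then - \<i> / 2 * h else if k = 1 then - \<i> / 2 * (e + f) else 1 / 2 * (f - e))"

lemma sl2_decompose:
  assumes A: "A \<in> sl2"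
  obtains a :: "nat \<Rightarrow> complex" where "A = a 0 \<cdot>\<^sub>m sl2_basis 0 + (a 1 \<cdot>\<^sub>m sl2_basis 1 + a 2 \<cdot>\<^sub>m sl2_basis 2)"
proof -
  \<comment> \<open>These coefficients invert the definition of \<open>sl2_basis\<close> entry by
    entry; tracelessness settles the last diagonal entry.\<close>
  define a :: "nat \<Rightarrow> complex" where "a k = (if k = 0 then 2 * \<i> * A $$ (0,0)
     else if k = 1 then \<i> * (A $$ (0,1) + A $$ (1,0)) else A $$ (1,0) - A $$ (0,1))" for k
  have A': "A \<in> carrier_mat 2 2" "A $$ (1, 1) = - A $$ (0, 0)"
    using A by (auto simp: sl2_def eq_neg_iff_add_eq_0 add.commute)
  note c = sl2_HEF_carrier(1-3)
  note d = carrier_matD[OF c(1)] carrier_matD[OF c(2)] carrier_matD[OF c(3)]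
  have "A = a 0 \<cdot>\<^sub>m sl2_basis 0 + (a 1 \<cdot>\<^sub>m sl2_basis 1 + a 2 \<cdot>\<^sub>m sl2_basis 2)"
    using A' by (intro mat2_eqI) (simp_all add: sl2_basis_def a_def d sl2_index field_simps)
  then show thesis by (rule that)
qed

text \<open>The columns of \<open>P\<close> are the vectors F^c v / c! for a highest weight vector
  v, so they transform by \<open>std_rep n\<close>. Irreducibility makes them span, which is
  recorded as a right inverse of \<open>P\<close>; their distinct weights give
  \<open>n \<le> d\<close>. This is what carries the vanishing of values from the standard form back
  to \<open>\<rho>\<close>, with a bound in terms of \<open>d\<close>.\<close>

lemma irreducible_structure:
  assumes irr: "irreducible_sl2_rep d \<rho>"
  obtains n P where "1 \<le> n" "n \<le> d"
    and "\<And>k r c. k < 3 \<Longrightarrow> r < d \<Longrightarrow> c < n \<Longrightarrow>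
      (\<Sum>s<d. \<rho> (sl2_basis k) $$ (r, s) * P s c) = (\<Sum>s<n. P r s * std_rep n k s c)"
    and "\<And>r. r < d \<Longrightarrow> \<exists>y. \<forall>s<d. (\<Sum>c<n. P s c * y c) = (if s = r then 1 else 0)"
proof -
  have rep: "sl2_rep d \<rho>" and d: "0 < d"
    and irred: "\<And>U. invariant_subspace d \<rho> U \<Longrightarrow> U = {0\<^sub>v d} \<or> U = carrier_vec d"
    using irr unfolding irreducible_sl2_rep_def by blast+
  have \<rho>c: "\<rho> A \<in> carrier_mat d d" if "A \<in> sl2" for A
    using rep that unfolding sl2_rep_def by blast
  have \<rho>add: "\<rho> (A + B) = \<rho> A + \<rho> B" if "A \<in> sl2" "B \<in> sl2" for A B
    using rep that unfolding sl2_rep_def by blast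
  have \<rho>smult: "\<rho> (a \<cdot>\<^sub>m A) = a \<cdot>\<^sub>m \<rho> A" if "A \<in> sl2" for a A
    using rep that unfolding sl2_rep_def by blast
  have \<rho>br: "\<rho> A * \<rho> B - \<rho> B * \<rho> A = \<rho> (A * B - B * A)" if "A \<in> sl2" "B \<in> sl2" for A B
    using rep that unfolding sl2_rep_def by metis
  define H E F where "H = \<rho> sl2_H" and "E = \<rho> sl2_E" and "F = \<rho> sl2_F"
  have car: "H \<in> carrier_mat d d" "E \<in> carrier_mat d d" "F \<in> carrier_mat d d"
    by (simp_all add: H_def E_def F_def \<rho>c)
  have HE: "H * E - E * H = 2 \<cdot>\<^sub>m E" and HF: "H * F - F * H = (-2) \<cdot>\<^sub>m F" and EF: "E * F - F * E = H"
    unfolding H_def E_def F_def by (simp_all add: \<rho>br sl2_brackets \<rho>smult)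
  have EV: "E *\<^sub>v x \<in> carrier_vec d" and FV: "F *\<^sub>v x \<in> carrier_vec d" for x
    using car by (auto intro!: carrier_vecI)
  obtain a x0 where x0: "x0 \<in> carrier_vec d" "x0 \<noteq> 0\<^sub>v d" "H *\<^sub>v x0 = a \<cdot>\<^sub>v x0"
    using spectrum_non_empty[OF car(1) d] car(1) unfolding spectrum_def eigenvalue_def eigenvector_def by auto
  \<comment> \<open>Raising an eigenvector of \<open>H\<close> by \<open>E\<close> must stop; the
    last non-zero vector is the highest weight vector \<open>v\<close>.\<close>
  define x where "x k = ((\<lambda>y. E *\<^sub>v y) ^^ k) x0" for k
  have xc: "x k \<in> carrier_vec d" for k by (cases k) (auto simp: x_def x0 EV)
  have xS: "x (Suc k) = E *\<^sub>v x k" for k by (simp add: x_def)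
  have Hx: "H *\<^sub>v x k = (a + of_nat k * 2) \<cdot>\<^sub>v x k" for k
  proof (induction k)
    case (Suc k)
    show ?case
      unfolding xS weight_shift[OF car(1,2) HE xc Suc] by (simp add: algebra_simps)
  qed (simp add: x_def x0)
  have "\<exists>k. x k = 0\<^sub>v d" by (rule weights_terminate[OF car(1) xc Hx]) simp
  then obtain k0 where k0: "x k0 = 0\<^sub>v d" "\<And>j. j < k0 \<Longrightarrow> x j \<noteq> 0\<^sub>v d"
    using exists_least_iff[of "\<lambda>k. x k = 0\<^sub>v d"] by auto
  have "k0 \<noteq> 0" using k0(1) x0 by (auto simp: x_def)
  then obtain k1 where k1: "k0 = Suc k1" by (cases k0) auto
  define v where "v = x k1"
  define \<mu> where "\<mu> = a + of_nat k1 * 2"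
  have v: "v \<in> carrier_vec d" "v \<noteq> 0\<^sub>v d" "E *\<^sub>v v = 0\<^sub>v d" "H *\<^sub>v v = \<mu> \<cdot>\<^sub>v v"
    using k0 k1 xc Hx xS by (auto simp: v_def \<mu>_def)
  \<comment> \<open>The divided powers F^k v / k!, which turn the actions of \<open>E\<close> and
    \<open>F\<close> into the coefficients of \<open>std_rep\<close>.\<close>
  define u where "u = rec_nat v (\<lambda>k y. (1 / of_nat (Suc k)) \<cdot>\<^sub>v (F *\<^sub>v y))"
  have u0: "u 0 = v" and uS: "u (Suc k) = (1 / of_nat (Suc k)) \<cdot>\<^sub>v (F *\<^sub>v u k)" for k
    by (simp_all add: u_def)
  have uc: "u k \<in> carrier_vec d" for k
    by (cases k) (simp_all add: u0 v uS FV)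
  have Fu: "F *\<^sub>v u k = of_nat (Suc k) \<cdot>\<^sub>v u (Suc k)" for k
    unfolding uS by (simp add: smult_smult_assoc del: of_nat_Suc)
  have Hu: "H *\<^sub>v u k = (\<mu> + of_nat k * (-2)) \<cdot>\<^sub>v u k" for k
  proof (induction k)
    case (Suc k)
    show ?case
      unfolding uS mult_mat_vec[OF car(1) FV] weight_shift[OF car(1,3) HF uc Suc]
      by (simp add: smult_smult_assoc algebra_simps)
  qed (simp add: u0 v)
  have Eu: "E *\<^sub>v u (Suc k) = (\<mu> - of_nat k) \<cdot>\<^sub>v u k" for k
  proof (induction k)
    case 0
    have "E *\<^sub>v (F *\<^sub>v v) = F *\<^sub>v 0\<^sub>v d + \<mu> \<cdot>\<^sub>v v"
      using commutator_shift[OF car(2,3,1) EF v(1)] v by simp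
    also have "F *\<^sub>v 0\<^sub>v d = 0\<^sub>v d" using car(3) by (intro eq_vecI) auto
    finally show ?case using v by (simp add: uS u0)
  next
    case (Suc k)
    have nz: "of_nat k + 2 \<noteq> (0 :: complex)"
      by (metis of_nat_add of_nat_numeral of_nat_eq_0_iff add_is_0 zero_neq_numeral)
    have "E *\<^sub>v (F *\<^sub>v u (Suc k)) = F *\<^sub>v ((\<mu> - of_nat k) \<cdot>\<^sub>v u k) + (\<mu> + of_nat (Suc k) * (-2)) \<cdot>\<^sub>v u (Suc k)"
      using commutator_shift[OF car(2,3,1) EF uc[of "Suc k"]] Suc Hu by simp
    also have "\<dots> = ((\<mu> - of_nat k) * of_nat (Suc k)) \<cdot>\<^sub>v u (Suc k) + (\<mu> + of_nat (Suc k) * (-2)) \<cdot>\<^sub>v u (Suc k)"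
      unfolding mult_mat_vec[OF car(3) uc] Fu smult_smult_assoc ..
    also have "\<dots> = ((\<mu> - of_nat k) * of_nat (Suc k) + (\<mu> + of_nat (Suc k) * (-2))) \<cdot>\<^sub>v u (Suc k)"
      by (rule add_smult_distrib_vec[symmetric])
    also have "(\<mu> - of_nat k) * of_nat (Suc k) + (\<mu> + of_nat (Suc k) * (-2)) = of_nat (Suc (Suc k)) * (\<mu> - of_nat (Suc k))"
      by (simp add: algebra_simps)
    finally have *: "E *\<^sub>v (F *\<^sub>v u (Suc k)) = (of_nat (Suc (Suc k)) * (\<mu> - of_nat (Suc k))) \<cdot>\<^sub>v u (Suc k)" .
    show ?case
      unfolding uS[of "Suc k"] mult_mat_vec[OF car(2) FV] * by (simp add: smult_smult_assoc del: of_nat_Suc)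
  qed
  have "\<exists>k. u k = 0\<^sub>v d" by (rule weights_terminate[OF car(1) uc Hu]) simp
  then obtain n where n: "u n = 0\<^sub>v d" "\<And>j. j < n \<Longrightarrow> u j \<noteq> 0\<^sub>v d"
    using exists_least_iff[of "\<lambda>k. u k = 0\<^sub>v d"] by auto
  have "n \<noteq> 0" using n(1) v by (auto simp: u0)
  then obtain n' where n': "n = Suc n'" by (cases n) auto
  \<comment> \<open>Applying \<open>E\<close> to \<open>u n\<close>, which is zero, leaves
    \<open>\<mu> - n'\<close> times the non-zero vector \<open>u n'\<close>.\<close>
  have \<mu>: "\<mu> = of_nat n - 1"
  proof -
    have "E *\<^sub>v u n = 0\<^sub>v d" unfolding n(1) using car(2) by (intro eq_vecI) auto
    then have z: "(\<mu> - of_nat n') \<cdot>\<^sub>v u n' = 0\<^sub>v d" using Eu[of n'] n' by simp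
    obtain i where i: "i < d" "u n' $ i \<noteq> 0"
    proof (rule ccontr)
      assume "\<not> thesis"
      then have "u n' = 0\<^sub>v d" using uc[of n'] that by (intro eq_vecI) auto
      then show False using n(2)[of n'] n' by simp
    qed
    have "((\<mu> - of_nat n') \<cdot>\<^sub>v u n') $ i = 0" unfolding z using i by simp
    then have "\<mu> = of_nat n'" using i uc[of n'] by simp
    then show ?thesis by (simp add: n')
  qed
  have nd: "n \<le> d"
  proof -
    have "(\<lambda>k. \<mu> + of_nat k * (-2)) ` {..<n} \<subseteq> spectrum H"
      unfolding spectrum_def eigenvalue_def eigenvector_def using uc Hu n(2) car(1) by auto
    then have "card ((\<lambda>k. \<mu> + of_nat k * (-2)) ` {..<n}) \<le> card (spectrum H)"
      by (rule card_mono[OF card_finite_spectrum(1)[OF car(1)]])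
    also have "card ((\<lambda>k. \<mu> + of_nat k * (-2)) ` {..<n}) = n"
      by (subst card_image) (auto simp: inj_on_def)
    finally show ?thesis using card_finite_spectrum(2)[OF car(1)] by simp
  qed
  define P where "P r c = u c $ r" for r c
  have PH: "(\<Sum>s<d. H $$ (r, s) * P s c) = (of_nat n - 1 - 2 * of_nat c) * P r c"
    and PE: "(\<Sum>s<d. E $$ (r, s) * P s c) = (if c = 0 then 0 else (of_nat n - of_nat c) * P r (c - 1))"
    and PF: "(\<Sum>s<d. F $$ (r, s) * P s c) = of_nat (Suc c) * P r (Suc c)" if r: "r < d" for r c
  proof -
    note ent = mult_mat_vec_entry[OF _ uc r, symmetric]
    show "(\<Sum>s<d. H $$ (r, s) * P s c) = (of_nat n - 1 - 2 * of_nat c) * P r c"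
      unfolding P_def ent[OF car(1)] Hu using uc[of c] r by (simp add: \<mu> algebra_simps)
    show "(\<Sum>s<d. F $$ (r, s) * P s c) = of_nat (Suc c) * P r (Suc c)"
      unfolding P_def ent[OF car(3)] Fu using uc[of "Suc c"] r by simp
    show "(\<Sum>s<d. E $$ (r, s) * P s c) = (if c = 0 then 0 else (of_nat n - of_nat c) * P r (c - 1))"
    proof (cases c)
      case 0
      then show ?thesis unfolding P_def ent[OF car(2)] using v r by (simp add: u0)
    next
      case (Suc c')
      then show ?thesis unfolding P_def ent[OF car(2)] using uc[of c'] r by (simp add: Eu \<mu>)
    qed
  qed
  have Pn: "P r n = 0" if "r < d" for r using n(1) that by (simp add: P_def)
  have std: "(\<Sum>s<d. \<rho> (sl2_basis k) $$ (r, s) * P s c) = (\<Sum>s<n. P r s * std_rep n k s c)"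
    if k: "k < 3" and r: "r < d" and c: "c < n" for k r c
  proof -
    have sh: "(\<Sum>s<n. P r s * (if s = c then of_nat n - 1 - 2 * of_nat c else 0)) = (of_nat n - 1 - 2 * of_nat c) * P r c"
      using c by (simp add: if_distrib sum.delta cong: if_cong)
    have se: "(\<Sum>s<n. P r s * (if Suc s = c then of_nat n - of_nat c else 0)) =
        (if c = 0 then 0 else (of_nat n - of_nat c) * P r (c - 1))"
    proof (cases c)
      case (Suc c')
      then show ?thesis using c by (simp add: if_distrib sum.delta cong: if_cong)
    qed simp
    have sf: "(\<Sum>s<n. P r s * (if s = Suc c then of_nat s else 0)) = of_nat (Suc c) * P r (Suc c)"
    proof (cases "Suc c = n")
      case True
      then have "(\<Sum>s<n. P r s * (if s = Suc c then of_nat s else 0)) = 0"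
        by (intro sum.neutral) auto
      then show ?thesis using Pn[OF r] True by simp
    next
      case False
      then show ?thesis using c by (simp add: if_distrib sum.delta cong: if_cong)
    qed
    have b: "\<rho> (sl2_basis k) $$ (r, s) = (if k = 0 then - \<i> / 2 * H $$ (r, s)
        else if k = 1 then - \<i> / 2 * (E $$ (r, s) + F $$ (r, s)) else 1 / 2 * (F $$ (r, s) - E $$ (r, s)))"
      if "s < d" for s
      using r that car
      by (simp add: sl2_basis_def \<rho>smult \<rho>add sl2_closed H_def[symmetric] E_def[symmetric] F_def[symmetric])
    consider "k = 0" | "k = 1" | "k = 2" using k by linarith
    then show ?thesis
    proof cases
      case 1
      have "(\<Sum>s<d. \<rho> (sl2_basis k) $$ (r, s) * P s c) = - \<i> / 2 * (\<Sum>s<d. H $$ (r, s) * P s c)"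
        unfolding sum_distrib_left by (intro sum.cong refl) (simp only: b lessThan_iff, simp add: 1)
      also have "\<dots> = (\<Sum>s<n. P r s * std_rep n k s c)"
        unfolding PH[OF r] sh[symmetric] sum_distrib_left using 1
        by (intro sum.cong refl) (simp add: std_rep_def)
      finally show ?thesis .
    next
      case 2
      have "(\<Sum>s<d. \<rho> (sl2_basis k) $$ (r, s) * P s c) =
          - \<i> / 2 * ((\<Sum>s<d. E $$ (r, s) * P s c) + (\<Sum>s<d. F $$ (r, s) * P s c))"
        unfolding sum_distrib_left sum.distrib[symmetric] 
        by (intro sum.cong refl) (simp only: b lessThan_iff, simp add: 2 algebra_simps)
      also have "\<dots> = (\<Sum>s<n. P r s * std_rep n k s c)"
        unfolding PE[OF r] PF[OF r] se[symmetric] sf[symmetric] sum_distrib_left sum.distrib[symmetric] using 2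
        by (intro sum.cong refl) (simp add: std_rep_def Let_def algebra_simps)
      finally show ?thesis .
    next
      case 3
      have "(\<Sum>s<d. \<rho> (sl2_basis k) $$ (r, s) * P s c) =
          1 / 2 * ((\<Sum>s<d. F $$ (r, s) * P s c) - (\<Sum>s<d. E $$ (r, s) * P s c))"
        unfolding sum_distrib_left sum_subtractf[symmetric] 
        by (intro sum.cong refl) (simp only: b lessThan_iff, simp add: 3 algebra_simps)
      also have "\<dots> = (\<Sum>s<n. P r s * std_rep n k s c)"
        unfolding PE[OF r] PF[OF r] se[symmetric] sf[symmetric] sum_distrib_left sum_subtractf[symmetric] using 3
        by (intro sum.cong refl) (simp add: std_rep_def Let_def algebra_simps)
      finally show ?thesis .
    qed
  qed
  \<comment> \<open>The column span of \<open>P\<close>: it is invariant and contains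
    \<open>v\<close>, so it is the whole space.\<close>
  define U where "U = {y \<in> carrier_vec d. \<exists>z. \<forall>r<d. y $ r = (\<Sum>c<n. P r c * z c)}"
  have Uadd: "y + y' \<in> U" if yy: "y \<in> U" "y' \<in> U" for y y'
  proof -
    obtain z z' where "\<forall>r<d. y $ r = (\<Sum>c<n. P r c * z c)" "\<forall>r<d. y' $ r = (\<Sum>c<n. P r c * z' c)"
      using yy unfolding U_def by blast
    then show ?thesis using yy unfolding U_def
      by (intro CollectI conjI exI[of _ "\<lambda>c. z c + z' c"]) (auto simp: sum.distrib algebra_simps)
  qed
  have Usmult: "b \<cdot>\<^sub>v y \<in> U" if yU: "y \<in> U" for b y
  proof -
    obtain z where "\<forall>r<d. y $ r = (\<Sum>c<n. P r c * z c)"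
      using yU unfolding U_def by blast
    then show ?thesis using yU unfolding U_def
      by (intro CollectI conjI exI[of _ "\<lambda>c. b * z c"]) (auto simp: sum_distrib_left mult_ac)
  qed
  have Ub: "\<rho> (sl2_basis k) *\<^sub>v y \<in> U" if k: "k < 3" and y: "y \<in> U" for k y
  proof -
    obtain z where z: "\<forall>r<d. y $ r = (\<Sum>c<n. P r c * z c)" and yc: "y \<in> carrier_vec d"
      using y unfolding U_def by blast
    have "(\<rho> (sl2_basis k) *\<^sub>v y) $ r = (\<Sum>s<n. P r s * (\<Sum>c<n. std_rep n k s c * z c))" if r: "r < d" for r
    proof -
      have "(\<rho> (sl2_basis k) *\<^sub>v y) $ r = (\<Sum>s<d. \<rho> (sl2_basis k) $$ (r, s) * (\<Sum>c<n. P s c * z c))"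
        using mult_mat_vec_entry[OF \<rho>c yc r, of "sl2_basis k"] z by simp
      also have "\<dots> = (\<Sum>c<n. (\<Sum>s<d. \<rho> (sl2_basis k) $$ (r, s) * P s c) * z c)"
        unfolding sum_distrib_left sum_distrib_right by (subst sum.swap) (simp add: mult.assoc)
      also have "\<dots> = (\<Sum>c<n. (\<Sum>s<n. P r s * std_rep n k s c) * z c)"
        using std[OF k r] by simp
      also have "\<dots> = (\<Sum>s<n. P r s * (\<Sum>c<n. std_rep n k s c * z c))"
        unfolding sum_distrib_left sum_distrib_right by (subst sum.swap) (simp add: mult.assoc)
      finally show ?thesis .
    qed
    moreover have "\<rho> (sl2_basis k) *\<^sub>v y \<in> carrier_vec d"
      using \<rho>c[of "sl2_basis k"] by (auto intro!: carrier_vecI)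
    ultimately show ?thesis unfolding U_def by (intro CollectI conjI exI) auto
  qed
  have "invariant_subspace d \<rho> U"
    unfolding invariant_subspace_def
  proof (intro conjI ballI allI)
    show "0\<^sub>v d \<in> U" unfolding U_def by (intro CollectI conjI exI[of _ "\<lambda>_. 0"]) auto
    fix A y assume A: "A \<in> sl2" and y: "y \<in> U"
    have yc: "y \<in> carrier_vec d" using y by (simp add: U_def)
    obtain b :: "nat \<Rightarrow> complex" where b: "A = b 0 \<cdot>\<^sub>m sl2_basis 0 + (b 1 \<cdot>\<^sub>m sl2_basis 1 + b 2 \<cdot>\<^sub>m sl2_basis 2)"
      using sl2_decompose[OF A] by blast
    have "\<rho> A = b 0 \<cdot>\<^sub>m \<rho> (sl2_basis 0) + (b 1 \<cdot>\<^sub>m \<rho> (sl2_basis 1) + b 2 \<cdot>\<^sub>m \<rho> (sl2_basis 2))"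
      unfolding b by (simp only: \<rho>add \<rho>smult sl2_closed sl2_basis_in)
    then have "\<rho> A *\<^sub>v y = b 0 \<cdot>\<^sub>v (\<rho> (sl2_basis 0) *\<^sub>v y) + (b 1 \<cdot>\<^sub>v (\<rho> (sl2_basis 1) *\<^sub>v y) + b 2 \<cdot>\<^sub>v (\<rho> (sl2_basis 2) *\<^sub>v y))"
      using yc \<rho>c[OF sl2_basis_in] by (simp add: add_mult_distrib_mat_vec[of _ d d] smult_mult_mat_vec[of _ d d])
    then show "\<rho> A *\<^sub>v y \<in> U" using Ub y by (simp add: Uadd Usmult)
  next
    show "U \<subseteq> carrier_vec d" unfolding U_def by blast
  qed (rule Uadd Usmult; assumption)+
  then have "U = {0\<^sub>v d} \<or> U = carrier_vec d" by (rule irred)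
  moreover have "u 0 \<in> U"
  proof -
    have "(\<Sum>c<n. P r c * (if c = 0 then 1 else 0)) = u 0 $ r" for r
      using n' by (simp add: P_def if_distrib sum.delta cong: if_cong)
    then show ?thesis unfolding U_def using uc[of 0]
      by (intro CollectI conjI exI[of _ "\<lambda>c. if c = 0 then 1 else 0"]) auto
  qed
  ultimately have U: "U = carrier_vec d" using v u0 by auto
  have "\<exists>y. \<forall>s<d. (\<Sum>c<n. P s c * y c) = (if s = r then 1 else 0)" if r: "r < d" for r
  proof -
    have "unit_vec d r \<in> U" unfolding U by simp
    then obtain z where "\<forall>s<d. unit_vec d r $ s = (\<Sum>c<n. P s c * z c)" unfolding U_def by blast
    then show ?thesis using r by (intro exI[of _ z]) auto
  qed
  with n' nd std show thesis by (intro that[of n P]) auto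
qed

section \<open>Values of multilinear polynomials\<close>

text \<open>Matrices are represented by functions of two indices. These are total, so that updating
  and summing them needs no dimension conditions; only indices below \<open>d\<close> carry
  meaning.\<close>

fun word_val :: "nat \<Rightarrow> (nat \<Rightarrow> nat \<Rightarrow> nat \<Rightarrow> complex) \<Rightarrow> nat list \<Rightarrow> nat \<Rightarrow> nat \<Rightarrow> complex" where
  "word_val d Y [] r c = (if r = c then 1 else 0)"
| "word_val d Y (i # L) r c = (\<Sum>s<d. Y i r s * word_val d Y L s c)"

lemma word_val_cong: "(\<And>i. i \<in> set L \<Longrightarrow> Y i = Y' i) \<Longrightarrow> word_val d Y L r c = word_val d Y' L r c"
  by (induction L arbitrary: r) auto

lemma word_val_map: "word_val d Y (map g L) r c = word_val d (\<lambda>i. Y (g i)) L r c"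
  by (induction L arbitrary: r) auto

lemma word_eval_entry:
  assumes "\<And>i. i \<in> set L \<Longrightarrow> X i \<in> carrier_mat d d" "r < d" "c < d"
  shows "word_eval d X (Word L) $$ (r, c) = word_val d (\<lambda>i r c. X i $$ (r, c)) L r c"
proof -
  have "foldr (\<lambda>i M. X i * M) L (1\<^sub>m d) \<in> carrier_mat d d \<and>
      (\<forall>r<d. foldr (\<lambda>i M. X i * M) L (1\<^sub>m d) $$ (r, c) = word_val d (\<lambda>i r c. X i $$ (r, c)) L r c)"
    using assms(1)
  proof (induction L)
    case Nil
    then show ?case using assms(3) by auto
  next
    case (Cons i L)
    let ?M = "foldr (\<lambda>i M. X i * M) L (1\<^sub>m d)"
    from Cons have M: "?M \<in> carrier_mat d d"
      and X: "X i \<in> carrier_mat d d"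
      and IH: "\<And>r. r < d \<Longrightarrow> ?M $$ (r, c) = word_val d (\<lambda>i r c. X i $$ (r, c)) L r c" by auto
    have "(X i * ?M) $$ (r, c) = (\<Sum>s<d. X i $$ (r, s) * word_val d (\<lambda>i r c. X i $$ (r, c)) L s c)"
      if "r < d" for r
    proof -
      have "(X i * ?M) $$ (r, c) = (\<Sum>s<d. X i $$ (r, s) * ?M $$ (s, c))"
        using M X that assms(3) by (simp add: scalar_prod_def lessThan_atLeast0)
      then show ?thesis using IH by simp
    qed
    then show ?case using M X by auto
  qed
  then show ?thesis using assms(2) by (simp add: word_eval_def)
qed

definition bracket :: "nat \<Rightarrow> (nat \<Rightarrow> nat \<Rightarrow> complex) \<Rightarrow> (nat \<Rightarrow> nat \<Rightarrow> complex) \<Rightarrow> nat \<Rightarrow> nat \<Rightarrow> complex" where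
  "bracket d X Y r c = (\<Sum>s<d. X r s * Y s c) - (\<Sum>s<d. Y r s * X s c)"

text \<open>Commutation with \<open>X\<close> is a derivation of the matrix product. As the letters
  are distinct, the Leibniz sum over positions is a sum over variables, and replacing a variable
  changes exactly one factor.\<close>

lemma word_val_derivation:
  assumes "distinct L" "r < d" "c < d"
  shows "bracket d X (word_val d Y L) r c = (\<Sum>t\<in>set L. word_val d (Y(t := bracket d X (Y t))) L r c)"
  using assms(1,2)
proof (induction L arbitrary: r)
  case Nil
  have "(\<Sum>s<d. X r s * (if s = c then 1 else 0)) = X r c" "(\<Sum>s<d. (if r = s then 1 else 0) * X s c) = X r c"
    using Nil assms(3) by (simp_all add: if_distrib if_distribR sum.delta sum.delta' cong: if_cong)
  then show ?case by (simp add: bracket_def)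
next
  case (Cons i L)
  let ?W = "word_val d Y L"
  have i: "i \<notin> set L" and dL: "distinct L" using Cons.prems by auto
  have "bracket d X (word_val d Y (i # L)) r c
      = (\<Sum>s<d. \<Sum>u<d. X r s * Y i s u * ?W u c) - (\<Sum>s<d. \<Sum>u<d. Y i r u * ?W u s * X s c)"
    by (simp add: bracket_def sum_distrib_left sum_distrib_right mult.assoc)
  also have "(\<Sum>s<d. \<Sum>u<d. X r s * Y i s u * ?W u c) = (\<Sum>u<d. (\<Sum>s<d. X r s * Y i s u) * ?W u c)"
    by (subst sum.swap) (simp add: sum_distrib_right)
  also have "(\<Sum>s<d. \<Sum>u<d. Y i r u * ?W u s * X s c) = (\<Sum>u<d. Y i r u * (\<Sum>s<d. ?W u s * X s c))"
    by (subst sum.swap) (simp add: sum_distrib_left mult.assoc)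
  also have "(\<Sum>u<d. (\<Sum>s<d. X r s * Y i s u) * ?W u c) - (\<Sum>u<d. Y i r u * (\<Sum>s<d. ?W u s * X s c))
      = (\<Sum>u<d. bracket d X (Y i) r u * ?W u c) + (\<Sum>u<d. Y i r u * bracket d X ?W u c)"
  proof -
    have "(\<Sum>u<d. (\<Sum>s<d. Y i r s * X s u) * ?W u c) = (\<Sum>u<d. Y i r u * (\<Sum>s<d. X u s * ?W s c))"
      unfolding sum_distrib_left sum_distrib_right by (subst sum.swap) (simp add: mult.assoc)
    then show ?thesis
      by (simp add: bracket_def left_diff_distrib right_diff_distrib sum_subtractf)
  qed
  also have "(\<Sum>u<d. bracket d X (Y i) r u * ?W u c) = word_val d (Y(i := bracket d X (Y i))) (i # L) r c"
    using i by (auto intro!: sum.cong word_val_cong)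
  also have "(\<Sum>u<d. Y i r u * bracket d X ?W u c)
      = (\<Sum>u<d. Y i r u * (\<Sum>t\<in>set L. word_val d (Y(t := bracket d X (Y t))) L u c))"
    by (intro sum.cong refl arg_cong2[where f="(*)"] Cons.IH[OF dL]) simp
  also have "\<dots> = (\<Sum>t\<in>set L. \<Sum>u<d. Y i r u * word_val d (Y(t := bracket d X (Y t))) L u c)"
    unfolding sum_distrib_left by (rule sum.swap)
  also have "\<dots> = (\<Sum>t\<in>set L. word_val d (Y(t := bracket d X (Y t))) (i # L) r c)"
    using i by (intro sum.cong refl) auto
  finally show ?case by (simp only: list.set sum.insert[OF finite_set i])
qed

lemma word_val_multilinear:
  assumes "distinct L" "t \<in> set L"
  shows "word_val d (Y(t := \<lambda>r c. \<Sum>j\<in>J. a j * Z j r c)) L r c = (\<Sum>j\<in>J. a j * word_val d (Y(t := Z j)) L r c)"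
  using assms
proof (induction L arbitrary: r)
  case (Cons i L)
  show ?case
  proof (cases "t = i")
    case True
    have "word_val d (Y(i := V)) L s c = word_val d Y L s c" for V s
      using Cons.prems(1) by (intro word_val_cong) auto
    then have e: "word_val d (Y(t := V)) (i # L) r c = (\<Sum>s<d. V r s * word_val d Y L s c)" for V
      unfolding True by simp
    show ?thesis
      unfolding e sum_distrib_left sum_distrib_right by (subst sum.swap) (simp add: mult.assoc)
  next
    case False
    then have e: "word_val d (Y(t := V)) (i # L) r c = (\<Sum>s<d. Y i r s * word_val d (Y(t := V)) L s c)" for V
      by simp
    have IH: "word_val d (Y(t := \<lambda>r c. \<Sum>j\<in>J. a j * Z j r c)) L s c = (\<Sum>j\<in>J. a j * word_val d (Y(t := Z j)) L s c)" for s
      by (rule Cons.IH) (use Cons.prems False in auto)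
    show ?thesis
      unfolding e IH sum_distrib_left by (subst sum.swap) (simp add: mult_ac)
  qed
qed simp

lemma word_val_intertwine:
  assumes "\<And>i r c. i \<in> set L \<Longrightarrow> r < d \<Longrightarrow> c < n \<Longrightarrow> (\<Sum>s<d. X i r s * P s c) = (\<Sum>s<n. P r s * x i s c)"
    and "r < d" "c < n"
  shows "(\<Sum>s<d. word_val d X L r s * P s c) = (\<Sum>s<n. P r s * word_val n x L s c)"
  using assms
proof (induction L arbitrary: r)
  case Nil
  then show ?case by (simp add: if_distrib if_distribR sum.delta sum.delta' cong: if_cong)
next
  case (Cons i L)
  have "(\<Sum>s<d. word_val d X (i # L) r s * P s c) = (\<Sum>u<d. X i r u * (\<Sum>s<d. word_val d X L u s * P s c))"
    by (simp add: sum_distrib_left sum_distrib_right mult.assoc) (rule sum.swap)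
  also have "\<dots> = (\<Sum>u<d. X i r u * (\<Sum>s<n. P u s * word_val n x L s c))"
    using Cons by simp
  also have "\<dots> = (\<Sum>s<n. (\<Sum>u<d. X i r u * P u s) * word_val n x L s c)"
    unfolding sum_distrib_left sum_distrib_right by (subst sum.swap) (simp add: mult.assoc)
  also have "\<dots> = (\<Sum>s<n. (\<Sum>u<n. P r u * x i u s) * word_val n x L s c)"
    using Cons.prems by simp
  also have "\<dots> = (\<Sum>s<n. P r s * word_val n x (i # L) s c)"
    by (simp add: sum_distrib_left sum_distrib_right mult.assoc) (rule sum.swap)
  finally show ?case .
qed

section \<open>Linear functionals and values of polynomials\<close>

definition lc_fun :: "('k \<Rightarrow> complex) \<Rightarrow> ('k \<Rightarrow>\<^sub>0 complex) \<Rightarrow> complex" where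
  "lc_fun g f = (\<Sum>k\<in>keys f. lookup f k * g k)"

text \<open>A functional is a linear map to the combinations of the single symbol \<open>()\<close>;
  linearity is thus inherited from \<open>lc_ext\<close>.\<close>

lemma lc_fun_eq_ext: "lc_fun g f = lookup (lc_ext (\<lambda>k. single () (g k)) f) ()"
  by (simp add: lc_fun_def lc_ext_def lookup_sum)

lemma lc_fun_add: "lc_fun g (x + y) = lc_fun g x + lc_fun g y"
  by (simp add: lc_fun_eq_ext lc_lin_add[OF lc_lin_ext] lookup_add)

lemma lc_fun_scale: "lc_fun g (lc_scale a x) = a * lc_fun g x"
  by (simp add: lc_fun_eq_ext lc_lin_scale[OF lc_lin_ext])

lemma lc_fun_sum: "lc_fun g (\<Sum>i\<in>I. f i) = (\<Sum>i\<in>I. lc_fun g (f i))"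
  by (simp add: lc_fun_eq_ext lc_lin_sum[OF lc_lin_ext] lookup_sum)

lemma lc_fun_single [simp]: "lc_fun g (single k a) = a * g k"
  by (simp add: lc_fun_eq_ext)

lemma lc_fun_zero [simp]: "lc_fun g 0 = 0"
  by (simp add: lc_fun_def)

lemma lc_fun_map: "lc_fun g (lc_map \<phi> f) = lc_fun (\<lambda>k. g (\<phi> k)) f"
  by (simp add: lc_map_def lc_fun_sum) (simp add: lc_fun_def)

lemma lc_fun_ext: "lc_fun g (lc_ext D f) = lc_fun (\<lambda>k. lc_fun g (D k)) f"
  by (simp add: lc_ext_def lc_fun_sum lc_fun_scale) (simp add: lc_fun_def)

lemma lc_fun_cong: "(\<And>k. k \<in> keys f \<Longrightarrow> g k = h k) \<Longrightarrow> lc_fun g f = lc_fun h f"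
  by (simp add: lc_fun_def)

lemma lc_fun_sum_left: "lc_fun (\<lambda>k. \<Sum>i\<in>I. a i * g i k) f = (\<Sum>i\<in>I. a i * lc_fun (g i) f)"
  unfolding lc_fun_def sum_distrib_left by (subst sum.swap) (simp add: mult_ac)

lemma lc_fun_diff_left: "lc_fun (\<lambda>k. g k - h k) f = lc_fun g f - lc_fun h f"
  by (simp add: lc_fun_def right_diff_distrib sum_subtractf)

lemma lc_fun_sum_left': "lc_fun (\<lambda>k. \<Sum>i\<in>I. g i k) f = (\<Sum>i\<in>I. lc_fun (g i) f)"
  using lc_fun_sum_left[where a="\<lambda>_. 1"] by simp

definition poly_val :: "nat \<Rightarrow> (nat \<Rightarrow> nat \<Rightarrow> nat \<Rightarrow> complex) \<Rightarrow> free_alg \<Rightarrow> nat \<Rightarrow> nat \<Rightarrow> complex" where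
  "poly_val d Y f r c = lc_fun (\<lambda>w. word_val d Y (letters w) r c) f"

lemma multilinear_part_iff:
  "f \<in> multilinear_part m \<longleftrightarrow> keys f \<subseteq> (\<lambda>p. Word (map p [0..<m])) ` sym_group m"
proof
  let ?S = "(\<lambda>p. Word (map p [0..<m])) ` sym_group m"
  have "lc.subspace {f :: free_alg. keys f \<subseteq> ?S}"
    unfolding lc.subspace_def
  proof (intro conjI ballI allI; (unfold mem_Collect_eq)?)
    fix x y :: free_alg and c :: complex
    assume "keys x \<subseteq> ?S"
    then show "keys (lc_scale c x) \<subseteq> ?S" by (auto simp: in_keys_iff)
    assume "keys y \<subseteq> ?S"
    then show "keys (x + y) \<subseteq> ?S"
      using \<open>keys x \<subseteq> ?S\<close> keys_add[of x y] by blast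
  qed simp
  then have "multilinear_part m \<subseteq> {f. keys f \<subseteq> ?S}"
    unfolding multilinear_part_def by (intro lc.span_minimal) auto
  then show "f \<in> multilinear_part m \<Longrightarrow> keys f \<subseteq> ?S" by blast
  assume "keys f \<subseteq> ?S"
  then have "f = (\<Sum>k\<in>?S. lc_scale (lookup f k) (single k 1))"
    by (intro lc_expand) auto
  also have "\<dots> \<in> multilinear_part m"
    unfolding multilinear_part_def by (intro lc.span_sum lc.span_scale lc.span_base) auto
  finally show "f \<in> multilinear_part m" .
qed

lemma multilinear_letters:
  assumes "f \<in> multilinear_part m" "w \<in> keys f"
  shows "distinct (letters w)" "set (letters w) = {..<m}"
proof -
  obtain p where p: "p permutes {..<m}" "w = Word (map p [0..<m])"
    using assms unfolding multilinear_part_iff sym_group_def by blast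
  have "inj_on p {0..<m}" using permutes_inj[OF p(1)] by (rule inj_on_subset) simp
  then show "distinct (letters w)" by (simp add: p distinct_map)
  show "set (letters w) = {..<m}"
    using permutes_image[OF p(1)] by (simp add: p lessThan_atLeast0)
qed

lemma poly_val_cong:
  assumes "f \<in> multilinear_part m" "\<And>i. i < m \<Longrightarrow> Y i = Y' i"
  shows "poly_val d Y f r c = poly_val d Y' f r c"
  unfolding poly_val_def using assms multilinear_letters[OF assms(1)]
  by (intro lc_fun_cong word_val_cong) auto

interpretation rename: sym_rep rename_vars
proof
  show "rename_vars (g \<circ> h) v = rename_vars g (rename_vars h v)" for g h v
    by (simp add: rename_vars_def lc_map_compose) (simp add: o_def)
  show "rename_vars id v = v" for v
    using lc_map_id[of v] by (simp add: rename_vars_def)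
qed (simp add: rename_vars_def lc_lin_map)

lemma poly_val_rename: "poly_val d Y (rename_vars g f) r c = poly_val d (\<lambda>i. Y (g i)) f r c"
  by (simp add: poly_val_def rename_vars_def lc_fun_map word_val_map)

lemma subspace_multilinear: "lc.subspace (multilinear_part m)"
  unfolding multilinear_part_def by (rule lc.subspace_span)

lemma rename_multilinear:
  assumes "g \<in> sym_group m" "f \<in> multilinear_part m"
  shows "rename_vars g f \<in> multilinear_part m"
proof -
  have "keys (rename_vars g f) \<subseteq> (\<lambda>w. Word (map g (letters w))) ` keys f"
    unfolding rename_vars_def by (rule keys_lc_map)
  also have "\<dots> \<subseteq> (\<lambda>w. Word (map g (letters w))) ` (\<lambda>p. Word (map p [0..<m])) ` sym_group m"
    using assms(2) unfolding multilinear_part_iff by (rule image_mono)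
  also have "\<dots> \<subseteq> (\<lambda>p. Word (map p [0..<m])) ` sym_group m"
  proof (unfold image_image, rule image_subsetI)
    fix p assume p: "p \<in> sym_group m"
    show "Word (map g (letters (Word (map p [0..<m])))) \<in> (\<lambda>p. Word (map p [0..<m])) ` sym_group m"
      by (rule image_eqI[OF _ compose_in_sym_group[OF assms(1) p]]) simp
  qed
  finally show ?thesis unfolding multilinear_part_iff .
qed

section \<open>Derivations on tensors\<close>

text \<open>A function \<open>w\<close> stands for the pure tensor \<open>e\<^bsub>w 0\<^esub> \<otimes> \<dots> \<otimes> e\<^bsub>w (m-1)\<^esub>\<close> in the \<open>m\<close>-th tensor power of
  \<open>\<complex>\<^sup>3\<close>, and \<open>tensor_der m y\<close> is the action of the matrix \<open>y\<close> of \<open>gl\<^sub>3\<close>.\<close>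

definition tensor_der :: "nat \<Rightarrow> (nat \<Rightarrow> nat \<Rightarrow> complex) \<Rightarrow> ((nat \<Rightarrow> nat) \<Rightarrow>\<^sub>0 complex) \<Rightarrow> ((nat \<Rightarrow> nat) \<Rightarrow>\<^sub>0 complex)" where
  "tensor_der m y = lc_ext (\<lambda>w. \<Sum>t<m. \<Sum>i<3. single (w(t := i)) (y i (w t)))"

lemma lc_lin_tensor_der: "lc_lin (tensor_der m y)"
  unfolding tensor_der_def by (rule lc_lin_ext)

lemma tensor_der_single [simp]:
  "tensor_der m y (single w 1) = (\<Sum>t<m. \<Sum>i<3. single (w(t := i)) (y i (w t)))"
  by (simp add: tensor_der_def)

lemma single_sum: "single k (\<Sum>i\<in>I. f i) = (\<Sum>i\<in>I. single k (f i :: complex))"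
  by (rule poly_mapping_eqI) (simp add: lookup_sum lookup_single when_def)

lemma single_eq_scale: "single k a = lc_scale a (single k 1)"
  by simp

lemma tensor_der_linear:
  "tensor_der m (\<lambda>i j. a * y i j + z i j) \<tau> = lc_scale a (tensor_der m y \<tau>) + tensor_der m z \<tau>"
proof (rule lc_lin_eqI[OF lc_lin_tensor_der])
  show "lc_lin (\<lambda>\<tau>. lc_scale a (tensor_der m y \<tau>) + tensor_der m z \<tau>)"
    using lc_lin_tensor_der[of m y] lc_lin_tensor_der[of m z]
    by (simp add: lc_lin_def lc.scale_right_distrib algebra_simps)
qed (simp add: lc.scale_sum_right single_add sum.distrib)

lemma tensor_der_single': 
  "tensor_der m y (single w a) = (\<Sum>t<m. \<Sum>i<3. single (w(t := i)) (a * y i (w t)))"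
proof -
  have "tensor_der m y (lc_scale a (single w 1)) = (\<Sum>t<m. \<Sum>i<3. single (w(t := i)) (a * y i (w t)))"
    unfolding lc_lin_scale[OF lc_lin_tensor_der] tensor_der_single by (simp only: lc.scale_sum_right lc_scale_single)
  then show ?thesis by (simp only: lc_scale_single mult_1_right)
qed

text \<open>In the composition of two derivations the terms acting in two different places are
  symmetric in \<open>y\<close> and \<open>z\<close>. The terms acting twice in one place give the
  matrix products, whose difference is the bracket.\<close>

lemma tensor_der_bracket:
  "tensor_der m y (tensor_der m z \<tau>) =
     tensor_der m z (tensor_der m y \<tau>) + tensor_der m (\<lambda>i j. bracket 3 y z i j) \<tau>"
proof (rule lc_lin_eqI[OF lc_lin_compose[OF lc_lin_tensor_der lc_lin_tensor_der]])
  show "lc_lin (\<lambda>\<tau>. tensor_der m z (tensor_der m y \<tau>) + tensor_der m (\<lambda>i j. bracket 3 y z i j) \<tau>)"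
    using lc_lin_compose[OF lc_lin_tensor_der[of m z] lc_lin_tensor_der[of m y]] lc_lin_tensor_der[of m "\<lambda>i j. bracket 3 y z i j"]
    by (simp add: lc_lin_def lc.scale_right_distrib algebra_simps)
  fix w :: "nat \<Rightarrow> nat"
  let ?s = "\<lambda>w a. single (w :: nat \<Rightarrow> nat) (a :: complex)"
  define diag where "diag y z = (\<Sum>t<m. \<Sum>k<3. ?s (w(t := k)) (\<Sum>i<3. y k i * z i (w t)))"
    for y z :: "nat \<Rightarrow> nat \<Rightarrow> complex"
  define off where "off y z = (\<Sum>t<m. \<Sum>s\<in>{..<m} - {t}. \<Sum>i<3. \<Sum>k<3. ?s (w(t := i, s := k)) (z i (w t) * y k (w s)))"
    for y z :: "nat \<Rightarrow> nat \<Rightarrow> complex"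
  have split: "tensor_der m y (tensor_der m z (?s w 1)) = diag y z + off y z" for y z
  proof -
    have "tensor_der m y (tensor_der m z (?s w 1)) =
        (\<Sum>t<m. \<Sum>i<3. \<Sum>s<m. \<Sum>k<3. ?s (w(t := i, s := k)) (z i (w t) * y k ((w(t := i)) s)))"
      by (simp only: tensor_der_single lc_lin_sum[OF lc_lin_tensor_der] tensor_der_single' mult_1)
    also have "\<dots> = (\<Sum>t<m. \<Sum>i<3. (\<Sum>k<3. ?s (w(t := k)) (z i (w t) * y k i)) +
        (\<Sum>s\<in>{..<m} - {t}. \<Sum>k<3. ?s (w(t := i, s := k)) (z i (w t) * y k (w s))))"
      by (intro sum.cong refl) (subst sum.remove, auto)
    also have "\<dots> = (\<Sum>t<m. \<Sum>i<3. \<Sum>k<3. ?s (w(t := k)) (y k i * z i (w t))) + off y z"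
    proof -
      have "(\<Sum>t<m. \<Sum>i<3. \<Sum>s\<in>{..<m} - {t}. \<Sum>k<3. ?s (w(t := i, s := k)) (z i (w t) * y k (w s))) = off y z"
        unfolding off_def by (rule sum.cong[OF refl], rule sum.swap)
      then show ?thesis unfolding sum.distrib by (simp only: mult.commute)
    qed
    also have "(\<Sum>t<m. \<Sum>i<3. \<Sum>k<3. ?s (w(t := k)) (y k i * z i (w t))) = diag y z"
      unfolding diag_def single_sum by (rule sum.cong[OF refl], rule sum.swap)
    finally show ?thesis .
  qed
  have off: "off y z = off z y"
  proof -
    have "off y z = (\<Sum>t<m. \<Sum>s<m. if s \<noteq> t then \<Sum>i<3. \<Sum>k<3. ?s (w(t := i, s := k)) (z i (w t) * y k (w s)) else 0)"
      unfolding off_def by (rule sum.cong[OF refl], rule sum.mono_neutral_cong_left) auto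
    also have "\<dots> = (\<Sum>s<m. \<Sum>t<m. if s \<noteq> t then \<Sum>i<3. \<Sum>k<3. ?s (w(t := i, s := k)) (z i (w t) * y k (w s)) else 0)"
      by (rule sum.swap)
    also have "\<dots> = (\<Sum>s<m. \<Sum>t<m. if t \<noteq> s then \<Sum>k<3. \<Sum>i<3. ?s (w(s := k, t := i)) (y k (w s) * z i (w t)) else 0)"
    proof (intro sum.cong refl)
      fix s t
      show "(if s \<noteq> t then \<Sum>i<3. \<Sum>k<3. ?s (w(t := i, s := k)) (z i (w t) * y k (w s)) else 0) =
          (if t \<noteq> s then \<Sum>k<3. \<Sum>i<3. ?s (w(s := k, t := i)) (y k (w s) * z i (w t)) else 0)"
        by (subst sum.swap) (auto simp: fun_upd_twist mult.commute)
    qed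
    also have "\<dots> = off z y"
      unfolding off_def by (rule sum.cong[OF refl], rule sum.mono_neutral_cong_right) auto
    finally show ?thesis .
  qed
  have "diag y z = diag z y + tensor_der m (\<lambda>i j. bracket 3 y z i j) (?s w 1)"
    unfolding diag_def tensor_der_single bracket_def
    by (simp add: sum.distrib[symmetric] single_add[symmetric])
  then show "tensor_der m y (tensor_der m z (?s w 1)) =
      tensor_der m z (tensor_der m y (?s w 1)) + tensor_der m (\<lambda>i j. bracket 3 y z i j) (?s w 1)"
    unfolding split off by (simp add: algebra_simps)
qed

text \<open>Precomposition is a right action. It is chosen because the value of
  \<open>rename_vars q f\<close> at the basis vectors listed by \<open>w\<close> is the value of
  \<open>f\<close> at those listed by \<open>w \<circ> q\<close>.\<close>

definition permute_tensor :: "(nat \<Rightarrow> nat) \<Rightarrow> ((nat \<Rightarrow> nat) \<Rightarrow>\<^sub>0 complex) \<Rightarrow> ((nat \<Rightarrow> nat) \<Rightarrow>\<^sub>0 complex)" where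
  "permute_tensor q = lc_map (\<lambda>w. w \<circ> q)"

lemma lc_lin_permute_tensor: "lc_lin (permute_tensor q)"
  unfolding permute_tensor_def by (rule lc_lin_map)

lemma permute_tensor_single [simp]: "permute_tensor q (single w a) = single (w \<circ> q) a"
  by (simp add: permute_tensor_def)

lemma tensor_der_permute:
  assumes q: "q \<in> sym_group m"
  shows "tensor_der m y (permute_tensor q \<tau>) = permute_tensor q (tensor_der m y \<tau>)"
proof (rule lc_lin_eqI[OF lc_lin_compose[OF lc_lin_tensor_der lc_lin_permute_tensor]
      lc_lin_compose[OF lc_lin_permute_tensor lc_lin_tensor_der]])
  fix w :: "nat \<Rightarrow> nat"
  have upd: "(w(q t := i)) \<circ> q = (w \<circ> q)(t := i)" for t i
    using sym_group_inverses(2)[OF q] by (auto simp: fun_eq_iff) metis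
  have "permute_tensor q (tensor_der m y (single w 1))
      = (\<Sum>t<m. \<Sum>i<3. single ((w(t := i)) \<circ> q) (y i (w t)))"
    by (simp add: lc_lin_sum[OF lc_lin_permute_tensor] del: fun_upd_apply)
  also have "\<dots> = (\<Sum>t<m. \<Sum>i<3. single ((w(q t := i)) \<circ> q) (y i (w (q t))))"
    using sum.permute[OF sym_groupD(1)[OF q], of "\<lambda>t. \<Sum>i<3. single ((w(t := i)) \<circ> q) (y i (w t))"]
    by (simp add: o_def[of _ q] del: fun_upd_apply)
  also have "\<dots> = tensor_der m y (permute_tensor q (single w 1))"
    by (simp add: upd del: fun_upd_apply)
  finally show "tensor_der m y (permute_tensor q (single w 1))
      = permute_tensor q (tensor_der m y (single w 1))" ..
qed

definition tensor_col :: "nat list \<Rightarrow> ((nat \<Rightarrow> nat) \<Rightarrow>\<^sub>0 complex) \<Rightarrow> ((nat \<Rightarrow> nat) \<Rightarrow>\<^sub>0 complex)" where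
  "tensor_col lam \<tau> = (\<Sum>q\<in>col_stabilizer lam. lc_scale (sgn_perm q) (permute_tensor q \<tau>))"

definition tensor_row :: "nat list \<Rightarrow> ((nat \<Rightarrow> nat) \<Rightarrow>\<^sub>0 complex) \<Rightarrow> ((nat \<Rightarrow> nat) \<Rightarrow>\<^sub>0 complex)" where
  "tensor_row lam \<tau> = (\<Sum>p\<in>row_stabilizer lam. permute_tensor p \<tau>)"

lemma lc_lin_tensor_col: "lc_lin (tensor_col lam)" and lc_lin_tensor_row: "lc_lin (tensor_row lam)"
  unfolding tensor_col_def[abs_def] tensor_row_def[abs_def]
  by (intro lc_lin_sumI lc_lin_scaleI lc_lin_permute_tensor)+

lemma tensor_der_col: "sum_list lam = m \<Longrightarrow> tensor_der m y (tensor_col lam \<tau>) = tensor_col lam (tensor_der m y \<tau>)"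
  using stabilizers_subset(2)[of lam m]
  by (simp add: tensor_col_def lc_lin_sum[OF lc_lin_tensor_der] lc_lin_scale[OF lc_lin_tensor_der] tensor_der_permute subset_iff)

lemma tensor_der_row: "sum_list lam = m \<Longrightarrow> tensor_der m y (tensor_row lam \<tau>) = tensor_row lam (tensor_der m y \<tau>)"
  using stabilizers_subset(1)[of lam m]
  by (simp add: tensor_row_def lc_lin_sum[OF lc_lin_tensor_der] tensor_der_permute subset_iff)

lemma tensor_row_permute:
  assumes "sum_list lam = m" "p \<in> row_stabilizer lam"
  shows "tensor_row lam (single (w \<circ> p) 1) = tensor_row lam (single w 1)"
  using perm_subgroup_sum_left[OF perm_subgroup_row[OF assms(1)] assms(2), of "\<lambda>q. single (w \<circ> q) (1::complex)"]
  by (simp add: tensor_row_def o_assoc)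

text \<open>Swapping two equal entries of a column fixes the tensor but negates its
  antisymmetrization.\<close>

lemma tensor_col_vanish:
  assumes lam: "sum_list lam = m" and t: "s < m" "t < m" "s \<noteq> t" "tab_col lam s = tab_col lam t" and w: "w s = w t"
  shows "tensor_col lam (single w a) = 0"
proof -
  let ?p = "transpose s t"
  have p: "?p \<in> col_stabilizer lam" by (rule transpose_col_stabilizer[OF lam t(1,2,4)])
  have wp: "w \<circ> ?p = w" using w by (auto simp: fun_eq_iff transpose_def)
  have C: "col_stabilizer lam \<subseteq> sym_group m" by (rule stabilizers_subset(2)[OF lam])
  have "tensor_col lam (single w a)
      = (\<Sum>q\<in>col_stabilizer lam. single (w \<circ> (?p \<circ> q)) (sgn_perm (?p \<circ> q) * a))"
    using perm_subgroup_sum_left[OF perm_subgroup_col[OF lam] p, of "\<lambda>q. single (w \<circ> q) (sgn_perm q * a)"]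
    by (simp add: tensor_col_def)
  also have "\<dots> = (\<Sum>q\<in>col_stabilizer lam. single (w \<circ> q) (- (sgn_perm q * a)))"
  proof (intro sum.cong refl)
    fix q assume "q \<in> col_stabilizer lam"
    then have "sgn_perm (?p \<circ> q) = - sgn_perm q"
      using p C sgn_perm_transpose[OF t(3)] by (subst sgn_perm_compose[of _ m]) auto
    then show "single (w \<circ> (?p \<circ> q)) (sgn_perm (?p \<circ> q) * a) = single (w \<circ> q) (- (sgn_perm q * a))"
      by (simp add: o_assoc wp)
  qed
  also have "\<dots> = - tensor_col lam (single w a)"
    by (simp add: tensor_col_def single_uminus sum_negf)
  finally have "tensor_col lam (single w a) + tensor_col lam (single w a) = 0"
    by (simp add: eq_neg_iff_add_eq_0)
  then have "lc_scale 2 (tensor_col lam (single w a)) = 0"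
    using lc.scale_left_distrib[of 1 1 "tensor_col lam (single w a)"] by simp
  then show ?thesis by simp
qed

text \<open>The structure constants of \<^const>\<open>sl2_basis\<close>: \<open>[e\<^sub>k, e\<^sub>j] = (\<Sum>i<3. so3 k i j e\<^sub>i)\<close>. Since
  \<^const>\<open>sl2_basis\<close> is constant from \<open>2\<close> on, so is \<open>so3 k i\<close>.\<close>

definition so3 :: "nat \<Rightarrow> nat \<Rightarrow> nat \<Rightarrow> complex" where
  "so3 k i j = (if (k, min j 2, i) \<in> {(0,1,2), (1,2,0), (2,0,1)} then 1
     else if (k, min j 2, i) \<in> {(1,0,2), (2,1,0), (0,2,1)} then -1 else 0)"

definition superstandard :: "nat list \<Rightarrow> nat \<Rightarrow> nat" where
  "superstandard lam t = (if t < sum_list lam then tab_row lam t else 0)"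

text \<open>Its span is the so3-module generated by the highest weight vector; the inductive form
  lets vanishing and stability be propagated along single steps.\<close>

inductive_set so3_orbit :: "nat list \<Rightarrow> ((nat \<Rightarrow> nat) \<Rightarrow>\<^sub>0 complex) set" for lam where
  base: "tensor_col lam (single (superstandard lam) 1) \<in> so3_orbit lam"
| step: "x \<in> so3_orbit lam \<Longrightarrow> k < 3 \<Longrightarrow> tensor_der (sum_list lam) (so3 k) x \<in> so3_orbit lam"

lemma tab_col_above:
  assumes lam: "lam \<in> partitions_of m" and t: "t < m" and i: "i < tab_row lam t"
  obtains s where "s < m" "s \<noteq> t" "tab_col lam s = tab_col lam t" "tab_row lam s = i"
proof -
  note s = partitions_ofD(1)[OF lam]
  have "tab_row lam t < length lam" "tab_col lam t < lam ! tab_row lam t"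
    using tableau_coordinates[of t lam] t s by auto
  moreover from this have "lam ! tab_row lam t \<le> lam ! i"
    using i partitions_ofD(2)[OF lam] by simp
  ultimately have "i < length lam" "tab_col lam t < lam ! i" using i by auto
  from tableau_entry_coordinates[OF this] show thesis
    using i s by (intro that[of "tableau_entry lam i (tab_col lam t)"]) auto
qed

text \<open>\<open>gl\<^sub>3\<close> is the sum of \<open>so\<^sub>3\<close> and the upper triangular matrices, and the latter act on the
  highest weight vector by scalars. Hence the \<open>so\<^sub>3\<close>-module generated by it is stable under \<open>gl\<^sub>3\<close>.\<close>

lemma tensor_der_highest:
  assumes lam: "lam \<in> partitions_of m" and "length lam \<le> 3"
  shows "tensor_der m y (tensor_col lam (single (superstandard lam) 1)) \<in> lc.span (so3_orbit lam)"
proof -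
  note s = partitions_ofD(1)[OF lam]
  let ?w = "superstandard lam"
  let ?v = "tensor_col lam (single ?w 1)"
  have w: "?w t = tab_row lam t" "?w t < 3" if "t < m" for t
    using that s tableau_coordinates(1)[of t lam] assms(2) by (auto simp: superstandard_def)
  \<comment> \<open>The bracketed part is the antisymmetric matrix with the lower triangle of
    \<open>y\<close>, so \<open>u\<close> is upper triangular. The minus sign appears because
    \<open>so3 1 2 0 = -1\<close>.\<close>
  define u where "u i j = y i j - (y 2 1 * so3 0 i j - y 2 0 * so3 1 i j + y 1 0 * so3 2 i j)" for i j
  have u0: "u i j = 0" if ij: "j < i" "i < 3" for i j
  proof -
    consider "i = 1" "j = 0" | "i = 2" "j = 0" | "i = 2" "j = 1" using ij by linarith
    then show ?thesis by cases (simp_all add: u_def so3_def)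
  qed
  have "y = (\<lambda>i j. y 2 1 * so3 0 i j + (- y 2 0 * so3 1 i j + (y 1 0 * so3 2 i j + u i j)))"
    by (simp add: fun_eq_iff u_def)
  then have "tensor_der m y ?v = tensor_der m (\<lambda>i j. y 2 1 * so3 0 i j + (- y 2 0 * so3 1 i j + (y 1 0 * so3 2 i j + u i j))) ?v"
    by metis
  also have "\<dots> = lc_scale (y 2 1) (tensor_der m (so3 0) ?v) + (lc_scale (- y 2 0) (tensor_der m (so3 1) ?v) +
      (lc_scale (y 1 0) (tensor_der m (so3 2) ?v) + tensor_der m u ?v))"
    unfolding tensor_der_linear ..
  also have "\<dots> \<in> lc.span (so3_orbit lam)"
  proof (intro lc.span_add lc.span_scale)
    show "tensor_der m (so3 0) ?v \<in> lc.span (so3_orbit lam)" "tensor_der m (so3 1) ?v \<in> lc.span (so3_orbit lam)"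
      "tensor_der m (so3 2) ?v \<in> lc.span (so3_orbit lam)"
      using so3_orbit.step[OF so3_orbit.base, of _ lam] s by (auto intro!: lc.span_base)
    have "tensor_der m u ?v = (\<Sum>t<m. \<Sum>i<3. tensor_col lam (single (?w(t := i)) (u i (?w t))))"
      by (simp add: tensor_der_col[OF s] lc_lin_sum[OF lc_lin_tensor_col])
    also have "\<dots> \<in> lc.span (so3_orbit lam)"
    proof (intro lc.span_sum)
      fix t i assume t: "t \<in> {..<m}" and i: "i \<in> {..<3::nat}"
      have tm: "t < m" using t by simp
      consider "?w t < i" | "i = ?w t" | "i < ?w t" by linarith
      then show "tensor_col lam (single (?w(t := i)) (u i (?w t))) \<in> lc.span (so3_orbit lam)"
      proof cases
        case 1
        then have "u i (?w t) = 0" using u0 i by simp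
        then show ?thesis by (simp add: lc_lin_zero[OF lc_lin_tensor_col] lc.span_zero)
      next
        case 2
        then have "?w(t := i) = ?w" by auto
        then have "tensor_col lam (single (?w(t := i)) (u i (?w t))) = lc_scale (u i (?w t)) ?v"
          by (subst single_eq_scale) (simp only: lc_lin_scale[OF lc_lin_tensor_col])
        then show ?thesis by (simp add: lc.span_scale lc.span_base so3_orbit.base)
      next
        case 3
        \<comment> \<open>The smaller entry \<open>i\<close> already occurs higher up in the same
          column, so the antisymmetrization is zero: this is where the highest weight property comes
          from.\<close>
        then have "i < tab_row lam t" using w(1)[OF tm] by simp
        then obtain s' where s': "s' < m" "s' \<noteq> t" "tab_col lam s' = tab_col lam t" "tab_row lam s' = i"
          using tab_col_above[OF lam tm] by blast
        have "tensor_col lam (single (?w(t := i)) (u i (?w t))) = 0"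
          by (rule tensor_col_vanish[OF s s'(1) tm s'(2,3)]) (use s' w(1)[OF s'(1)] in simp)
        then show ?thesis by (simp add: lc.span_zero)
      qed
    qed
    finally show "tensor_der m u ?v \<in> lc.span (so3_orbit lam)" .
  qed
  finally show ?thesis .
qed

text \<open>An arbitrary \<open>y\<close> is commuted past the last so3 step. The commutator is the
  action of another matrix on the shorter element, so the induction hypothesis, which is about all
  matrices at once, covers both terms.\<close>

lemma tensor_der_so3_orbit:
  assumes lam: "lam \<in> partitions_of m" and len: "length lam \<le> 3" and x: "x \<in> lc.span (so3_orbit lam)"
  shows "tensor_der m y x \<in> lc.span (so3_orbit lam)"
proof -
  note s = partitions_ofD(1)[OF lam]
  have "tensor_der m y x \<in> lc.span (so3_orbit lam)" if "x \<in> so3_orbit lam" for x y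
    using that
  proof (induction arbitrary: y)
    case base
    then show ?case by (rule tensor_der_highest[OF lam len])
  next
    case (step x k)
    have "tensor_der m (so3 k) z \<in> lc.span (so3_orbit lam)" if "z \<in> lc.span (so3_orbit lam)" for z
      using so3_orbit.step[OF _ step.hyps(2)] s
      by (intro lc_lin_span[OF lc_lin_tensor_der lc.subspace_span _ that]) (auto intro: lc.span_base)
    then show ?case
      unfolding s tensor_der_bracket[of m y] using step.IH by (intro lc.span_add) blast+
  qed
  then show ?thesis
    by (intro lc_lin_span[OF lc_lin_tensor_der lc.subspace_span _ x])
qed

text \<open>Up to \<open>gl\<^sub>3\<close>, every row symmetric tensor is obtained from the one with all entries of row \<open>r\<close>
  equal to \<open>r\<close>; induction on the number of the other entries.\<close>

lemma tensor_row_so3_orbit: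
  assumes lam: "lam \<in> partitions_of m" and len: "length lam \<le> 3"
    and w: "\<And>t. t < m \<Longrightarrow> w t < 3" "\<And>t. \<not> t < m \<Longrightarrow> w t = 0"
  shows "tensor_col lam (tensor_row lam (single w 1)) \<in> lc.span (so3_orbit lam)"
  using w
proof (induction "card {t. t < m \<and> w t \<noteq> tab_row lam t}" arbitrary: w rule: less_induct)
  case less
  note s = partitions_ofD(1)[OF lam]
  let ?Q = "{\<tau>. tensor_col lam \<tau> \<in> lc.span (so3_orbit lam)}"
  let ?A = "\<lambda>w. tensor_row lam (single w 1)"
  have Q: "lc.subspace ?Q"
    unfolding lc.subspace_def
    by (auto simp: lc_lin_zero[OF lc_lin_tensor_col] lc_lin_add[OF lc_lin_tensor_col] lc_lin_scale[OF lc_lin_tensor_col]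
        lc.span_zero lc.span_add lc.span_scale)
  have DQ: "tensor_der m y \<tau> \<in> ?Q" if "\<tau> \<in> ?Q" for y \<tau>
    using that tensor_der_so3_orbit[OF lam len] by (simp add: tensor_der_col[OF s, symmetric])
  show ?case
  proof (cases "\<exists>t<m. w t \<noteq> tab_row lam t")
    case False
    then have w: "w = superstandard lam" using less.prems s by (auto simp: superstandard_def fun_eq_iff)
    have "w \<circ> p = w" if "p \<in> row_stabilizer lam" for p
      using that sym_group_less[of p m] unfolding w row_stabilizer_eq[OF s]
      by (auto simp: superstandard_def fun_eq_iff s)
    then have "?A w = lc_scale (of_nat (card (row_stabilizer lam))) (single w 1)"
      by (simp add: tensor_row_def) (simp add: single_sum[symmetric])
    then show ?thesis
      unfolding w by (simp only: lc_lin_scale[OF lc_lin_tensor_col]) (intro lc.span_scale lc.span_base so3_orbit.base)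
  next
    case True
    then obtain t0 where t0: "t0 < m" "w t0 \<noteq> tab_row lam t0" by blast
    define r where "r = tab_row lam t0"
    define j where "j = w t0"
    \<comment> \<open>The place \<open>t0\<close> is wrong in \<open>w\<close> and repaired in
      \<open>w'\<close>, so the induction hypothesis applies to \<open>w'\<close>.\<close>
    define w' where "w' = w(t0 := r)"
    have r3: "r < 3" using tableau_coordinates(1)[of t0 lam] t0 s len by (simp add: r_def)
    have j3: "j < 3" using less.prems(1) t0 by (simp add: j_def)
    have w'3: "w' t < 3" if "t < m" for t using less.prems(1)[OF that] r3 by (simp add: w'_def)
    have w'0: "w' t = 0" if "\<not> t < m" for t using less.prems(2)[OF that] that t0 by (auto simp: w'_def)
    have sub: "{t. t < m \<and> w' t \<noteq> tab_row lam t} \<subset> {t. t < m \<and> w t \<noteq> tab_row lam t}"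
      using t0 by (auto simp: w'_def r_def)
    have card_less: "card S < card {t. t < m \<and> w t \<noteq> tab_row lam t}"
      if "S \<subseteq> {t. t < m \<and> w' t \<noteq> tab_row lam t}" for S
      using that sub by (intro psubset_card_mono) auto
    have "?A w' \<in> ?Q"
      using less.hyps[OF card_less[OF subset_refl] w'3 w'0] by simp
    \<comment> \<open>The elementary matrix taking basis vector \<open>r\<close> to
      \<open>j\<close>. Acting on \<open>w'\<close>, it recreates \<open>w\<close>, up to a row
      permutation, at every place of row \<open>r\<close> that holds \<open>r\<close>; at other
      places it alters an entry that was wrong already, which leaves a tensor covered by the
      induction hypothesis.\<close>
    define y where "y a b = (if a = j \<and> b = r then 1 else 0 :: complex)" for a b
    have "tensor_der m y (single w' 1) = (\<Sum>t<m. if w' t = r then single (w'(t := j)) 1 else 0)"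
      unfolding tensor_der_single
    proof (intro sum.cong refl)
      fix t
      have "(\<Sum>i<3. single (w'(t := i)) (y i (w' t))) =
          (\<Sum>i<3. if i = j then if w' t = r then single (w'(t := i)) 1 else 0 else 0)"
        by (intro sum.cong refl) (auto simp: y_def)
      then show "(\<Sum>i<3. single (w'(t := i)) (y i (w' t))) =
          (if w' t = r then single (w'(t := j)) 1 else 0)"
        using j3 by simp
    qed
    also have "\<dots> = (\<Sum>t\<in>{t. t < m \<and> w' t = r}. single (w'(t := j)) 1)"
      by (intro sum.mono_neutral_cong_right) auto
    finally have "tensor_der m y (?A w') = (\<Sum>t\<in>{t. t < m \<and> w' t = r}. ?A (w'(t := j)))"
      by (simp add: tensor_der_row[OF s] lc_lin_sum[OF lc_lin_tensor_row])
    also have "{t. t < m \<and> w' t = r} = {t. t < m \<and> w' t = r \<and> tab_row lam t = r} \<union> {t. t < m \<and> w' t = r \<and> tab_row lam t \<noteq> r}"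
      by auto
    also have "(\<Sum>t\<in>{t. t < m \<and> w' t = r \<and> tab_row lam t = r} \<union> {t. t < m \<and> w' t = r \<and> tab_row lam t \<noteq> r}. ?A (w'(t := j)))
        = (\<Sum>t\<in>{t. t < m \<and> w' t = r \<and> tab_row lam t = r}. ?A (w'(t := j)))
          + (\<Sum>t\<in>{t. t < m \<and> w' t = r \<and> tab_row lam t \<noteq> r}. ?A (w'(t := j)))"
      by (rule sum.union_disjoint) auto
    also have "(\<Sum>t\<in>{t. t < m \<and> w' t = r \<and> tab_row lam t = r}. ?A (w'(t := j)))
        = (\<Sum>t\<in>{t. t < m \<and> w' t = r \<and> tab_row lam t = r}. ?A w)"
    proof (intro sum.cong refl)
      fix t assume "t \<in> {t. t < m \<and> w' t = r \<and> tab_row lam t = r}"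
      then have t: "t < m" "w' t = r" "tab_row lam t = r" by auto
      have "w'(t := j) = w \<circ> transpose t t0"
        using t(2) by (auto simp: fun_eq_iff w'_def j_def transpose_def split: if_splits)
      then show "?A (w'(t := j)) = ?A w"
        using tensor_row_permute[OF s transpose_row_stabilizer[OF s t(1) t0(1)]] t(3) by (simp add: r_def)
    qed
    finally have eq: "tensor_der m y (?A w') = lc_scale (of_nat (card {t. t < m \<and> w' t = r \<and> tab_row lam t = r})) (?A w)
        + (\<Sum>t\<in>{t. t < m \<and> w' t = r \<and> tab_row lam t \<noteq> r}. ?A (w'(t := j)))" (is "_ = lc_scale ?k _ + ?rest")
      by (simp only: lc.sum_constant_scale)
    have "?rest \<in> ?Q"
    proof (rule lc.subspace_sum[OF Q])
      fix t assume "t \<in> {t. t < m \<and> w' t = r \<and> tab_row lam t \<noteq> r}"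
      then have t: "t < m" "w' t = r" "tab_row lam t \<noteq> r" by auto
      have "tensor_col lam (?A (w'(t := j))) \<in> lc.span (so3_orbit lam)"
        by (rule less.hyps[OF card_less]) (use t w'3 w'0 j3 in auto)
      then show "?A (w'(t := j)) \<in> ?Q" by simp
    qed
    moreover have "tensor_der m y (?A w') \<in> ?Q" by (rule DQ) fact
    ultimately have "lc_scale ?k (?A w) \<in> ?Q"
      using lc.subspace_diff[OF Q, of "tensor_der m y (?A w')" ?rest] unfolding eq by simp
    then have "lc_scale (inverse ?k) (lc_scale ?k (?A w)) \<in> ?Q" by (rule lc.subspace_scale[OF Q])
    \<comment> \<open>The place \<open>t0\<close> itself is counted, so \<open>w\<close> can be
      isolated by division.\<close>
    moreover have "?k \<noteq> 0"
    proof -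
      have "t0 \<in> {t. t < m \<and> w' t = r \<and> tab_row lam t = r}" using t0 by (simp add: w'_def r_def)
      then show ?thesis by (auto simp: card_eq_0_iff)
    qed
    ultimately show ?thesis by simp
  qed
qed

section \<open>Evaluation as an equivariant map on tensors\<close>

lemma sl2_basis_brackets:
  assumes "k < 3"
  shows "sl2_basis k * sl2_basis j - sl2_basis j * sl2_basis k =
    so3 k 0 j \<cdot>\<^sub>m sl2_basis 0 + (so3 k 1 j \<cdot>\<^sub>m sl2_basis 1 + so3 k 2 j \<cdot>\<^sub>m sl2_basis 2)"
proof -
  have j: "sl2_basis j = sl2_basis (min j 2)" "so3 k i j = so3 k i (min j 2)" for i
    by (auto simp: sl2_basis_def so3_def)
  define j' where "j' = min j 2"
  have "j' < 3" by (simp add: j'_def)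
  have ent: "sl2_basis i $$ (a, b) = (if i = 0 then - \<i> / 2 * (if a = b then if a = 0 then 1 else -1 else 0)
      else if i = 1 then - \<i> / 2 * ((if a = 0 \<and> b = 1 then 1 else 0) + (if a = 1 \<and> b = 0 then 1 else 0))
      else 1 / 2 * ((if a = 1 \<and> b = 0 then 1 else 0) - (if a = 0 \<and> b = 1 then 1 else 0)))"
    if "a < 2" "b < 2" for i a b
    using that carrier_matD[OF sl2_HEF_carrier(1)] carrier_matD[OF sl2_HEF_carrier(2)] carrier_matD[OF sl2_HEF_carrier(3)]
    by (simp add: sl2_basis_def sl2_index)
  have k: "k = 0 \<or> k = 1 \<or> k = 2" and j': "j' = 0 \<or> j' = 1 \<or> j' = 2"
    using assms \<open>j' < 3\<close> by linarith+
  note c = sl2_HEF_carrier(4)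
  have "sl2_basis k * sl2_basis j' - sl2_basis j' * sl2_basis k =
    so3 k 0 j' \<cdot>\<^sub>m sl2_basis 0 + (so3 k 1 j' \<cdot>\<^sub>m sl2_basis 1 + so3 k 2 j' \<cdot>\<^sub>m sl2_basis 2)"
    using k
  proof (elim disjE)
    assume k: "k = 0"
    show ?thesis unfolding k using j'
      by (intro mat2_eqI[OF bracket2_carrier[OF c c]])
        (auto simp: bracket2_index[OF c c] ent so3_def carrier_matD[OF c] simp del: index_minus_mat)
  next
    assume k: "k = 1"
    show ?thesis unfolding k using j'
      by (intro mat2_eqI[OF bracket2_carrier[OF c c]])
        (auto simp: bracket2_index[OF c c] ent so3_def carrier_matD[OF c] simp del: index_minus_mat)
  next
    assume k: "k = 2"
    show ?thesis unfolding k using j'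
      by (intro mat2_eqI[OF bracket2_carrier[OF c c]])
        (auto simp: bracket2_index[OF c c] ent so3_def carrier_matD[OF c] simp del: index_minus_mat)
  qed
  then show ?thesis unfolding j'_def j[symmetric] .
qed

lemma bracket_lc_fun:
  "bracket d X (\<lambda>r c. lc_fun (g r c) f) r c = lc_fun (\<lambda>k. bracket d X (\<lambda>r c. g r c k) r c) f"
  unfolding bracket_def lc_fun_diff_left lc_fun_sum_left
  by (simp add: mult.commute[of _ "X _ c"] lc_fun_sum_left)

lemma poly_val_derivation:
  assumes "f \<in> multilinear_part m" "r < d" "c < d"
  shows "bracket d X (poly_val d Y f) r c = (\<Sum>t<m. poly_val d (Y(t := bracket d X (Y t))) f r c)"
proof -
  have "bracket d X (poly_val d Y f) r c = lc_fun (\<lambda>w. bracket d X (word_val d Y (letters w)) r c) f"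
    unfolding poly_val_def[abs_def] by (rule bracket_lc_fun)
  also have "\<dots> = lc_fun (\<lambda>w. \<Sum>t<m. word_val d (Y(t := bracket d X (Y t))) (letters w) r c) f"
    using multilinear_letters[OF assms(1)] assms(2,3)
    by (intro lc_fun_cong) (subst word_val_derivation, simp_all)
  also have "\<dots> = (\<Sum>t<m. poly_val d (Y(t := bracket d X (Y t))) f r c)"
    unfolding poly_val_def by (rule lc_fun_sum_left')
  finally show ?thesis .
qed

lemma poly_val_multilinear:
  assumes "f \<in> multilinear_part m" "t < m"
  shows "poly_val d (Y(t := \<lambda>r c. \<Sum>j\<in>J. a j * Z j r c)) f r c = (\<Sum>j\<in>J. a j * poly_val d (Y(t := Z j)) f r c)"
proof -
  have "poly_val d (Y(t := \<lambda>r c. \<Sum>j\<in>J. a j * Z j r c)) f r c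
      = lc_fun (\<lambda>w. \<Sum>j\<in>J. a j * word_val d (Y(t := Z j)) (letters w) r c) f"
    unfolding poly_val_def using multilinear_letters[OF assms(1)] assms(2)
    by (intro lc_fun_cong word_val_multilinear) auto
  then show ?thesis unfolding poly_val_def lc_fun_sum_left .
qed

lemma poly_val_add: "poly_val d Y (f + g) r c = poly_val d Y f r c + poly_val d Y g r c"
  and poly_val_scale: "poly_val d Y (lc_scale a f) r c = a * poly_val d Y f r c"
  and poly_val_sum: "poly_val d Y (\<Sum>i\<in>I. h i) r c = (\<Sum>i\<in>I. poly_val d Y (h i) r c)"
  by (simp_all add: poly_val_def lc_fun_add lc_fun_scale lc_fun_sum)

locale sl2_irrep =
  fixes d :: nat and \<rho> :: "complex mat \<Rightarrow> complex mat"
  assumes irr: "irreducible_sl2_rep d \<rho>"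
begin

lemma rep: "sl2_rep d \<rho>"
  using irr unfolding irreducible_sl2_rep_def by blast

lemma rep_carrier: "A \<in> sl2 \<Longrightarrow> \<rho> A \<in> carrier_mat d d"
  using rep unfolding sl2_rep_def by blast

lemma rep_add: "A \<in> sl2 \<Longrightarrow> B \<in> sl2 \<Longrightarrow> \<rho> (A + B) = \<rho> A + \<rho> B"
  using rep unfolding sl2_rep_def by blast

lemma rep_smult: "A \<in> sl2 \<Longrightarrow> \<rho> (a \<cdot>\<^sub>m A) = a \<cdot>\<^sub>m \<rho> A"
  using rep unfolding sl2_rep_def by blast

lemma rep_bracket: "A \<in> sl2 \<Longrightarrow> B \<in> sl2 \<Longrightarrow> \<rho> (A * B - B * A) = \<rho> A * \<rho> B - \<rho> B * \<rho> A"
  using rep unfolding sl2_rep_def by blast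

text \<open>Entries outside the \<open>d\<close> by \<open>d\<close> square are set to 0, so that
  relations such as \<open>bracket_gen\<close> are equalities of functions and can be rewritten
  inside an evaluation.\<close>

definition entry :: "complex mat \<Rightarrow> nat \<Rightarrow> nat \<Rightarrow> complex" where
  "entry A r c = (if r < d \<and> c < d then \<rho> A $$ (r, c) else 0)"

definition gen :: "nat \<Rightarrow> nat \<Rightarrow> nat \<Rightarrow> complex" where
  "gen k = entry (sl2_basis k)"

lemma entry_combination:
  assumes "A = a 0 \<cdot>\<^sub>m sl2_basis 0 + (a 1 \<cdot>\<^sub>m sl2_basis 1 + a 2 \<cdot>\<^sub>m sl2_basis 2)"
  shows "entry A = (\<lambda>r c. \<Sum>i<3. a i * gen i r c)"
proof -
  have "\<rho> A = a 0 \<cdot>\<^sub>m \<rho> (sl2_basis 0) + (a 1 \<cdot>\<^sub>m \<rho> (sl2_basis 1) + a 2 \<cdot>\<^sub>m \<rho> (sl2_basis 2))"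
    unfolding assms by (simp only: rep_add rep_smult sl2_closed sl2_basis_in)
  moreover have "\<rho> (sl2_basis i) \<in> carrier_mat d d" for i by (rule rep_carrier) simp
  ultimately show ?thesis
    using carrier_matD[OF \<open>\<And>i. \<rho> (sl2_basis i) \<in> carrier_mat d d\<close>]
    by (simp add: fun_eq_iff entry_def gen_def eval_nat_numeral algebra_simps)
qed

lemma bracket_gen:
  assumes "k < 3"
  shows "bracket d (gen k) (gen j) = (\<lambda>r c. \<Sum>i<3. so3 k i j * gen i r c)"
proof -
  let ?A = "sl2_basis k * sl2_basis j - sl2_basis j * sl2_basis k"
  have "bracket d (gen k) (gen j) r c = entry ?A r c" for r c
  proof (cases "r < d \<and> c < d")
    case True
    then show ?thesis
      using carrier_matD[OF rep_carrier[OF sl2_basis_in]]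
      by (simp add: entry_def rep_bracket bracket_def gen_def scalar_prod_def lessThan_atLeast0)
  next
    case False
    then show ?thesis by (auto simp: bracket_def gen_def entry_def)
  qed
  then show ?thesis
    unfolding fun_eq_iff using entry_combination[OF sl2_basis_brackets[OF assms, of j]] by simp
qed

text \<open>The polynomial \<open>f\<close> as a linear map from tensors to \<open>d \<times> d\<close> matrices.\<close>

definition tensor_val :: "free_alg \<Rightarrow> ((nat \<Rightarrow> nat) \<Rightarrow>\<^sub>0 complex) \<Rightarrow> nat \<Rightarrow> nat \<Rightarrow> complex" where
  "tensor_val f \<tau> r c = lc_fun (\<lambda>w. poly_val d (\<lambda>i. gen (w i)) f r c) \<tau>"

text \<open>Bracketing with \<open>gen k\<close> is a derivation of polynomial values, and on the
  arguments \<open>gen j\<close> it acts by the structure constants \<open>so3 k\<close>. Place by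
  place this is the action on the tensor.\<close>

lemma tensor_val_equivariant:
  assumes f: "f \<in> multilinear_part m" and k: "k < 3" and rc: "r < d" "c < d"
  shows "tensor_val f (tensor_der m (so3 k) \<tau>) r c = bracket d (gen k) (tensor_val f \<tau>) r c"
proof -
  have "bracket d (gen k) (poly_val d (\<lambda>i. gen (w i)) f) r c
      = (\<Sum>t<m. \<Sum>i<3. so3 k i (w t) * poly_val d (\<lambda>j. gen ((w(t := i)) j)) f r c)" for w
  proof -
    have upd: "(\<lambda>i. gen (w i))(t := gen i) = (\<lambda>j. gen ((w(t := i)) j))" for t i by auto
    show ?thesis
      unfolding poly_val_derivation[OF f rc] bracket_gen[OF k]
      by (intro sum.cong refl) (simp only: lessThan_iff poly_val_multilinear[OF f] upd)
  qed
  note bracket_val = this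
  have "tensor_val f (tensor_der m (so3 k) \<tau>) r c
      = lc_fun (\<lambda>w. bracket d (gen k) (poly_val d (\<lambda>i. gen (w i)) f) r c) \<tau>"
    unfolding tensor_val_def tensor_der_def lc_fun_ext bracket_val
    by (simp only: lc_fun_sum lc_fun_single)
  also have "\<dots> = bracket d (gen k) (tensor_val f \<tau>) r c"
    unfolding tensor_val_def[abs_def] bracket_lc_fun ..
  finally show ?thesis .
qed

lemma tensor_val_col:
  assumes "sum_list lam = m"
  shows "tensor_val f (tensor_col lam (single w 1)) r c
    = poly_val d (\<lambda>i. gen (w i)) (col_op lam rename_vars f) r c"
  by (simp add: tensor_val_def tensor_col_def lc_fun_sum lc_fun_scale col_op_def poly_val_sum poly_val_scale poly_val_rename)

text \<open>Renaming acts on polynomials from the left and on tensors from the right, so the tensor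
  is symmetrized along rows before it is antisymmetrized along columns.\<close>

lemma tensor_val_young:
  "tensor_val f (tensor_col lam (tensor_row lam (single w 1))) r c
    = poly_val d (\<lambda>i. gen (w i)) (young_op lam rename_vars f) r c"
proof -
  have "tensor_val f (tensor_col lam (tensor_row lam (single w 1))) r c
      = (\<Sum>p\<in>row_stabilizer lam. tensor_val f (tensor_col lam (single (w \<circ> p) 1)) r c)"
    by (simp add: tensor_row_def lc_lin_sum[OF lc_lin_tensor_col] tensor_val_def lc_fun_sum)
  then show ?thesis
    unfolding tensor_val_col[OF refl] by (simp add: young_op_def row_op_def poly_val_sum poly_val_rename)
qed

text \<open>By equivariance the tensors at which \<open>f\<close> vanishes are stable under so3, so
  it is enough that the generating tensor is among them.\<close>

lemma tensor_val_so3_orbit: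
  assumes lam: "sum_list lam = m" and f: "f \<in> multilinear_part m"
    and 0: "\<And>r c. r < d \<Longrightarrow> c < d \<Longrightarrow> poly_val d (\<lambda>i. gen (superstandard lam i)) (col_op lam rename_vars f) r c = 0"
    and x: "x \<in> lc.span (so3_orbit lam)" and "r < d" "c < d"
  shows "tensor_val f x r c = 0"
proof -
  let ?K = "{\<tau>. \<forall>r<d. \<forall>c<d. tensor_val f \<tau> r c = 0}"
  have "lc.subspace ?K"
    unfolding lc.subspace_def by (simp add: tensor_val_def lc_fun_add lc_fun_scale)
  moreover have "so3_orbit lam \<subseteq> ?K"
  proof
    fix \<tau> assume "\<tau> \<in> so3_orbit lam"
    then show "\<tau> \<in> ?K"
    proof induction
      case base
      then show ?case using 0 by (simp add: tensor_val_col[OF refl])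
    next
      case (step x k)
      then show ?case
        by (simp add: tensor_val_equivariant[OF f, unfolded lam[symmetric]] bracket_def)
    qed
  qed
  ultimately have "lc.span (so3_orbit lam) \<subseteq> ?K" by (intro lc.span_minimal)
  then show ?thesis using assms by blast
qed

text \<open>By multilinearity it suffices to substitute basis vectors, and only the first
  \<open>m\<close> arguments matter, so \<open>w\<close> can be normalised to 0 beyond them.\<close>

lemma weak_identity_iff:
  assumes f: "f \<in> multilinear_part m"
  shows "f \<in> weak_identities d \<rho> \<longleftrightarrow>
    (\<forall>w. (\<forall>t<m. w t < 3) \<longrightarrow> (\<forall>t. \<not> t < m \<longrightarrow> w t = 0) \<longrightarrow> (\<forall>r<d. \<forall>c<d. poly_val d (\<lambda>i. gen (w i)) f r c = 0))"
    (is "?L \<longleftrightarrow> ?R")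
proof
  have eval: "free_alg_eval d (\<lambda>i. \<rho> (A i)) f $$ (r, c) = poly_val d (\<lambda>i. entry (A i)) f r c"
    if "f \<in> free_alg_vars l" "\<And>i. i < l \<Longrightarrow> A i \<in> sl2" and rc: "r < d" "c < d" for A l r c
  proof -
    have "word_eval d (\<lambda>i. \<rho> (A i)) w $$ (r, c) = word_val d (\<lambda>i. entry (A i)) (letters w) r c"
      if w: "w \<in> keys f" for w
    proof -
      have "A i \<in> sl2" if "i \<in> set (letters w)" for i
        using that w \<open>f \<in> free_alg_vars l\<close> \<open>\<And>i. i < l \<Longrightarrow> A i \<in> sl2\<close> by (auto simp: free_alg_vars_def)
      then have c: "\<rho> (A i) \<in> carrier_mat d d" if "i \<in> set (letters w)" for i
        using that rep_carrier by blast
      \<comment> \<open>Setting entries outside the square to 0 does not affect the entries of a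
        product inside it.\<close>
      have cut: "word_val d Y L r c = word_val d (\<lambda>i r c. if r < d \<and> c < d then Y i r c else 0) L r c"
        if "r < d" for Y L r
        using that rc(2)
      proof (induction L arbitrary: r)
        case (Cons i L)
        then show ?case by (auto intro!: sum.cong)
      qed simp
      have "word_eval d (\<lambda>i. \<rho> (A i)) w $$ (r, c) = word_val d (\<lambda>i r c. \<rho> (A i) $$ (r, c)) (letters w) r c"
        using word_eval_entry[OF c rc] by (cases w) simp
      then show ?thesis
        by (subst (asm) cut[OF rc(1)]) (simp add: entry_def[abs_def])
    qed
    then show ?thesis
      using rc by (simp add: free_alg_eval_def poly_val_def lc_fun_def)
  qed
  have fm: "f \<in> free_alg_vars m"
    using multilinear_letters[OF f] by (simp add: free_alg_vars_def)
  {
    assume L: ?L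
    show ?R
    proof (intro allI impI)
      fix w :: "nat \<Rightarrow> nat" and r c assume rc: "r < d" "c < d"
      have "free_alg_eval d (\<lambda>i. \<rho> (sl2_basis (w i))) f = 0\<^sub>m d d"
        using L fm unfolding weak_identities_def by (auto dest!: spec[where x=m])
      then show "poly_val d (\<lambda>i. gen (w i)) f r c = 0"
        using eval[OF fm, of "\<lambda>i. sl2_basis (w i)", OF _ rc] rc by (simp add: gen_def)
    qed
  next
    assume R: ?R
    show ?L
      unfolding weak_identities_def
    proof (intro CollectI allI impI)
      fix l A assume fl: "f \<in> free_alg_vars l" and A: "\<forall>i<l. A i \<in> sl2"
      \<comment> \<open>\<open>weak_identities\<close> ranges over all \<open>l\<close> with
        \<open>f\<close> in \<open>free_alg_vars l\<close>, so \<open>l\<close> may differ from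
        \<open>m\<close>; beyond \<open>l\<close> an arbitrary element of \<open>sl2\<close> is
        filled in.\<close>
      define A' where "A' i = (if i < l then A i else sl2_H)" for i
      have "\<exists>a :: nat \<Rightarrow> complex. entry (A' i) = (\<lambda>r c. \<Sum>j<3. a j * gen j r c)" for i
      proof -
        have "A' i \<in> sl2" using A by (simp add: A'_def)
        then obtain a :: "nat \<Rightarrow> complex" where
          "A' i = a 0 \<cdot>\<^sub>m sl2_basis 0 + (a 1 \<cdot>\<^sub>m sl2_basis 1 + a 2 \<cdot>\<^sub>m sl2_basis 2)"
          using sl2_decompose by blast
        from entry_combination[OF this] show ?thesis by blast
      qed
      then have "\<forall>i. \<exists>a :: nat \<Rightarrow> complex. entry (A' i) = (\<lambda>r c. \<Sum>j<3. a j * gen j r c)" ..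
      from choice[OF this] obtain a :: "nat \<Rightarrow> nat \<Rightarrow> complex"
        where a: "\<And>i. entry (A' i) = (\<lambda>r c. \<Sum>j<3. a i j * gen j r c)" by blast
      have val0: "poly_val d (\<lambda>i. entry (A' i)) f r c = 0" if rc: "r < d" "c < d" for r c
      proof -
        \<comment> \<open>Induction on the number \<open>n\<close> of leading arguments that are
          general elements while the others are still basis vectors.\<close>
        have "poly_val d (\<lambda>i. if i < n then entry (A' i) else gen (w i)) f r c = 0"
          if "n \<le> m" "\<forall>t<m. w t < 3" "\<forall>t. \<not> t < m \<longrightarrow> w t = 0" for n w
          using that
        proof (induction n arbitrary: w)
          case 0
          then show ?case using R rc by simp
        next
          case (Suc n)
          let ?Z = "\<lambda>i. if i < n then entry (A' i) else gen (w i)"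
          have "(\<lambda>i. if i < Suc n then entry (A' i) else gen (w i)) = ?Z(n := \<lambda>r c. \<Sum>j<3. a n j * gen j r c)"
            using a[of n] by (auto simp: fun_eq_iff less_Suc_eq)
          then have "poly_val d (\<lambda>i. if i < Suc n then entry (A' i) else gen (w i)) f r c
              = (\<Sum>j<3. a n j * poly_val d (?Z(n := gen j)) f r c)"
            using poly_val_multilinear[OF f, of n d ?Z "a n" gen "{..<3}" r c] Suc.prems(1) by simp
          also have "\<dots> = 0"
          proof (intro sum.neutral ballI)
            fix j :: nat assume "j \<in> {..<3}"
            have "?Z(n := gen j) = (\<lambda>i. if i < n then entry (A' i) else gen ((w(n := j)) i))" by auto
            moreover have "poly_val d (\<lambda>i. if i < n then entry (A' i) else gen ((w(n := j)) i)) f r c = 0"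
              using Suc.prems \<open>j \<in> {..<3}\<close> by (intro Suc.IH) auto
            ultimately show "a n j * poly_val d (?Z(n := gen j)) f r c = 0" by simp
          qed
          finally show ?case .
        qed
        from this[of m "\<lambda>_. 0"] have "poly_val d (\<lambda>i. if i < m then entry (A' i) else gen 0) f r c = 0" by simp
        moreover have "poly_val d (\<lambda>i. if i < m then entry (A' i) else gen 0) f r c = poly_val d (\<lambda>i. entry (A' i)) f r c"
          by (rule poly_val_cong[OF f]) simp
        ultimately show ?thesis by simp
      qed
      have A_A': "poly_val d (\<lambda>i. entry (A i)) f r c = poly_val d (\<lambda>i. entry (A' i)) f r c" for r c
        unfolding poly_val_def using fl
        by (intro lc_fun_cong word_val_cong) (auto simp: free_alg_vars_def A'_def)
      show "free_alg_eval d (\<lambda>i. \<rho> (A i)) f = 0\<^sub>m d d"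
      proof (rule eq_matI)
        fix r c assume "r < dim_row (0\<^sub>m d d :: complex mat)" "c < dim_col (0\<^sub>m d d :: complex mat)"
        then have rc: "r < d" "c < d" by simp_all
        show "free_alg_eval d (\<lambda>i. \<rho> (A i)) f $$ (r, c) = 0\<^sub>m d d $$ (r, c)"
          using eval[OF fl _ rc, of A] A val0[OF rc] A_A'[of r c] rc by simp
      qed (simp_all add: free_alg_eval_def)
    qed
  }
qed

lemma young_weak_identity:
  assumes lam: "lam \<in> partitions_of m" and len: "length lam \<le> 3" and f: "f \<in> multilinear_part m"
    and 0: "\<And>r c. r < d \<Longrightarrow> c < d \<Longrightarrow> poly_val d (\<lambda>i. gen (superstandard lam i)) (col_op lam rename_vars f) r c = 0"
  shows "young_op lam rename_vars f \<in> weak_identities d \<rho>"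
proof -
  note s = partitions_ofD(1)[OF lam]
  have yf: "young_op lam rename_vars f \<in> multilinear_part m"
    by (rule young_op_subspace[OF subspace_multilinear rename_multilinear s f])
  show ?thesis
    unfolding weak_identity_iff[OF yf] tensor_val_young[symmetric]
    using tensor_val_so3_orbit[OF s f 0] tensor_row_so3_orbit[OF lam len] by blast
qed

text \<open>The first column has at least four boxes, but there are only three basis vectors. So
  every tensor repeats an entry there and its antisymmetrization vanishes.\<close>

lemma young_weak_identity_long:
  assumes lam: "lam \<in> partitions_of m" and len: "length lam > 3" and f: "f \<in> multilinear_part m"
  shows "young_op lam rename_vars f \<in> weak_identities d \<rho>"
proof -
  note s = partitions_ofD(1)[OF lam]
  have yf: "young_op lam rename_vars f \<in> multilinear_part m"
    by (rule young_op_subspace[OF subspace_multilinear rename_multilinear s f])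
  have col0: "tensor_col lam (single w 1) = 0" if w: "\<forall>t<m. w t < 3" for w
  proof -
    let ?t = "\<lambda>i. tableau_entry lam i 0"
    have t: "?t i < m" "tab_row lam (?t i) = i" "tab_col lam (?t i) = 0" if "i < 4" for i
      using tableau_entry_coordinates[of i lam 0] partitions_ofD(3)[OF lam, of i] that len s by auto
    have "\<not> inj_on (\<lambda>i. w (?t i)) {..<4}"
    proof
      assume "inj_on (\<lambda>i. w (?t i)) {..<4}"
      moreover have "(\<lambda>i. w (?t i)) ` {..<4} \<subseteq> {..<3}" using w t by auto
      ultimately have "card {..<4::nat} \<le> card {..<3::nat}" by (intro card_inj_on_le) auto
      then show False by simp
    qed
    then obtain i j where ij: "i < 4" "j < 4" "i \<noteq> j" "w (?t i) = w (?t j)" by (auto simp: inj_on_def)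
    then have "?t i \<noteq> ?t j" using t by metis
    with ij t show ?thesis by (intro tensor_col_vanish[OF s, of "?t i" "?t j"]) auto
  qed
  have "tensor_col lam (tensor_row lam (single w 1)) = 0" if w: "\<forall>t<m. w t < 3" for w
  proof -
    have "tensor_col lam (single (w \<circ> p) 1) = 0" if "p \<in> row_stabilizer lam" for p
      using that stabilizers_subset(1)[OF s] sym_group_less[of p m] w by (intro col0) auto
    then show ?thesis by (simp add: tensor_row_def lc_lin_sum[OF lc_lin_tensor_col])
  qed
  then show ?thesis
    unfolding weak_identity_iff[OF yf] tensor_val_young[symmetric] by (simp add: tensor_val_def)
qed

lemma multilinear_module:
  "sym_module rename_vars (multilinear_part m) (weak_identities d \<rho> \<inter> multilinear_part m) m"
proof
  let ?W = "weak_identities d \<rho> \<inter> multilinear_part m"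
  show "lc.subspace (multilinear_part m)" by (rule subspace_multilinear)
  show "lc.subspace ?W"
    unfolding lc.subspace_def
  proof (intro conjI ballI allI)
    show "0 \<in> ?W" using weak_identity_iff[OF lc.subspace_0[OF subspace_multilinear], of m] lc.subspace_0[OF subspace_multilinear]
      by (simp add: poly_val_def)
    fix x y a assume x: "x \<in> ?W"
    then show "lc_scale a x \<in> ?W"
      using weak_identity_iff[of x m] weak_identity_iff[of "lc_scale a x" m] lc.subspace_scale[OF subspace_multilinear, of x m a]
      by (simp add: poly_val_scale)
    assume y: "y \<in> ?W"
    show "x + y \<in> ?W"
      using x y weak_identity_iff[of x m] weak_identity_iff[of y m] weak_identity_iff[of "x + y" m] lc.subspace_add[OF subspace_multilinear, of x m y]
      by (simp add: poly_val_add)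
  qed
  show "\<exists>S. finite S \<and> multilinear_part m \<subseteq> lc.span S"
    unfolding multilinear_part_def
    by (intro exI[of _ "(\<lambda>p. single (Word (map p [0..<m])) 1) ` sym_group m"]) simp
  show "rename_vars g v \<in> multilinear_part m" if "g \<in> sym_group m" "v \<in> multilinear_part m" for g v
    using that by (rule rename_multilinear)
  show "rename_vars g v \<in> ?W" if g: "g \<in> sym_group m" and v: "v \<in> ?W" for g v
  proof -
    have gv: "rename_vars g v \<in> multilinear_part m" using g v by (simp add: rename_multilinear)
    moreover have "rename_vars g v \<in> weak_identities d \<rho>"
      unfolding weak_identity_iff[OF gv] poly_val_rename
    proof (intro allI impI)
      fix w r c assume w: "\<forall>t<m. w t < 3" "\<forall>t. \<not> t < m \<longrightarrow> w t = (0::nat)" and rc: "r < d" "c < d"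
      have "\<forall>t<m. (w \<circ> g) t < 3" "\<forall>t. \<not> t < m \<longrightarrow> (w \<circ> g) t = 0"
        using w sym_group_less[OF g] by auto
      moreover have "v \<in> multilinear_part m" "v \<in> weak_identities d \<rho>" using v by auto
      ultimately have "poly_val d (\<lambda>i. gen ((w \<circ> g) i)) v r c = 0"
        using weak_identity_iff rc by blast
      then show "poly_val d (\<lambda>i. gen (w (g i))) v r c = 0" by simp
    qed
    ultimately show ?thesis by simp
  qed
qed simp

end

section \<open>Matrices with a parity\<close>

text \<open>The Klein four-group acts on the matrices by conjugation with \<open>diag(1,-1,1,\<dots>)\<close> and with the
  reversal of the basis; \<open>s\<close> and \<open>p\<close> describe a character of it.\<close>

definition parity_class :: "nat \<Rightarrow> complex \<Rightarrow> nat \<Rightarrow> (nat \<Rightarrow> nat \<Rightarrow> complex) \<Rightarrow> bool" where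
  "parity_class n s p M \<longleftrightarrow> (\<forall>r<n. \<forall>c<n. (odd (r + c + p) \<longrightarrow> M r c = 0) \<and>
     M (n - Suc r) (n - Suc c) = s * M r c)"

lemma parity_class_mult:
  assumes A: "parity_class n s p A" and B: "parity_class n t q B"
  shows "parity_class n (s * t) (p + q) (\<lambda>r c. \<Sum>u<n. A r u * B u c)"
  unfolding parity_class_def
proof (intro allI impI conjI)
  fix r c assume rc: "r < n" "c < n"
  show "(\<Sum>u<n. A r u * B u c) = 0" if odd: "odd (r + c + (p + q))"
  proof (rule sum.neutral, rule ballI)
    fix u assume "u \<in> {..<n}"
    moreover have "odd (r + u + p) \<or> odd (u + c + q)" using odd by presburger
    ultimately show "A r u * B u c = 0" using A B rc unfolding parity_class_def by auto
  qed
  have "(\<Sum>u<n. A (n - Suc r) u * B u (n - Suc c)) = (\<Sum>u<n. A (n - Suc r) (n - Suc u) * B (n - Suc u) (n - Suc c))"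
    by (rule sum.nat_diff_reindex[symmetric])
  also have "\<dots> = (\<Sum>u<n. s * t * (A r u * B u c))"
    using A B rc unfolding parity_class_def by (intro sum.cong refl) (simp add: mult_ac)
  finally show "(\<Sum>u<n. A (n - Suc r) u * B u (n - Suc c)) = s * t * (\<Sum>u<n. A r u * B u c)"
    by (simp add: sum_distrib_left)
qed

text \<open>Reversing the basis negates H and exchanges E and F, so only \<open>sl2_basis 1\<close>,
  a multiple of E + F, is fixed.\<close>

definition rep_sign :: "nat \<Rightarrow> complex" where
  "rep_sign k = (if k = 1 then 1 else -1)"

text \<open>H is diagonal, whereas E and F shift the index by one.\<close>

definition rep_parity :: "nat \<Rightarrow> nat" where
  "rep_parity k = (if k = 0 then 0 else 1)"

lemma parity_class_std: "parity_class n (rep_sign k) (rep_parity k) (std_rep n k)"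
  unfolding parity_class_def
proof (intro allI impI conjI)
  fix r c assume rc: "r < n" "c < n"
  show "std_rep n k r c = 0" if "odd (r + c + rep_parity k)"
    using that by (auto simp: std_rep_def rep_parity_def split: if_splits)
  have "n - Suc r = n - Suc c \<longleftrightarrow> r = c" "Suc (n - Suc r) = n - Suc c \<longleftrightarrow> r = Suc c"
    "n - Suc r = Suc (n - Suc c) \<longleftrightarrow> Suc r = c" using rc by auto
  then show "std_rep n k (n - Suc r) (n - Suc c) = rep_sign k * std_rep n k r c"
    using rc by (auto simp: std_rep_def rep_sign_def of_nat_diff Let_def algebra_simps)
qed

lemma parity_class_word:
  "parity_class n (prod_list (map (\<lambda>i. rep_sign (w i)) L)) (sum_list (map (\<lambda>i. rep_parity (w i)) L))
     (word_val n (\<lambda>i. std_rep n (w i)) L)"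
proof (induction L)
  case Nil
  then show ?case by (auto simp: parity_class_def)
next
  case (Cons i L)
  from parity_class_mult[OF parity_class_std[of n "w i"] Cons] show ?case by simp
qed

lemma parity_class_poly_val:
  assumes f: "f \<in> multilinear_part m"
  shows "parity_class n (\<Prod>i<m. rep_sign (w i)) (\<Sum>i<m. rep_parity (w i)) (poly_val n (\<lambda>i. std_rep n (w i)) f)"
proof -
  have "parity_class n (\<Prod>i<m. rep_sign (w i)) (\<Sum>i<m. rep_parity (w i)) (word_val n (\<lambda>i. std_rep n (w i)) (letters v))"
    if "v \<in> keys f" for v
    using parity_class_word[of n w "letters v"] multilinear_letters[OF f that]
    by (metis prod.distinct_set_conv_list sum.distinct_set_conv_list)
  note v = this[unfolded parity_class_def]
  show ?thesis
    unfolding parity_class_def poly_val_def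
  proof (intro allI impI conjI)
    fix r c assume rc: "r < n" "c < n"
    show "lc_fun (\<lambda>v. word_val n (\<lambda>i. std_rep n (w i)) (letters v) r c) f = 0"
      if "odd (r + c + (\<Sum>i<m. rep_parity (w i)))"
      using v rc that by (simp add: lc_fun_def)
    show "lc_fun (\<lambda>v. word_val n (\<lambda>i. std_rep n (w i)) (letters v) (n - Suc r) (n - Suc c)) f
        = (\<Prod>i<m. rep_sign (w i)) * lc_fun (\<lambda>v. word_val n (\<lambda>i. std_rep n (w i)) (letters v) r c) f"
      using v rc by (simp add: lc_fun_def sum_distrib_left mult_ac)
  qed
qed

text \<open>One entry from each orbit of the half-turn of the square, the first in row-by-row order,
  within one colour of the checkerboard. A list rather than a set, so that small cases can be
  counted by evaluation.\<close>

definition half_entries :: "nat \<Rightarrow> nat \<Rightarrow> (nat \<times> nat) list" where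
  "half_entries n p = filter (\<lambda>(r, c). even (r + c + p) \<and> r * n + c \<le> (n - Suc r) * n + (n - Suc c))
     (List.product [0..<n] [0..<n])"

lemma parity_class_zero:
  assumes M: "parity_class n s p M" and 0: "\<And>r c. (r, c) \<in> set (half_entries n p) \<Longrightarrow> M r c = 0"
    and s: "s \<noteq> 0" and rc: "r < n" "c < n"
  shows "M r c = 0"
proof (cases "even (r + c + p)")
  case True
  let ?r = "n - Suc r" and ?c = "n - Suc c"
  have rc': "?r < n" "?c < n" "n - Suc ?r = r" "n - Suc ?c = c" using rc by auto
  \<comment> \<open>The half-turn preserves the colour of the checkerboard.\<close>
  have "?r + ?c + p + (r + c + p) + 2 = 2 * n + 2 * p" using rc by simp
  then have "even (?r + ?c + p)" using True by presburger
  moreover consider "r * n + c \<le> ?r * n + ?c" | "?r * n + ?c \<le> r * n + c" by linarith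
  ultimately have "(r, c) \<in> set (half_entries n p) \<or> (?r, ?c) \<in> set (half_entries n p)"
    using True rc rc' by cases (auto simp: half_entries_def)
  then have "M r c = 0 \<or> M ?r ?c = 0" using 0 by blast
  moreover have "M ?r ?c = s * M r c" using M rc unfolding parity_class_def by blast
  ultimately show ?thesis using s by simp
qed (use M rc in \<open>auto simp: parity_class_def\<close>)

lemma half_entries_mod: "half_entries n p = half_entries n (p mod 2)"
  by (simp add: half_entries_def)

text \<open>The start is 25 \<le> 27; at 4 the inequality fails, since 16 > 9.\<close>

lemma square_le_power3: "n \<ge> 5 \<Longrightarrow> n * n \<le> 3 ^ (n - 2 :: nat)"
proof (induction n rule: nat_induct_at_least)
  case (Suc n)
  have "5 * n \<le> n * n" using Suc.hyps by (rule mult_le_mono1)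
  moreover have "Suc n * Suc n = n * n + 2 * n + 1" by simp
  ultimately have "Suc n * Suc n \<le> 3 * (n * n)" using Suc.hyps by linarith
  also have "\<dots> \<le> 3 * 3 ^ (n - 2)" using Suc.IH by simp
  also have "\<dots> = 3 ^ Suc (n - 2)" by simp
  also have "Suc (n - 2) = Suc n - 2" using Suc.hyps by simp
  finally show ?case .
qed simp

text \<open>From 5 on it is enough to count all entries of the square. The cases 2, 3 and 4 are
  settled by evaluation; the bounds 1 for \<open>n = 2\<close> and 3 for \<open>n = 3\<close> are
  attained.\<close>

lemma length_half_entries:
  assumes "2 \<le> n"
  shows "length (half_entries n p) \<le> 3 ^ (n - 2)"
proof -
  have p: "p mod 2 = 0 \<or> p mod 2 = 1" by auto
  consider "n = 2" | "n = 3" | "n = 4" | "n \<ge> 5" using assms by linarith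
  then show ?thesis
  proof cases
    case 4
    have "length (half_entries n p) \<le> length (List.product [0..<n] [0..<n])"
      unfolding half_entries_def by (rule length_filter_le)
    then show ?thesis using square_le_power3[OF 4] by simp
  next
    case 1
    have "length (half_entries 2 0) \<le> 1" "length (half_entries 2 1) \<le> 1" by code_simp+
    then show ?thesis using p 1 by (subst half_entries_mod) auto
  next
    case 2
    have "length (half_entries 3 0) \<le> 3" "length (half_entries 3 1) \<le> 3" by code_simp+
    then show ?thesis using p 2 by (subst half_entries_mod) auto
  next
    case 3
    have "length (half_entries 4 0) \<le> 9" "length (half_entries 4 1) \<le> 9" by code_simp+
    then show ?thesis using p 3 by (subst half_entries_mod) auto
  qed
qed

section \<open>The bound\<close>

context sl2_irrep
begin

text \<open>With \<open>V\<close> and \<open>v\<close> the values in \<open>\<rho>\<close> and in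
  the standard form, \<open>V P = P v = 0\<close>; and \<open>P\<close> has a right inverse.\<close>

lemma poly_val_zero_if_std:
  assumes f: "f \<in> multilinear_part m" and w: "\<And>t. t < m \<Longrightarrow> w t < 3"
    and P: "\<And>k r c. k < 3 \<Longrightarrow> r < d \<Longrightarrow> c < n \<Longrightarrow>
      (\<Sum>s<d. \<rho> (sl2_basis k) $$ (r, s) * P s c) = (\<Sum>s<n. P r s * std_rep n k s c)"
    and surj: "\<And>r. r < d \<Longrightarrow> \<exists>y. \<forall>s<d. (\<Sum>c<n. P s c * y c) = (if s = r then 1 else 0)"
    and 0: "\<And>r c. r < n \<Longrightarrow> c < n \<Longrightarrow> poly_val n (\<lambda>i. std_rep n (w i)) f r c = 0"
    and rc: "r < d" "c < d"
  shows "poly_val d (\<lambda>i. gen (w i)) f r c = 0"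
proof -
  let ?V = "poly_val d (\<lambda>i. gen (w i)) f" and ?v = "poly_val n (\<lambda>i. std_rep n (w i)) f"
  have VP: "(\<Sum>s<d. ?V r s * P s b) = 0" if b: "b < n" for b
  proof -
    have word: "(\<Sum>s<d. word_val d (\<lambda>i. gen (w i)) (letters v) r s * P s b)
        = (\<Sum>s<n. P r s * word_val n (\<lambda>i. std_rep n (w i)) (letters v) s b)" if "v \<in> keys f" for v
    proof (rule word_val_intertwine[OF _ rc(1) b])
      fix i r c assume i: "i \<in> set (letters v)" and "r < d" "c < n"
      then have "w i < 3" using multilinear_letters(2)[OF f that] w by auto
      from P[OF this \<open>r < d\<close> \<open>c < n\<close>] \<open>r < d\<close>
      show "(\<Sum>s<d. gen (w i) r s * P s c) = (\<Sum>s<n. P r s * std_rep n (w i) s c)"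
        by (simp add: gen_def entry_def)
    qed
    have "(\<Sum>s<d. ?V r s * P s b) = lc_fun (\<lambda>v. \<Sum>s<d. P s b * word_val d (\<lambda>i. gen (w i)) (letters v) r s) f"
      unfolding lc_fun_sum_left by (simp add: poly_val_def mult.commute)
    also have "\<dots> = lc_fun (\<lambda>v. \<Sum>s<n. P r s * word_val n (\<lambda>i. std_rep n (w i)) (letters v) s b) f"
      using word by (intro lc_fun_cong) (simp add: mult.commute)
    also have "\<dots> = (\<Sum>s<n. P r s * ?v s b)"
      unfolding lc_fun_sum_left by (simp add: poly_val_def)
    also have "\<dots> = 0" using 0 b by simp
    finally show ?thesis .
  qed
  obtain y where y: "\<forall>s<d. (\<Sum>b<n. P s b * y b) = (if s = c then 1 else 0)" using surj[OF rc(2)] by blast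
  have "?V r c = (\<Sum>s<d. ?V r s * (\<Sum>b<n. P s b * y b))"
  proof -
    have "(\<Sum>s<d. ?V r s * (\<Sum>b<n. P s b * y b)) = (\<Sum>s<d. if s = c then ?V r s else 0)"
      using y by (intro sum.cong refl) auto
    then show ?thesis using rc by simp
  qed
  also have "\<dots> = (\<Sum>b<n. (\<Sum>s<d. ?V r s * P s b) * y b)"
    unfolding sum_distrib_left sum_distrib_right by (subst sum.swap) (simp add: mult.assoc)
  also have "\<dots> = 0" using VP by simp
  finally show ?thesis .
qed

lemma std_rep_trivial: "n = 1 \<Longrightarrow> r < n \<Longrightarrow> c < n \<Longrightarrow> std_rep n k r c = 0"
  by (simp add: std_rep_def)

lemma cocharacter_bound:
  assumes lam: "lam \<in> partitions_of m" and R: "finite R" "\<And>r. r \<in> R \<Longrightarrow> lin_on (multilinear_part m) (l r)"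
    and l: "\<And>v. v \<in> multilinear_part m \<Longrightarrow> (\<And>r. r \<in> R \<Longrightarrow> l r v = 0) \<Longrightarrow> young_op lam rename_vars v \<in> weak_identities d \<rho>"
  shows "sl2_mult d \<rho> m lam \<le> card R"
proof -
  interpret M: sym_module rename_vars "multilinear_part m" "weak_identities d \<rho> \<inter> multilinear_part m" m
    by (rule multilinear_module)
  have "cocharacter d \<rho> m = M.chr"
    by (simp add: fun_eq_iff cocharacter_def M.chr_def)
  moreover have "char_mult m M.chr lam \<le> card R"
    using l young_op_subspace[OF subspace_multilinear rename_multilinear partitions_ofD(1)[OF lam]]
    by (intro M.char_mult_bound[OF lam R]) auto
  ultimately show ?thesis by (simp add: sl2_mult_def)
qed

text \<open>The functionals are entries of the value of \<open>col_op lam rename_vars f\<close> at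
  the superstandard arguments, taken in the standard form; by parity those listed in
  \<open>half_entries\<close> decide whether the whole value vanishes.\<close>

lemma mult_bound:
  assumes lam: "lam \<in> partitions_of m" and len: "length lam \<le> 3" and m: "1 \<le> m"
  shows "sl2_mult d \<rho> m lam \<le> (if d = 1 then 0 else 3 ^ (d - 2))"
proof (rule irreducible_structure[OF irr])
  fix n P
  assume n: "1 \<le> n" "n \<le> d"
    and P: "\<And>k r c. k < 3 \<Longrightarrow> r < d \<Longrightarrow> c < n \<Longrightarrow>
      (\<Sum>s<d. \<rho> (sl2_basis k) $$ (r, s) * P s c) = (\<Sum>s<n. P r s * std_rep n k s c)"
    and surj: "\<And>r. r < d \<Longrightarrow> \<exists>y. \<forall>s<d. (\<Sum>c<n. P s c * y c) = (if s = r then 1 else 0)"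
  note s = partitions_ofD(1)[OF lam]
  let ?w = "superstandard lam"
  have w3: "?w t < 3" if "t < m" for t
    using tableau_coordinates(1)[of t lam] that s len by (simp add: superstandard_def)
  define p where "p = (\<Sum>i<m. rep_parity (?w i))"
  \<comment> \<open>In dimension one the generators act as zero and, as \<open>m \<ge> 1\<close>, so
    does every word; the empty family then detects vanishing. For \<open>d = 1\<close> this yields
    0, where the truncated exponent would only give 3^0 = 1.\<close>
  define R where "R = (if n = 1 then {} else set (half_entries n p))"
  define l where "l rc f = poly_val n (\<lambda>i. std_rep n (?w i)) (col_op lam rename_vars f) (fst rc) (snd rc)" for rc f
  have "sl2_mult d \<rho> m lam \<le> card R"
  proof (rule cocharacter_bound[OF lam])
    show "finite R" by (simp add: R_def)
    show "lin_on (multilinear_part m) (l rc)" for rc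
      using rename.lin_col_op[of lam] by (simp add: lin_on_def l_def lc_lin_def poly_val_add poly_val_scale)
    fix f assume f: "f \<in> multilinear_part m" and l0: "\<And>rc. rc \<in> R \<Longrightarrow> l rc f = 0"
    let ?g = "col_op lam rename_vars f"
    have g: "?g \<in> multilinear_part m"
      by (rule col_op_subspace[OF subspace_multilinear rename_multilinear s f])
    have "poly_val n (\<lambda>i. std_rep n (?w i)) ?g r c = 0" if rc: "r < n" "c < n" for r c
    proof (cases "n = 1")
      case True
      have "word_val n (\<lambda>i. std_rep n (?w i)) (letters v) r c = 0" if "v \<in> keys ?g" for v
      proof -
        have "set (letters v) \<noteq> {}" using multilinear_letters(2)[OF g that] m by (simp add: lessThan_empty_iff)
        then obtain i L where L: "letters v = i # L" by (cases "letters v") simp_all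
        show ?thesis unfolding L word_val.simps
          by (rule sum.neutral) (simp add: std_rep_trivial[OF True rc(1)])
      qed
      then show ?thesis by (simp add: poly_val_def lc_fun_def)
    next
      case False
      show ?thesis
      proof (rule parity_class_zero[OF parity_class_poly_val[OF g, of n ?w] _ _ rc])
        show "poly_val n (\<lambda>i. std_rep n (?w i)) ?g r c = 0"
          if "(r, c) \<in> set (half_entries n (\<Sum>i<m. rep_parity (?w i)))" for r c
          using l0[of "(r, c)"] that False by (simp add: R_def p_def l_def)
        show "(\<Prod>i<m. rep_sign (?w i)) \<noteq> 0" by (simp add: rep_sign_def)
      qed
    qed
    note std0 = this
    have "poly_val d (\<lambda>i. gen (?w i)) ?g r c = 0" if rc: "r < d" "c < d" for r c
      by (rule poly_val_zero_if_std[where w="?w" and n=n and P=P, OF g]; fact w3 P surj std0 rc)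
    then show "young_op lam rename_vars f \<in> weak_identities d \<rho>"
      by (rule young_weak_identity[OF lam len f])
  qed
  also have "card R \<le> (if d = 1 then 0 else 3 ^ (d - 2))"
  proof (cases "n = 1")
    case True
    then show ?thesis by (simp add: R_def)
  next
    case False
    then have n2: "2 \<le> n" using n by simp
    have "card R \<le> length (half_entries n p)" using False by (simp add: R_def card_length)
    also have "\<dots> \<le> 3 ^ (n - 2)" by (rule length_half_entries[OF n2])
    also have "\<dots> \<le> 3 ^ (d - 2)" using n(2) by (intro power_increasing) auto
    finally show ?thesis using n n2 by simp
  qed
  finally show ?thesis .
qed

lemma mult_long:
  assumes lam: "lam \<in> partitions_of m" and len: "length lam > 3"
  shows "sl2_mult d \<rho> m lam = 0"
proof -
  have "sl2_mult d \<rho> m lam \<le> card ({} :: nat set)"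
    by (rule cocharacter_bound[OF lam, where l="\<lambda>_ _. 0"]) (use young_weak_identity_long[OF lam len] in auto)
  then show ?thesis by simp
qed

end

theorem theorem1p1:
  fixes d m :: nat and lam :: "nat list" and \<rho> :: "complex mat \<Rightarrow> complex mat"
  assumes "d \<ge> 1" and "m \<ge> 1"
    and "lam \<in> partitions_of m"
    and "irreducible_sl2_rep d \<rho>"
  shows "(sl2_mult d \<rho> m lam \<noteq> 0 \<longrightarrow> length lam \<le> 3) \<and>
         (length lam \<le> 3 \<longrightarrow> real (sl2_mult d \<rho> m lam) \<le> 3 powi (int d - 2))"
proof -
  interpret sl2_irrep d \<rho> by unfold_locales (rule assms)
  show ?thesis
  proof (intro conjI impI)
    show "length lam \<le> 3" if "sl2_mult d \<rho> m lam \<noteq> 0"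
      using mult_long[OF assms(3)] that by (metis not_le_imp_less)
    assume "length lam \<le> 3"
    from mult_bound[OF assms(3) this assms(2)]
    have b: "sl2_mult d \<rho> m lam \<le> (if d = 1 then 0 else 3 ^ (d - 2))" .
    show "real (sl2_mult d \<rho> m lam) \<le> 3 powi (int d - 2)"
    proof (cases "d = 1")
      \<comment> \<open>Here the exponent is -1, and a natural number is at most 1/3 only if it is
        0.\<close>
      case True
      then show ?thesis using b by simp
    next
      case False
      then have "(3::real) powi (int d - 2) = 3 ^ (d - 2)"
        using assms(1) by (simp add: power_int_def nat_diff_distrib)
      moreover have "real (sl2_mult d \<rho> m lam) \<le> real (3 ^ (d - 2))"
        using b False by (simp only: of_nat_le_iff if_False)
      ultimately show ?thesis by simp
    qed
  qed
qed

end
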